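(* Let $n\ge2$, and let $\mathfrak{M}_n$ be the $2$-dimensional suspension matchbox manifold whose holonomy pseudogroup is the translation pseudogroup $\mathcal{G}_{\mathfrak{X}_n}$ acting on the space $\mathfrak{X}_n$ of pointed subtrees of the Cayley graph of the free group $\mathbb{F}_n$. Then the transitive Lipschitz matchbox manifold $\mathfrak{M}_n$ is not homeomorphic to an invariant subset of any $C^1$-foliation $\mathcal{F}_M$ of a manifold $M$.
   Context: **Matchbox manifolds.** A foliated space of dimension $k$ is a compact metrizable space $\mathfrak{M}$ for which there is a separable metric space $\mathfrak{X}$ such that each $x\in\mathfrak{M}$ has an open neighborhood $U_x$, a compact set $\mathfrak{X}_x\subset\mathfrak{X}$ and a homeomorphism $\varphi_x\colon \overline{U}_x\to[-1,1]^k\times\mathfrak{X}_x$ with $\varphi_x(x)=(0,w_x)$, $w_x\in \mathrm{int}(\mathfrak{X}_x)$, which extends to a foliated homeomorphism $\widehat U_x\to(-2,2)^k\times\mathfrak{X}_x$ on some $\widehat U_x\supset\overline U_x$. The sets $\varphi_x^{-1}(V\times\{w\})$, $V\subset(-1,1)^k$ open, form a basis of the fine topology, whose connected components are the leaves. The foliated space is smooth if the charts can be chosen so that the transition maps between plaques $\varphi_x^{-1}([-1,1]^k\times\{w\})$ are smooth and depend continuously on the transverse parameter in the $C^\infty$-topology. A matchbox manifold is a connected smooth foliated space for which $\mathfrak{X}$ is totally disconnected and each $\mathfrak{X}_x$ is clopen in $\mathfrak{X}$. Transitive means that some leaf is dense. The holonomy pseudogroup on a transversal is generated by the transverse homeomorphisms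 obtained by following overlapping plaques along leafwise paths. Lipschitz means that there is a metric on the transversal space for which the holonomy pseudogroup is generated by finitely many bi-Lipschitz homeomorphisms between clopen sets. **The space $\mathfrak{X}_n$.** Let $\mathcal{T}_n$ be the Cayley graph of the free group $\mathbb{F}_n$ on $n$ free generators (a tree on which $\mathbb{F}_n$ acts by left translation), with each edge of length $1$, the path-length metric, and basepoint $e$ the identity. Let $B(e,m)$ be the closed ball of radius $m$ about $e$. Let $X_n$ be the set of all connected infinite subtrees $T\subset\mathcal{T}_n$ with $e\in T$ and with no dead ends (no vertex of $T$ is contained in exactly one edge of $T$). Define the metric $d_{\mathfrak{X}_n}$ on $X_n$ by $d(T,T')\le2^{-m}\iff B(e,m)\cap T=B(e,m)\cap T'$, and let $\mathfrak{X}_n$ be the closure (completion) of $X_n$; it is a Cantor set. **The pseudogroup $\mathcal{G}_{\mathfrak{X}_n}$.** For $\gamma\in\mathbb{F}_n$, the map $T\mapsto\gamma^{-1}\cdot T$ is defined on the clopen set $\{T\in\mathfrak{X}_n\mid\gamma\cdot e\in T\}$ and takes values in $\mathfrak{X}_n$. $\mathcal{G}_{\mathfrak{X}_n}$ is the pseudogroup on $\mathfrak{X}_n$ generated by these maps for $\gamma$ a free generator or the inverse of one. **The matchbox manifold $\mathfrak{M}_n$.** $\mathfrak{M}_n$ is a $2$-dimensional matchbox manifold (obtained by suspension) which has a complete transversal identified with $\mathfrak{X}_n$ on which the holonomy pseudogroup is $\mathcal{G}_{\mathfrak{X}_n}$. **Invariant sets.** An invariant subset of a foliation $\mathcal{F}_M$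 of $M$ is a union of leaves; $\mathcal{F}_M$ is understood to have the same leaf dimension as $\mathfrak{M}_n$ and homeomorphisms are understood to carry leaves onto leaves. *)

theory Defs
  imports "HOL-Analysis.Analysis" "HOL-Algebra.Group"
begin

section \<open>Pseudogroups\<close>

text \<open>
  A homeomorphism between open subsets of a space is represented by its graph, so that two
  partial maps are equal iff they have the same domain and the same values on it.
  In this representation \<open>r O s\<close> is ``first \<open>r\<close>, then \<open>s\<close>'' and \<open>Id_on U O r\<close> is the
  restriction of \<open>r\<close> to \<open>U\<close>.
\<close>

definition graph_on :: "'t set \<Rightarrow> ('t \<Rightarrow> 't) \<Rightarrow> ('t \<times> 't) set" where
  "graph_on W f = {(u, f u) | u. u \<in> W}"

definition partial_homeo :: "'t topology \<Rightarrow> ('t \<times> 't) set \<Rightarrow> bool" where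
  "partial_homeo T r \<longleftrightarrow>
     (\<exists>W W' f. openin T W \<and> openin T W' \<and>
        homeomorphic_map (subtopology T W) (subtopology T W') f \<and> r = graph_on W f)"

definition pseudogroup :: "'t topology \<Rightarrow> ('t \<times> 't) set set \<Rightarrow> bool" where
  "pseudogroup T G \<longleftrightarrow>
     (\<forall>r\<in>G. partial_homeo T r) \<and>
     Id_on (topspace T) \<in> G \<and>
     (\<forall>r\<in>G. r\<inverse> \<in> G) \<and>
     (\<forall>r\<in>G. \<forall>s\<in>G. r O s \<in> G) \<and>
     (\<forall>r\<in>G. \<forall>U. openin T U \<longrightarrow> Id_on U O r \<in> G) \<and>
     (\<forall>r. partial_homeo T r \<and>
          (\<forall>u\<in>Domain r. \<exists>U. openin T U \<and> u \<in> U \<and> Id_on U O r \<in> G) \<longrightarrow> r \<in> G)"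

text \<open>Only meaningful if all members of \<open>\<Gamma>\<close> satisfy \<^const>\<open>partial_homeo\<close>.\<close>

definition generated_pseudogroup ::
    "'t topology \<Rightarrow> ('t \<times> 't) set set \<Rightarrow> ('t \<times> 't) set set" where
  "generated_pseudogroup T \<Gamma> = \<Inter> {G. pseudogroup T G \<and> \<Gamma> \<subseteq> G}"

definition clopen_bi_lipschitz :: "'t metric \<Rightarrow> ('t \<times> 't) set \<Rightarrow> bool" where
  "clopen_bi_lipschitz d r \<longleftrightarrow>
     partial_homeo (mtopology_of d) r \<and>
     closedin (mtopology_of d) (Domain r) \<and> closedin (mtopology_of d) (Range r) \<and>
     (\<exists>B. \<forall>(u, u') \<in> r. \<forall>(v, v') \<in> r.
        mdist d u' v' \<le> B * mdist d u v \<and> mdist d u v \<le> B * mdist d u' v')"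


section \<open>Foliated spaces and matchbox manifolds\<close>

text \<open>
  The chart at a point \<open>x\<close>: \<open>chart_core\<close> is the open set \<open>U\<^sub>x\<close> whose closure is mapped onto
  \<open>[-1,1]\<^sup>k \<times> \<X>\<^sub>x\<close>, \<open>chart_ext\<close> is the larger set mapped onto \<open>(-2,2)\<^sup>k \<times> \<X>\<^sub>x\<close>, \<open>chart_trans\<close> is
  \<open>\<X>\<^sub>x\<close>, and \<open>chart_map\<close> is the extended homeomorphism, whose restriction to the closure of
  \<open>U\<^sub>x\<close> is \<open>\<phi>\<^sub>x\<close>. The space \<open>\<real>\<^sup>k\<close> is a Euclidean space type \<open>'e\<close> with \<open>DIM('e) = k\<close>; there
  \<open>cbox (- One) One = [-1,1]\<^sup>k\<close> and \<open>box (- (2 *\<^sub>R One)) (2 *\<^sub>R One) = (-2,2)\<^sup>k\<close>.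
\<close>

record ('a, 'e, 'x) foliated_chart =
  chart_core :: "'a set"
  chart_ext :: "'a set"
  chart_trans :: "'x set"
  chart_map :: "'a \<Rightarrow> 'e \<times> 'x"

definition plaque_piece ::
    "'a topology \<Rightarrow> ('a, 'e::euclidean_space, 'x) foliated_chart \<Rightarrow> 'e set \<Rightarrow> 'x \<Rightarrow> 'a set" where
  "plaque_piece M c V w =
     {z \<in> M closure_of chart_core c. fst (chart_map c z) \<in> V \<and> snd (chart_map c z) = w}"

definition plaque_basis ::
    "'a topology \<Rightarrow> ('a \<Rightarrow> ('a, 'e::euclidean_space, 'x) foliated_chart) \<Rightarrow> 'a set set" where
  "plaque_basis M chart =
     {plaque_piece M (chart x) V w | x V w.
        x \<in> topspace M \<and> open V \<and> V \<subseteq> box (- One) One \<and> w \<in> chart_trans (chart x)}"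

definition fine_topology ::
    "'a topology \<Rightarrow> ('a \<Rightarrow> ('a, 'e::euclidean_space, 'x) foliated_chart) \<Rightarrow> 'a topology" where
  "fine_topology M chart = topology_generated_by (plaque_basis M chart)"

definition leaves ::
    "'a topology \<Rightarrow> ('a \<Rightarrow> ('a, 'e::euclidean_space, 'x) foliated_chart) \<Rightarrow> 'a set set" where
  "leaves M chart = connected_components_of (fine_topology M chart)"

text \<open>
  The requirement that the extension to \<open>chart_ext\<close> be foliated is that it is also a
  homeomorphism for the fine topology on the source and the fine topology of the product (the
  product topology with the transversal made discrete) on the target.
\<close>

locale foliated_space =
  fixes M :: "'a topology"
    and X :: "'x metric"
    and chart :: "'a \<Rightarrow> ('a, 'e::euclidean_space, 'x) foliated_chart"
  assumes compact: "compact_space M"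
    and metrizable: "metrizable_space M"
    and separable: "separable_space (mtopology_of X)"
    and core_open: "x \<in> topspace M \<Longrightarrow> openin M (chart_core (chart x))"
    and core_mem: "x \<in> topspace M \<Longrightarrow> x \<in> chart_core (chart x)"
    and ext_open: "x \<in> topspace M \<Longrightarrow> openin M (chart_ext (chart x))"
    and core_ext: "x \<in> topspace M \<Longrightarrow> M closure_of chart_core (chart x) \<subseteq> chart_ext (chart x)"
    and trans_compact: "x \<in> topspace M \<Longrightarrow> compactin (mtopology_of X) (chart_trans (chart x))"
    and homeo_core: "x \<in> topspace M \<Longrightarrow>
          homeomorphic_map
            (subtopology M (M closure_of chart_core (chart x)))
            (prod_topology (top_of_set (cbox (- One) One))
               (subtopology (mtopology_of X) (chart_trans (chart x))))
            (chart_map (chart x))"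
    and homeo_ext: "x \<in> topspace M \<Longrightarrow>
          homeomorphic_map
            (subtopology M (chart_ext (chart x)))
            (prod_topology (top_of_set (box (- (2 *\<^sub>R One)) (2 *\<^sub>R One)))
               (subtopology (mtopology_of X) (chart_trans (chart x))))
            (chart_map (chart x))"
    and centered: "x \<in> topspace M \<Longrightarrow> fst (chart_map (chart x) x) = 0"
    and centered_interior: "x \<in> topspace M \<Longrightarrow>
          snd (chart_map (chart x) x) \<in> mtopology_of X interior_of chart_trans (chart x)"
    and basis: "\<lbrakk>P \<in> plaque_basis M chart; Q \<in> plaque_basis M chart; z \<in> P \<inter> Q\<rbrakk> \<Longrightarrow>
          \<exists>R\<in>plaque_basis M chart. z \<in> R \<and> R \<subseteq> P \<inter> Q"
    and foliated_ext: "x \<in> topspace M \<Longrightarrow>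
          homeomorphic_map
            (subtopology (fine_topology M chart) (chart_ext (chart x)))
            (prod_topology (top_of_set (box (- (2 *\<^sub>R One)) (2 *\<^sub>R One)))
               (discrete_topology (chart_trans (chart x))))
            (chart_map (chart x))"

text \<open>
  A family of \<open>C\<^sup>r\<close> maps \<open>\<xi> \<mapsto> F (\<xi>, w)\<close> that depends continuously on \<open>w\<close> in the \<open>C\<^sup>r\<close>-topology:
  all leafwise partial derivatives of order at most \<open>r\<close> exist and are jointly continuous.
  The set \<open>D\<close> is meant to have open slices \<open>{\<xi>. (\<xi>, w) \<in> D}\<close>.
\<close>

primrec leafwise_Ck ::
    "nat \<Rightarrow> 'x topology \<Rightarrow> ('e::euclidean_space \<times> 'x) set \<Rightarrow> ('e \<times> 'x \<Rightarrow> 'e) \<Rightarrow> bool" where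
  "leafwise_Ck 0 T D F \<longleftrightarrow>
     continuous_map (subtopology (prod_topology euclidean T) D) euclidean F"
| "leafwise_Ck (Suc r) T D F \<longleftrightarrow>
     continuous_map (subtopology (prod_topology euclidean T) D) euclidean F \<and>
     (\<exists>F'. (\<forall>(\<xi>, w)\<in>D. ((\<lambda>\<eta>. F (\<eta>, w)) has_derivative F' (\<xi>, w)) (at \<xi>)) \<and>
           (\<forall>b\<in>Basis. leafwise_Ck r T D (\<lambda>p. F' p b)))"

text \<open>
  As usual, smoothness of the transition maps on overlaps of closed plaques means that they
  extend to smooth maps on a neighbourhood.
\<close>

definition smooth_charts ::
    "'a topology \<Rightarrow> 'x metric \<Rightarrow> ('a \<Rightarrow> ('a, 'e::euclidean_space, 'x) foliated_chart) \<Rightarrow> bool" where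
  "smooth_charts M X chart \<longleftrightarrow>
     (\<forall>x\<in>topspace M. \<forall>y\<in>topspace M. \<exists>D F.
        openin (prod_topology euclidean
                  (subtopology (mtopology_of X) (chart_trans (chart x)))) D \<and>
        (\<forall>r. leafwise_Ck r (mtopology_of X) D F) \<and>
        (\<forall>z \<in> M closure_of chart_core (chart x) \<inter> M closure_of chart_core (chart y).
           chart_map (chart x) z \<in> D \<and>
           F (chart_map (chart x) z) = fst (chart_map (chart y) z)))"

locale matchbox_manifold = foliated_space +
  assumes connected: "connected_space M"
    and smooth: "smooth_charts M X chart"
    and totally_disconnected: "connectedin (mtopology_of X) S \<Longrightarrow> \<exists>w. S \<subseteq> {w}"
    and trans_open: "x \<in> topspace M \<Longrightarrow> openin (mtopology_of X) (chart_trans (chart x))"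
    and trans_closed: "x \<in> topspace M \<Longrightarrow> closedin (mtopology_of X) (chart_trans (chart x))"

definition transitive ::
    "'a topology \<Rightarrow> ('a \<Rightarrow> ('a, 'e::euclidean_space, 'x) foliated_chart) \<Rightarrow> bool" where
  "transitive M chart \<longleftrightarrow> (\<exists>L\<in>leaves M chart. M closure_of L = topspace M)"


section \<open>Transversals and holonomy\<close>

abbreviation plaque ::
    "'a topology \<Rightarrow> ('a, 'e::euclidean_space, 'x) foliated_chart \<Rightarrow> 'x \<Rightarrow> 'a set" where
  "plaque M c w \<equiv> plaque_piece M c (box (- One) One) w"

text \<open>
  A transversal is a space \<open>T\<close> with an embedding \<open>\<tau>\<close> into \<open>M\<close> such that locally the transverse
  coordinate of some chart identifies \<open>T\<close> with an open subset of \<open>\<X>\<^sub>y\<close>; it is complete if it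
  meets every leaf.
\<close>

definition complete_transversal ::
    "'a topology \<Rightarrow> 'x metric \<Rightarrow> ('a \<Rightarrow> ('a, 'e::euclidean_space, 'x) foliated_chart) \<Rightarrow>
     't topology \<Rightarrow> ('t \<Rightarrow> 'a) \<Rightarrow> bool" where
  "complete_transversal M X chart T \<tau> \<longleftrightarrow>
     embedding_map T M \<tau> \<and>
     (\<forall>t\<in>topspace T. \<exists>y\<in>topspace M. \<exists>W V.
        openin T W \<and> t \<in> W \<and> \<tau> ` W \<subseteq> (\<Union>w\<in>chart_trans (chart y). plaque M (chart y) w) \<and>
        openin (subtopology (mtopology_of X) (chart_trans (chart y))) V \<and>
        homeomorphic_map (subtopology T W) (subtopology (mtopology_of X) V)
          (\<lambda>u. snd (chart_map (chart y) (\<tau> u)))) \<and>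
     (\<forall>L\<in>leaves M chart. L \<inter> \<tau> ` topspace T \<noteq> {})"

text \<open>
  The map with graph \<open>r\<close> is obtained by following the plaques of a chain of charts
  \<open>y 0, \<dots>, y m\<close>. The points \<open>p i u\<close> mark the path: \<open>p i u\<close> and \<open>p (Suc i) u\<close> lie in a common
  plaque of the chart \<open>y i\<close>, so the consecutive plaques overlap in \<open>p (Suc i) u\<close>. Continuity of
  \<open>p i\<close> in \<open>u\<close> guarantees that neighbouring points of the transversal follow the same path also
  if a plaque meets several plaques of another chart.
\<close>

definition holonomy_transformation ::
    "'a topology \<Rightarrow> ('a \<Rightarrow> ('a, 'e::euclidean_space, 'x) foliated_chart) \<Rightarrow>
     't topology \<Rightarrow> ('t \<Rightarrow> 'a) \<Rightarrow> ('t \<times> 't) set \<Rightarrow> bool" where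
  "holonomy_transformation M chart T \<tau> r \<longleftrightarrow>
     partial_homeo T r \<and>
     (\<exists>(m::nat) y p.
        (\<forall>i\<le>m. y i \<in> topspace M) \<and>
        (\<forall>i\<le>Suc m. continuous_map (subtopology T (Domain r)) M (p i)) \<and>
        (\<forall>(u, v)\<in>r. p 0 u = \<tau> u \<and> p (Suc m) u = \<tau> v) \<and>
        (\<forall>i\<le>m. \<forall>u\<in>Domain r. \<exists>w\<in>chart_trans (chart (y i)).
           p i u \<in> plaque M (chart (y i)) w \<and> p (Suc i) u \<in> plaque M (chart (y i)) w))"

definition holonomy_pseudogroup ::
    "'a topology \<Rightarrow> ('a \<Rightarrow> ('a, 'e::euclidean_space, 'x) foliated_chart) \<Rightarrow>
     't topology \<Rightarrow> ('t \<Rightarrow> 'a) \<Rightarrow> ('t \<times> 't) set set" where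
  "holonomy_pseudogroup M chart T \<tau> =
     generated_pseudogroup T {r. holonomy_transformation M chart T \<tau> r}"

definition lipschitz_transversal ::
    "'a topology \<Rightarrow> ('a \<Rightarrow> ('a, 'e::euclidean_space, 'x) foliated_chart) \<Rightarrow>
     't topology \<Rightarrow> ('t \<Rightarrow> 'a) \<Rightarrow> bool" where
  "lipschitz_transversal M chart T \<tau> \<longleftrightarrow>
     (\<exists>d \<Gamma>. mtopology_of d = T \<and> finite \<Gamma> \<and> (\<forall>r\<in>\<Gamma>. clopen_bi_lipschitz d r) \<and>
        holonomy_pseudogroup M chart T \<tau> = generated_pseudogroup T \<Gamma>)"


section \<open>The free group and its Cayley graph\<close>

text \<open>
  Elements of the free group are reduced words; the letter \<open>(i, True)\<close> is the \<open>i\<close>-th free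
  generator and \<open>(i, False)\<close> is its inverse.
\<close>

type_synonym word = "(nat \<times> bool) list"

definition flip :: "nat \<times> bool \<Rightarrow> nat \<times> bool" where
  "flip a = (fst a, \<not> snd a)"

fun cancel_cons :: "nat \<times> bool \<Rightarrow> word \<Rightarrow> word" where
  "cancel_cons a [] = [a]"
| "cancel_cons a (b # w) = (if b = flip a then w else a # b # w)"

definition free_group :: "nat \<Rightarrow> word monoid" where
  "free_group n =
     \<lparr>carrier = {w. set w \<subseteq> {..<n} \<times> UNIV \<and> successively (\<lambda>a b. b \<noteq> flip a) w},
      mult = (\<lambda>u v. foldr cancel_cons u v),
      one = []\<rparr>"

lemma flip_flip [simp]: "flip (flip a) = a"
  by (simp add: flip_def)

lemma flip_mem [simp]: "flip a \<in> {..<n} \<times> UNIV \<longleftrightarrow> a \<in> {..<n} \<times> UNIV"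
  by (cases a) (simp add: flip_def)

lemma flip_neq [simp]: "flip a \<noteq> a"
  by (cases a) (simp add: flip_def)

lemma cancel_cons_closed:
  "w \<in> carrier (free_group n) \<Longrightarrow> a \<in> {..<n} \<times> UNIV \<Longrightarrow>
     cancel_cons a w \<in> carrier (free_group n)"
  by (cases w) (auto simp: free_group_def successively_Cons)

lemma cancel_cons_flip:
  "w \<in> carrier (free_group n) \<Longrightarrow> cancel_cons (flip a) (cancel_cons a w) = w"
  by (cases w; cases "tl w") (auto simp: free_group_def successively_Cons)

lemma foldr_cancel_cons_closed:
  "v \<in> carrier (free_group n) \<Longrightarrow> set u \<subseteq> {..<n} \<times> UNIV \<Longrightarrow>
     foldr cancel_cons u v \<in> carrier (free_group n)"
  by (induction u) (auto intro!: cancel_cons_closed)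

lemma foldr_cancel_cons_cancel_cons:
  assumes "w \<in> carrier (free_group n)" "set u \<subseteq> {..<n} \<times> UNIV"
  shows "foldr cancel_cons (cancel_cons a u) w = cancel_cons a (foldr cancel_cons u w)"
proof (cases u)
  case (Cons b u')
  have "foldr cancel_cons u' w \<in> carrier (free_group n)"
    using assms Cons by (intro foldr_cancel_cons_closed) auto
  then show ?thesis
    using Cons cancel_cons_flip[of "foldr cancel_cons u' w" n "flip a"] by auto
qed simp

lemma foldr_cancel_cons_assoc:
  assumes "w \<in> carrier (free_group n)" "v \<in> carrier (free_group n)" "set u \<subseteq> {..<n} \<times> UNIV"
  shows "foldr cancel_cons (foldr cancel_cons u v) w = foldr cancel_cons u (foldr cancel_cons v w)"
  using assms(3)
proof (induction u)
  case (Cons a u)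
  have "set (foldr cancel_cons u v) \<subseteq> {..<n} \<times> UNIV"
    using foldr_cancel_cons_closed[OF assms(2), of u] Cons.prems by (auto simp: free_group_def)
  then show ?case
    using Cons foldr_cancel_cons_cancel_cons[OF assms(1)] by simp
qed simp

lemma foldr_cancel_cons_Nil:
  "u \<in> carrier (free_group n) \<Longrightarrow> foldr cancel_cons u [] = u"
proof (induction u)
  case (Cons a u)
  then have "foldr cancel_cons u [] = u"
    by (auto simp: free_group_def successively_Cons)
  then show ?case
    using Cons.prems by (cases u) (auto simp: free_group_def)
qed simp

lemma foldr_cancel_cons_inverse:
  assumes "v \<in> carrier (free_group n)" "set u \<subseteq> {..<n} \<times> UNIV"
  shows "foldr cancel_cons (map flip (rev u)) (foldr cancel_cons u v) = v"
  using assms(2)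
proof (induction u)
  case (Cons a u)
  then show ?case
    using cancel_cons_flip[OF foldr_cancel_cons_closed[OF assms(1), of u]] by simp
qed simp

lemma flip_word_closed:
  assumes "u \<in> carrier (free_group n)"
  shows "map flip (rev u) \<in> carrier (free_group n)"
proof -
  have "successively (\<lambda>a b. b \<noteq> flip a) (map flip (rev u))"
    using assms unfolding successively_map successively_rev
    by (auto simp: free_group_def elim!: successively_mono)
  moreover have "set (map flip (rev u)) \<subseteq> {..<n} \<times> UNIV"
    using assms by (auto simp: free_group_def flip_def)
  ultimately show ?thesis
    by (simp add: free_group_def)
qed

lemma group_free_group: "group (free_group n)"
proof (rule groupI)
  fix u assume u: "u \<in> carrier (free_group n)"
  show "\<exists>v\<in>carrier (free_group n). v \<otimes>\<^bsub>free_group n\<^esub> u = \<one>\<^bsub>free_group n\<^esub>"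
  proof
    show "map flip (rev u) \<otimes>\<^bsub>free_group n\<^esub> u = \<one>\<^bsub>free_group n\<^esub>"
      using foldr_cancel_cons_inverse[of "[]" n u] foldr_cancel_cons_Nil[OF u] u
      by (simp add: free_group_def)
  qed (rule flip_word_closed[OF u])
next
  fix u v assume "u \<in> carrier (free_group n)" "v \<in> carrier (free_group n)"
  then show "u \<otimes>\<^bsub>free_group n\<^esub> v \<in> carrier (free_group n)"
    using foldr_cancel_cons_closed[of v n u] by (simp add: free_group_def)
next
  fix u v w
  assume "u \<in> carrier (free_group n)" "v \<in> carrier (free_group n)" "w \<in> carrier (free_group n)"
  then show "u \<otimes>\<^bsub>free_group n\<^esub> v \<otimes>\<^bsub>free_group n\<^esub> w = u \<otimes>\<^bsub>free_group n\<^esub> (v \<otimes>\<^bsub>free_group n\<^esub> w)"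
    using foldr_cancel_cons_assoc[of w n v u] by (simp add: free_group_def)
qed (auto simp: free_group_def)

definition free_generators :: "nat \<Rightarrow> word set" where
  "free_generators n = {[(i, True)] | i. i < n}"

definition cayley_edges :: "nat \<Rightarrow> word set set" where
  "cayley_edges n =
     {{g, g \<otimes>\<^bsub>free_group n\<^esub> s} | g s. g \<in> carrier (free_group n) \<and> s \<in> free_generators n}"


section \<open>The space of pointed subtrees and its translation pseudogroup\<close>

text \<open>
  A subgraph without isolated vertices is represented by its set \<open>t\<close> of edges; its set of
  vertices is \<open>\<Union> t\<close>. A connected infinite subgraph has no isolated vertices.
\<close>

type_synonym subgraph = "word set set"

definition adjacency :: "subgraph \<Rightarrow> (word \<times> word) set" where
  "adjacency t = {(g, h). {g, h} \<in> t}"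

definition connected_subgraph :: "subgraph \<Rightarrow> bool" where
  "connected_subgraph t \<longleftrightarrow> (\<forall>g\<in>\<Union> t. \<forall>h\<in>\<Union> t. (g, h) \<in> (adjacency t)\<^sup>*)"

definition pointed_subtrees :: "nat \<Rightarrow> subgraph set" where
  "pointed_subtrees n =
     {t. t \<subseteq> cayley_edges n \<and> connected_subgraph t \<and> infinite t \<and>
         \<one>\<^bsub>free_group n\<^esub> \<in> \<Union> t \<and> (\<forall>g\<in>\<Union> t. card {c \<in> t. g \<in> c} \<noteq> 1)}"

definition ball_vertices :: "nat \<Rightarrow> nat \<Rightarrow> word set" where
  "ball_vertices n m =
     {g. \<exists>k\<le>m. (\<one>\<^bsub>free_group n\<^esub>, g) \<in> adjacency (cayley_edges n) ^^ k}"

text \<open>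
  The ball \<open>B(e,m)\<close>, again as a set of edges. As the Cayley graph is a tree, an edge is contained
  in \<open>B(e,m)\<close> iff its end points are. For connected \<open>t\<close> with an edge at \<open>e\<close>, the edges of \<open>t\<close>
  inside \<open>B(e,m)\<close>, together with \<open>e\<close>, determine the subspace \<open>B(e,m) \<inter> t\<close>.
\<close>

definition cayley_ball :: "nat \<Rightarrow> nat \<Rightarrow> subgraph" where
  "cayley_ball n m = {c \<in> cayley_edges n. c \<subseteq> ball_vertices n m}"

definition tree_dist :: "nat \<Rightarrow> subgraph \<Rightarrow> subgraph \<Rightarrow> real" where
  "tree_dist n t t' = (INF m \<in> {m. cayley_ball n m \<inter> t = cayley_ball n m \<inter> t'}. (1/2) ^ m)"

lemma ball_vertices_mono: "k \<le> m \<Longrightarrow> ball_vertices n k \<subseteq> ball_vertices n m"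
  unfolding ball_vertices_def by (auto intro: order_trans)

lemma cayley_ball_mono: "k \<le> m \<Longrightarrow> cayley_ball n k \<subseteq> cayley_ball n m"
  using ball_vertices_mono unfolding cayley_ball_def by blast

lemma cayley_ball_0: "cayley_ball n 0 = {}"
proof -
  interpret group "free_group n" by (rule group_free_group)
  have ball: "ball_vertices n 0 = {\<one>\<^bsub>free_group n\<^esub>}"
    by (auto simp: ball_vertices_def)
  have False if c: "c \<in> cayley_edges n" and sub: "c \<subseteq> {\<one>\<^bsub>free_group n\<^esub>}" for c
  proof -
    obtain g s where gs: "c = {g, g \<otimes>\<^bsub>free_group n\<^esub> s}" and s: "s \<in> free_generators n"
      using c unfolding cayley_edges_def by blast
    have "g = \<one>\<^bsub>free_group n\<^esub>" "g \<otimes>\<^bsub>free_group n\<^esub> s = \<one>\<^bsub>free_group n\<^esub>"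
      using sub unfolding gs by blast+
    moreover have "s \<in> carrier (free_group n)" "s \<noteq> \<one>\<^bsub>free_group n\<^esub>"
      using s by (auto simp: free_generators_def free_group_def)
    ultimately show False by simp
  qed
  then show ?thesis
    unfolding cayley_ball_def ball by blast
qed

lemma tree_dist_le_iff:
  "tree_dist n t t' \<le> (1/2) ^ m \<longleftrightarrow> cayley_ball n m \<inter> t = cayley_ball n m \<inter> t'"
proof
  let ?A = "{m. cayley_ball n m \<inter> t = cayley_ball n m \<inter> t'}"
  have bdd: "bdd_below ((\<lambda>m. (1/2::real) ^ m) ` ?A)"
    by (rule bdd_belowI[of _ 0]) auto
  show "tree_dist n t t' \<le> (1/2) ^ m" if "cayley_ball n m \<inter> t = cayley_ball n m \<inter> t'"
    unfolding tree_dist_def using that by (intro cINF_lower[OF bdd]) simp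
  show "cayley_ball n m \<inter> t = cayley_ball n m \<inter> t'" if le: "tree_dist n t t' \<le> (1/2) ^ m"
  proof (rule ccontr)
    assume ne: "\<not> ?thesis"
    then obtain k where k: "m = Suc k"
      using cayley_ball_0 by (cases m) auto
    have "(1/2) ^ k \<le> tree_dist n t t'"
      unfolding tree_dist_def
    proof (rule cINF_greatest)
      show "?A \<noteq> {}" using cayley_ball_0 by blast
      fix i assume "i \<in> ?A"
      then have "i \<le> k"
        using ne k cayley_ball_mono[of m i n] not_less_eq_eq[of i k] by blast
      then show "(1/2::real) ^ k \<le> (1/2) ^ i" by (simp add: power_decreasing)
    qed
    moreover have "(1/2::real) ^ m < (1/2) ^ k"
      unfolding k by (rule power_strict_decreasing) auto
    ultimately show False using le by linarith
  qed
qed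

lemma tree_dist_nonneg: "0 \<le> tree_dist n t t'"
  unfolding tree_dist_def
proof (rule cINF_greatest)
  show "{m. cayley_ball n m \<inter> t = cayley_ball n m \<inter> t'} \<noteq> {}"
    using cayley_ball_0 by blast
qed simp

lemma tree_dist_cases:
  obtains "tree_dist n t t' = 0" | m where "tree_dist n t t' = (1/2) ^ m"
proof (cases "\<forall>m. cayley_ball n m \<inter> t = cayley_ball n m \<inter> t'")
  case True
  have "tree_dist n t t' \<le> 0"
  proof (rule field_le_epsilon)
    fix e :: real assume "0 < e"
    then obtain m where "(1/2::real) ^ m < e"
      using real_arch_pow_inv[of e "1/2"] by auto
    then show "tree_dist n t t' \<le> 0 + e"
      using True tree_dist_le_iff[of n t t' m] by simp
  qed
  then show ?thesis using tree_dist_nonneg[of n t t'] that(1) by simp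
next
  case False
  let ?A = "{m. cayley_ball n m \<inter> t = cayley_ball n m \<inter> t'}"
  obtain k where "cayley_ball n k \<inter> t \<noteq> cayley_ball n k \<inter> t'" using False by blast
  then have bound: "i \<le> k" if "i \<in> ?A" for i
    using that cayley_ball_mono[of k i n] nat_le_linear[of i k] by blast
  then have fin: "finite ?A" by (meson finite_nat_set_iff_bounded_le)
  moreover have "?A \<noteq> {}" using cayley_ball_0 by blast
  ultimately have "Inf ((\<lambda>m. (1/2::real) ^ m) ` ?A) \<in> (\<lambda>m. (1/2) ^ m) ` ?A"
    by (simp add: cInf_eq_Min Min_in del: Collect_empty_eq)
  then show ?thesis using that(2) unfolding tree_dist_def by blast
qed

lemma letter_closed: "a \<in> {..<n} \<times> UNIV \<Longrightarrow> [a] \<in> carrier (free_group n)"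
  by (simp add: free_group_def)

lemma adjacency_snoc:
  assumes ga: "g @ [a] \<in> carrier (free_group n)"
  shows "(g, g @ [a]) \<in> adjacency (cayley_edges n)"
proof -
  interpret group "free_group n" by (rule group_free_group)
  have g: "g \<in> carrier (free_group n)" and a: "a \<in> {..<n} \<times> UNIV"
    using ga by (auto simp: free_group_def successively_append_iff)
  have 1: "g \<otimes>\<^bsub>free_group n\<^esub> [a] = g @ [a]"
    using foldr_cancel_cons_Nil[OF ga] by (simp add: free_group_def)
  have "[a] \<otimes>\<^bsub>free_group n\<^esub> [flip a] = \<one>\<^bsub>free_group n\<^esub>"
    by (simp add: free_group_def)
  then have 2: "(g @ [a]) \<otimes>\<^bsub>free_group n\<^esub> [flip a] = g"
    using g letter_closed[of a n] letter_closed[of "flip a" n] a m_assoc[of g "[a]" "[flip a]"] 1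
    by simp
  show ?thesis
  proof (cases "snd a")
    case True
    then have "[a] \<in> free_generators n"
      using a by (cases a) (auto simp: free_generators_def)
    then have "{g, g \<otimes>\<^bsub>free_group n\<^esub> [a]} \<in> cayley_edges n"
      using g unfolding cayley_edges_def by blast
    then show ?thesis by (simp add: 1 adjacency_def)
  next
    case False
    then have "[flip a] \<in> free_generators n"
      using a by (cases a) (auto simp: free_generators_def flip_def)
    then have "{g @ [a], (g @ [a]) \<otimes>\<^bsub>free_group n\<^esub> [flip a]} \<in> cayley_edges n"
      using ga unfolding cayley_edges_def by blast
    then show ?thesis by (simp add: 2 adjacency_def insert_commute)
  qed
qed

lemma vertex_in_ball:
  assumes "g \<in> carrier (free_group n)"
  shows "g \<in> ball_vertices n (length g)"
proof -
  have "(\<one>\<^bsub>free_group n\<^esub>, g) \<in> adjacency (cayley_edges n) ^^ length g"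
    using assms
  proof (induction g rule: rev_induct)
    case Nil
    then show ?case by (simp add: free_group_def)
  next
    case (snoc a g)
    then have "g \<in> carrier (free_group n)"
      by (auto simp: free_group_def successively_append_iff)
    with snoc adjacency_snoc[OF snoc.prems] show ?case by auto
  qed
  then show ?thesis unfolding ball_vertices_def by blast
qed

lemma edge_in_ball:
  assumes "c \<in> cayley_edges n"
  shows "\<exists>m. c \<subseteq> ball_vertices n m"
proof -
  interpret group "free_group n" by (rule group_free_group)
  obtain g s where c: "c = {g, g \<otimes>\<^bsub>free_group n\<^esub> s}" "g \<in> carrier (free_group n)"
    "s \<in> free_generators n"
    using assms by (auto simp: cayley_edges_def)
  let ?h = "g \<otimes>\<^bsub>free_group n\<^esub> s"
  have "s \<in> carrier (free_group n)"
    using c(3) by (auto simp: free_generators_def free_group_def)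
  then have "?h \<in> carrier (free_group n)"
    using c(2) by simp
  then have "c \<subseteq> ball_vertices n (max (length g) (length ?h))"
    unfolding c(1)
    using vertex_in_ball[OF c(2)] vertex_in_ball[of ?h n]
      ball_vertices_mono[of "length g" "max (length g) (length ?h)" n]
      ball_vertices_mono[of "length ?h" "max (length g) (length ?h)" n] by auto
  then show ?thesis by blast
qed

lemma Metric_space_tree_dist: "Metric_space (Pow (cayley_edges n)) (tree_dist n)"
proof
  show "0 \<le> tree_dist n t t'" for t t'
    by (rule tree_dist_nonneg)
  show "tree_dist n t t' = tree_dist n t' t" for t t'
    unfolding tree_dist_def by (simp add: eq_commute)
  show "tree_dist n t t' = 0 \<longleftrightarrow> t = t'"
    if "t \<in> Pow (cayley_edges n)" "t' \<in> Pow (cayley_edges n)" for t t'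
  proof
    assume "tree_dist n t t' = 0"
    then have eq: "cayley_ball n m \<inter> t = cayley_ball n m \<inter> t'" for m
      using tree_dist_le_iff[of n t t' m] by simp
    have "\<exists>m. c \<in> cayley_ball n m" if "c \<in> cayley_edges n" for c
      using edge_in_ball[OF that] that unfolding cayley_ball_def by blast
    then show "t = t'"
      using that eq by blast
  next
    assume "t = t'"
    then have le: "tree_dist n t t' \<le> (1/2) ^ m" for m
      by (simp add: tree_dist_le_iff)
    show "tree_dist n t t' = 0"
    proof (cases rule: tree_dist_cases[of n t t'])
      case (2 m)
      then show ?thesis using le[of "Suc m"] by simp
    qed
  qed
  show "tree_dist n t t'' \<le> tree_dist n t t' + tree_dist n t' t''" for t t' t''
  proof -
    let ?a = "tree_dist n t t'" and ?b = "tree_dist n t' t''"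
    have zero: "cayley_ball n m \<inter> s = cayley_ball n m \<inter> s'" if "tree_dist n s s' = 0" for m s s'
      using that tree_dist_le_iff[of n s s' m] by simp
    have pow: "cayley_ball n m \<inter> s = cayley_ball n m \<inter> s'"
      if "tree_dist n s s' = (1/2) ^ k" "m \<le> k" for m k s s'
      using that tree_dist_le_iff[of n s s' m] by (simp add: power_decreasing)
    show ?thesis
    proof (cases rule: tree_dist_cases[of n t t'])
      case 1
      then have "tree_dist n t t'' = ?b"
        unfolding tree_dist_def using zero[OF 1] by simp
      with 1 show ?thesis by simp
    next
      case a: (2 k)
      show ?thesis
      proof (cases rule: tree_dist_cases[of n t' t''])
        case 1
        then have "tree_dist n t t'' = ?a"
          unfolding tree_dist_def using zero[OF 1] by simp
        with 1 show ?thesis by simp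
      next
        case b: (2 l)
        have "cayley_ball n (min k l) \<inter> t = cayley_ball n (min k l) \<inter> t''"
          using pow[OF a, of "min k l"] pow[OF b, of "min k l"] by simp
        then have "tree_dist n t t'' \<le> (1/2) ^ min k l"
          by (simp add: tree_dist_le_iff)
        also have "\<dots> \<le> ?a + ?b"
          by (auto simp: a b min_def)
        finally show ?thesis .
      qed
    qed
  qed
qed

text \<open>
  The metric extends \<open>d\<close> from the pointed subtrees to all sets of edges. The latter form a
  complete space, so the closure of the set of pointed subtrees is its completion.
\<close>

definition tree_metric :: "nat \<Rightarrow> subgraph metric" where
  "tree_metric n = metric (Pow (cayley_edges n), tree_dist n)"

definition subtree_space :: "nat \<Rightarrow> subgraph topology" where
  "subtree_space n =
     subtopology (mtopology_of (tree_metric n))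
       (mtopology_of (tree_metric n) closure_of pointed_subtrees n)"

definition translate :: "nat \<Rightarrow> word \<Rightarrow> subgraph \<Rightarrow> subgraph" where
  "translate n g t = (\<lambda>c. (\<lambda>h. g \<otimes>\<^bsub>free_group n\<^esub> h) ` c) ` t"

definition translation :: "nat \<Rightarrow> word \<Rightarrow> (subgraph \<times> subgraph) set" where
  "translation n g =
     graph_on {t \<in> topspace (subtree_space n). g \<in> \<Union> t} (translate n (inv\<^bsub>free_group n\<^esub> g))"

definition translation_pseudogroup :: "nat \<Rightarrow> (subgraph \<times> subgraph) set set" where
  "translation_pseudogroup n =
     generated_pseudogroup (subtree_space n)
       (translation n ` (free_generators n \<union> m_inv (free_group n) ` free_generators n))"


section \<open>Foliations of manifolds\<close>

definition C1_on :: "('m::euclidean_space \<Rightarrow> 'm) \<Rightarrow> 'm set \<Rightarrow> bool" where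
  "C1_on f S \<longleftrightarrow>
     (\<exists>f'. (\<forall>x\<in>S. (f has_derivative blinfun_apply (f' x)) (at x)) \<and> continuous_on S f')"

text \<open>
  A \<open>C\<^sup>1\<close>-foliation of a manifold \<open>N\<close> of dimension \<open>DIM('m)\<close> is given by a foliated \<open>C\<^sup>1\<close>-atlas
  \<open>\<A>\<close>, consisting of pairs of a domain and a coordinate map. The leaf directions are those of a
  linear subspace \<open>E\<close>: writing \<open>'m = E \<oplus> F\<close>, the last condition says that a coordinate change
  is locally of the form \<open>(x, y) \<mapsto> (f (x, y), g y)\<close>. The leaf dimension is \<open>dim E\<close>, and \<open>E\<close>
  may be the whole space (codimension zero).
\<close>

definition C1_foliation ::
    "'b topology \<Rightarrow> 'm::euclidean_space set \<Rightarrow> ('b set \<times> ('b \<Rightarrow> 'm)) set \<Rightarrow> bool" where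
  "C1_foliation N E \<A> \<longleftrightarrow>
     Hausdorff_space N \<and> second_countable N \<and> subspace E \<and>
     (\<Union>(U, \<phi>)\<in>\<A>. U) = topspace N \<and>
     (\<forall>(U, \<phi>)\<in>\<A>. openin N U \<and> open (\<phi> ` U) \<and>
        homeomorphic_map (subtopology N U) (top_of_set (\<phi> ` U)) \<phi>) \<and>
     (\<forall>(U, \<phi>)\<in>\<A>. \<forall>(V, \<psi>)\<in>\<A>. \<exists>h.
        (\<forall>z\<in>U \<inter> V. h (\<phi> z) = \<psi> z) \<and> C1_on h (\<phi> ` (U \<inter> V)) \<and>
        (\<forall>p\<in>\<phi> ` (U \<inter> V). \<exists>W. open W \<and> p \<in> W \<and> W \<subseteq> \<phi> ` (U \<inter> V) \<and>
           (\<forall>q\<in>W. \<forall>q'\<in>W. q - q' \<in> E \<longrightarrow> h q - h q' \<in> E)))"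

text \<open>
  As for foliated spaces, the leaves are the components of the topology generated by the open
  subsets of the plaques.
\<close>

definition foliation_leaves ::
    "'m::euclidean_space set \<Rightarrow> ('b set \<times> ('b \<Rightarrow> 'm)) set \<Rightarrow> 'b set set" where
  "foliation_leaves E \<A> =
     connected_components_of (topology_generated_by
       {{z \<in> U. \<phi> z \<in> V \<and> \<phi> z - a \<in> E} | U \<phi> V a. (U, \<phi>) \<in> \<A> \<and> open V})"

definition invariant_subset ::
    "'m::euclidean_space set \<Rightarrow> ('b set \<times> ('b \<Rightarrow> 'm)) set \<Rightarrow> 'b set \<Rightarrow> bool" where
  "invariant_subset E \<A> K \<longleftrightarrow> (\<exists>\<L> \<subseteq> foliation_leaves E \<A>. K = \<Union> \<L>)"

definition homeomorphic_to_invariant_subset ::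
    "'a topology \<Rightarrow> ('a \<Rightarrow> ('a, 'e::euclidean_space, 'x) foliated_chart) \<Rightarrow>
     'b topology \<Rightarrow> 'm::euclidean_space set \<Rightarrow> ('b set \<times> ('b \<Rightarrow> 'm)) set \<Rightarrow> bool" where
  "homeomorphic_to_invariant_subset M chart N E \<A> \<longleftrightarrow>
     (\<exists>K f. invariant_subset E \<A> K \<and> homeomorphic_map M (subtopology N K) f \<and>
        (\<forall>L\<in>leaves M chart. f ` L \<in> foliation_leaves E \<A>))"

end

theory Submission
  imports Defs "HOL-Library.Sublist"
begin

text \<open>
  Transitivity: finite pieces of any two pointed trees fit into one tree, so a Baire argument gives
  a tree whose orbit under the translations is dense; the closure of a leaf is a union of leaves.
  Lipschitz: a translation by a generator changes the ball metric by a factor of at most \<open>2\<close>.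

  Now let \<open>f\<close> embed the matchbox manifold as an invariant set of a \<open>C\<^sup>1\<close>-foliation. Because the
  transversal is totally disconnected, small plaques of the foliation correspond to open pieces of
  plaques of the matchbox manifold, so the holonomy along leafwise paths is locally bi-Lipschitz for
  the Euclidean distance transverse to the foliation. By compactness all translations by generators
  have a common Lipschitz constant \<open>L\<close> on small balls. If two trees agree on \<open>B(e,k)\<close> but not on
  \<open>B(e,k+1)\<close>, then following a path to an edge where they differ shows that their images have
  transverse distance at least \<open>\<epsilon> / L\<^sup>k\<close>. A bounded set in Euclidean space contains only
  exponentially many points (in \<open>k\<close>) with such mutual distances, but there are at least
  \<open>2 ^ 2 ^ k\<close> trees that agree on \<open>B(e,k)\<close> and differ pairwise on \<open>B(e,k+1)\<close>.
\<close>

section \<open>Reduced words and the Cayley graph\<close>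

text \<open>The obstacle is that the embedding is only a homeomorphism: neither the metric of the
  trees nor the smooth structure along the leaves of the matchbox manifold passes to the foliation.
  All distances are therefore measured in the target, by \<open>infdist _ E\<close>, which vanishes
  exactly along the leaf directions, and holonomy is controlled through chains of foliation charts.
  What topology alone provides is that a short curve in a leaf of the matchbox manifold does not
  change the transverse coordinate of a foliation chart. The double exponential arises because the
  vertices on the sphere of radius \<open>k\<close>, of which there are at least
  \<open>2 ^ k\<close>, decide independently whether to branch. The single exponential arises
  because one letter lowers the level of the first difference by exactly one, and all intermediate
  pairs still agree to a depth beyond the radius on which the uniform Lipschitz estimate holds. This
  is why the trees that are counted agree on a large ball and differ on the very next one.\<close>

abbreviation letters :: "nat \<Rightarrow> (nat \<times> bool) set" where
  "letters n \<equiv> {..<n} \<times> UNIV"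

lemma free_group_simps [simp]:
  "\<one>\<^bsub>free_group n\<^esub> = []"
  "u \<otimes>\<^bsub>free_group n\<^esub> v = foldr cancel_cons u v"
  by (simp_all add: free_group_def)

lemma carrier_append_iff:
  "u @ v \<in> carrier (free_group n) \<longleftrightarrow>
     u \<in> carrier (free_group n) \<and> v \<in> carrier (free_group n) \<and>
     (u \<noteq> [] \<and> v \<noteq> [] \<longrightarrow> hd v \<noteq> flip (last u))"
  by (auto simp: free_group_def successively_append_iff)

lemma carrier_Cons_iff:
  "a # v \<in> carrier (free_group n) \<longleftrightarrow>
     a \<in> letters n \<and> v \<in> carrier (free_group n) \<and> (v \<noteq> [] \<longrightarrow> hd v \<noteq> flip a)"
  by (auto simp: free_group_def successively_Cons)

lemma Nil_in_carrier [simp]: "[] \<in> carrier (free_group n)"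
  by (simp add: free_group_def)

lemma carrier_snoc_iff:
  "v @ [a] \<in> carrier (free_group n) \<longleftrightarrow>
     a \<in> letters n \<and> v \<in> carrier (free_group n) \<and> (v \<noteq> [] \<longrightarrow> a \<noteq> flip (last v))"
  by (auto simp: carrier_append_iff carrier_Cons_iff)

lemma carrier_letters: "u \<in> carrier (free_group n) \<Longrightarrow> set u \<subseteq> letters n"
  by (simp add: free_group_def)

lemma mult_closed:
  "\<lbrakk>u \<in> carrier (free_group n); v \<in> carrier (free_group n)\<rbrakk> \<Longrightarrow>
     foldr cancel_cons u v \<in> carrier (free_group n)"
  by (rule foldr_cancel_cons_closed) (auto dest: carrier_letters)

lemma mult_assoc:
  "\<lbrakk>u \<in> carrier (free_group n); v \<in> carrier (free_group n); w \<in> carrier (free_group n)\<rbrakk> \<Longrightarrow>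
     foldr cancel_cons (foldr cancel_cons u v) w = foldr cancel_cons u (foldr cancel_cons v w)"
  by (rule foldr_cancel_cons_assoc) (auto dest: carrier_letters)

text \<open>Nothing cancels in a reduced concatenation; this is read off from multiplying
  \<open>u @ v\<close> by the empty word.\<close>

lemma mult_append:
  assumes "u @ v \<in> carrier (free_group n)"
  shows "foldr cancel_cons u v = u @ v"
proof -
  have "v \<in> carrier (free_group n)" using assms by (simp add: carrier_append_iff)
  then show ?thesis
    using foldr_cancel_cons_Nil[OF assms] foldr_cancel_cons_Nil[of v n] by simp
qed

lemma inv_free_group:
  assumes "u \<in> carrier (free_group n)"
  shows "inv\<^bsub>free_group n\<^esub> u = map flip (rev u)"
proof -
  interpret group "free_group n" by (rule group_free_group)
  show ?thesis
    using foldr_cancel_cons_inverse[of "[]" n u] foldr_cancel_cons_Nil[OF assms] assms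
      carrier_letters[OF assms] flip_word_closed[OF assms]
    by (intro inv_equality) auto
qed

lemma inverse_word_mult:
  "\<lbrakk>u \<in> carrier (free_group n); v \<in> carrier (free_group n)\<rbrakk> \<Longrightarrow>
     foldr cancel_cons (map flip (rev u)) (foldr cancel_cons u v) = v"
  by (rule foldr_cancel_cons_inverse) (auto dest: carrier_letters)

lemma mult_inverse_word:
  assumes "u \<in> carrier (free_group n)" "v \<in> carrier (free_group n)"
  shows "foldr cancel_cons u (foldr cancel_cons (map flip (rev u)) v) = v"
proof -
  have "map flip (rev (map flip (rev u))) = u"
    by (simp add: rev_map comp_def)
  then show ?thesis
    using inverse_word_mult[OF flip_word_closed[OF assms(1)] assms(2)] by simp
qed

lemma mult_inj_on: "u \<in> carrier (free_group n) \<Longrightarrow>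
    inj_on (foldr cancel_cons u) (carrier (free_group n))"
  by (rule inj_on_inverseI) (rule inverse_word_mult)

text \<open>Left translation by \<open>u\<close> shifts levels by at most the length of
  \<open>u\<close>. This is the loss of radius in every later estimate on agreeing balls.\<close>

lemma length_mult: "length (foldr cancel_cons u v) \<le> length u + length v"
proof (induction u)
  case (Cons a u)
  have "length (cancel_cons a w) \<le> Suc (length w)" for w
    by (cases w) auto
  from this[of "foldr cancel_cons u v"] Cons show ?case by simp
qed simp

text \<open>The definition orients edges by positive generators. Orienting them away from the root
  makes the tree structure visible, as every nonempty word then has exactly one edge towards the
  root, to its \<open>butlast\<close>. Multiplication by a generator either appends it or deletes a
  final inverse letter.\<close>

lemma cayley_edges_iff:
  "c \<in> cayley_edges n \<longleftrightarrow> (\<exists>g a. g @ [a] \<in> carrier (free_group n) \<and> c = {g, g @ [a]})"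
proof
  assume "c \<in> cayley_edges n"
  then obtain g s where g: "g \<in> carrier (free_group n)" and s: "s \<in> free_generators n"
    and c: "c = {g, foldr cancel_cons g s}"
    unfolding cayley_edges_def free_group_simps by blast
  obtain i where i: "i < n" and si: "s = [(i, True)]"
    using s unfolding free_generators_def by blast
  show "\<exists>g a. g @ [a] \<in> carrier (free_group n) \<and> c = {g, g @ [a]}"
  proof (cases "g \<noteq> [] \<and> last g = (i, False)")
    case True
    then have g': "g = butlast g @ [(i, False)]"
      using append_butlast_last_id[of g] by simp
    then have gc: "butlast g @ [(i, False)] \<in> carrier (free_group n)"
      using g by simp
    then have bc: "butlast g \<in> carrier (free_group n)"
      by (simp only: carrier_snoc_iff)
    have "[(i, False)] \<in> carrier (free_group n)" "s \<in> carrier (free_group n)"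
      using i si by (simp_all add: letter_closed)
    then have "foldr cancel_cons (foldr cancel_cons (butlast g) [(i, False)]) s =
        foldr cancel_cons (butlast g) []"
      using mult_assoc[OF bc] by (simp add: si flip_def)
    then have "foldr cancel_cons g s = butlast g"
      using foldr_cancel_cons_Nil[OF bc] mult_append[OF gc] g' by simp
    then have "c = {butlast g, butlast g @ [(i, False)]}"
      using c g' by auto
    then show ?thesis
      using gc by blast
  next
    case False
    have "last g = (i, False)" if "(i, True) = flip (last g)"
      using flip_flip[of "last g"] unfolding that[symmetric] by (simp add: flip_def)
    with False have "g @ [(i, True)] \<in> carrier (free_group n)"
      using g i unfolding carrier_snoc_iff by auto
    then show ?thesis
      using mult_append[of g s n] c si by auto
  qed
next
  assume "\<exists>g a. g @ [a] \<in> carrier (free_group n) \<and> c = {g, g @ [a]}"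
  then obtain g a where ga: "g @ [a] \<in> carrier (free_group n)" and c: "c = {g, g @ [a]}"
    by blast
  show "c \<in> cayley_edges n"
    using adjacency_snoc[OF ga] by (simp add: adjacency_def c)
qed

lemma cayley_edge_carrier: "\<lbrakk>c \<in> cayley_edges n; g \<in> c\<rbrakk> \<Longrightarrow> g \<in> carrier (free_group n)"
  unfolding cayley_edges_iff using carrier_snoc_iff by blast

text \<open>Graph distance from the root is word length, since an edge changes the length by
  one.\<close>

lemma ball_vertices_eq: "ball_vertices n m = {w \<in> carrier (free_group n). length w \<le> m}"
proof
  have "g \<in> carrier (free_group n) \<and> length g \<le> k"
    if "([], g) \<in> adjacency (cayley_edges n) ^^ k" for g k
    using that
  proof (induction k arbitrary: g)
    case (Suc k)
    then obtain h where h: "h \<in> carrier (free_group n)" "length h \<le> k"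
      "{h, g} \<in> cayley_edges n"
      by (auto simp: adjacency_def)
    then have "g \<in> carrier (free_group n)"
      using cayley_edge_carrier[OF h(3)] by simp
    moreover obtain g' a where "{h, g} = {g', g' @ [a]}"
      using h(3) unfolding cayley_edges_iff by blast
    then have "length g \<le> Suc (length h)"
      by (auto simp: doubleton_eq_iff)
    ultimately show ?case
      using h(2) by simp
  qed simp
  note reach = this
  show "ball_vertices n m \<subseteq> {w \<in> carrier (free_group n). length w \<le> m}"
  proof
    fix g assume "g \<in> ball_vertices n m"
    then obtain k where "k \<le> m" "([], g) \<in> adjacency (cayley_edges n) ^^ k"
      unfolding ball_vertices_def by auto
    then show "g \<in> {w \<in> carrier (free_group n). length w \<le> m}"
      using reach[of g k] by auto
  qed
  show "{w \<in> carrier (free_group n). length w \<le> m} \<subseteq> ball_vertices n m"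
  proof
    fix w assume "w \<in> {w \<in> carrier (free_group n). length w \<le> m}"
    then show "w \<in> ball_vertices n m"
      using vertex_in_ball[of w n] ball_vertices_mono[of "length w" m n] by auto
  qed
qed

lemma cayley_ball_eq: "cayley_ball n m = {c \<in> cayley_edges n. \<forall>w\<in>c. length w \<le> m}"
  unfolding cayley_ball_def ball_vertices_eq by (auto dest: cayley_edge_carrier)

lemma finite_cayley_ball: "finite (cayley_ball n m)"
proof (rule finite_subset)
  show "cayley_ball n m \<subseteq> Pow (ball_vertices n m)"
    by (auto simp: cayley_ball_def)
  have "ball_vertices n m \<subseteq> {w. set w \<subseteq> letters n \<and> length w \<le> m}"
    by (auto simp: ball_vertices_eq dest: carrier_letters)
  then show "finite (Pow (ball_vertices n m))"
    using finite_lists_length_le[of "letters n" m] finite_subset by auto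
qed

lemma cayley_ball_subset: "cayley_ball n m \<subseteq> cayley_edges n"
  by (simp add: cayley_ball_def)

lemma edge_at_in_cayley_ball:
  "\<lbrakk>c \<in> cayley_edges n; g \<in> c\<rbrakk> \<Longrightarrow> c \<in> cayley_ball n (Suc (length g))"
  by (auto simp: cayley_ball_eq cayley_edges_iff)

text \<open>The words extending \<open>p\<close> form the branch above \<open>p\<close>; its only
  exit is the edge to the parent of \<open>p\<close>.\<close>

lemma edge_across_prefix:
  assumes "{x, y} \<in> cayley_edges n" "prefix p x" "\<not> prefix p y"
  shows "x = p \<and> y = butlast p"
proof -
  obtain g a where "{x, y} = {g, g @ [a]}"
    using assms(1) unfolding cayley_edges_iff by blast
  then consider "x = g" "y = g @ [a]" | "x = g @ [a]" "y = g"
    by (auto simp: doubleton_eq_iff)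
  then show ?thesis
    using assms(2,3) by cases (auto simp: prefix_snoc)
qed

text \<open>A path leaving the branch above \<open>p\<close> would have to use the missing
  edge.\<close>

lemma connected_subgraph_prefix:
  assumes t: "t \<subseteq> cayley_edges n" "connected_subgraph t" "{butlast p, p} \<notin> t"
    and xy: "x \<in> \<Union> t" "y \<in> \<Union> t" "prefix p x"
  shows "prefix p y"
proof -
  have "(x, y) \<in> (adjacency t)\<^sup>*"
    using t xy unfolding connected_subgraph_def by blast
  then show ?thesis
  proof induction
    case (step y z)
    then have "{y, z} \<in> t" by (simp add: adjacency_def)
    then show ?case
      using edge_across_prefix[of y z n p] step.IH t by (auto simp: insert_commute)
  qed (rule xy)
qed

section \<open>Translations of subgraphs\<close>

text \<open>Edges come from right multiplication by generators and so commute with left translation.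
  This is immediate from the defining form of an edge, but not from the normal form with a
  one-letter extension.\<close>

lemma translate_edge:
  assumes g: "g \<in> carrier (free_group n)" and c: "c \<in> cayley_edges n"
  shows "foldr cancel_cons g ` c \<in> cayley_edges n"
proof -
  obtain h s where h: "h \<in> carrier (free_group n)" and s: "s \<in> free_generators n"
    and c: "c = {h, foldr cancel_cons h s}"
    using c unfolding cayley_edges_def by auto
  have "s \<in> carrier (free_group n)"
    using s by (auto simp: free_generators_def carrier_Cons_iff)
  then have "foldr cancel_cons g ` c =
      {foldr cancel_cons g h, foldr cancel_cons (foldr cancel_cons g h) s}"
    using mult_assoc[OF g h] by (simp add: c)
  then show ?thesis
    using mult_closed[OF g h] s unfolding cayley_edges_def by auto
qed

lemma translate_eq: "translate n g t = (\<lambda>c. foldr cancel_cons g ` c) ` t"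
  by (simp add: translate_def)

lemma translate_subset:
  "\<lbrakk>g \<in> carrier (free_group n); t \<subseteq> cayley_edges n\<rbrakk> \<Longrightarrow> translate n g t \<subseteq> cayley_edges n"
  unfolding translate_eq using translate_edge by blast

lemma Union_translate: "\<Union> (translate n g t) = foldr cancel_cons g ` \<Union> t"
  by (auto simp: translate_eq)

lemma edge_mult_inverse:
  assumes "g \<in> carrier (free_group n)" "c \<in> cayley_edges n"
  shows "foldr cancel_cons g ` foldr cancel_cons (map flip (rev g)) ` c = c"
    and "foldr cancel_cons (map flip (rev g)) ` foldr cancel_cons g ` c = c"
proof -
  have "foldr cancel_cons g ` foldr cancel_cons (map flip (rev g)) ` c = (\<lambda>x. x) ` c"
    unfolding image_image using cayley_edge_carrier[OF assms(2)]
    by (intro image_cong refl mult_inverse_word[OF assms(1)])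
  then show "foldr cancel_cons g ` foldr cancel_cons (map flip (rev g)) ` c = c"
    by simp
  have "foldr cancel_cons (map flip (rev g)) ` foldr cancel_cons g ` c = (\<lambda>x. x) ` c"
    unfolding image_image using cayley_edge_carrier[OF assms(2)]
    by (intro image_cong refl inverse_word_mult[OF assms(1)])
  then show "foldr cancel_cons (map flip (rev g)) ` foldr cancel_cons g ` c = c"
    by simp
qed

lemma translate_cancel:
  assumes "g \<in> carrier (free_group n)" "t \<subseteq> cayley_edges n"
  shows "translate n g (translate n (map flip (rev g)) t) = t"
    and "translate n (map flip (rev g)) (translate n g t) = t"
proof -
  have "(\<lambda>c. foldr cancel_cons g ` foldr cancel_cons (map flip (rev g)) ` c) ` t = (\<lambda>c. c) ` t"
    by (rule image_cong[OF refl]) (use edge_mult_inverse(1)[OF assms(1)] assms(2) in blast)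
  then show "translate n g (translate n (map flip (rev g)) t) = t"
    by (simp add: translate_eq image_image)
  have "(\<lambda>c. foldr cancel_cons (map flip (rev g)) ` foldr cancel_cons g ` c) ` t = (\<lambda>c. c) ` t"
    by (rule image_cong[OF refl]) (use edge_mult_inverse(2)[OF assms(1)] assms(2) in blast)
  then show "translate n (map flip (rev g)) (translate n g t) = t"
    by (simp add: translate_eq image_image)
qed

lemma translate_mem_iff:
  assumes "g \<in> carrier (free_group n)" "t \<subseteq> cayley_edges n" "c \<in> cayley_edges n"
  shows "c \<in> translate n (map flip (rev g)) t \<longleftrightarrow> foldr cancel_cons g ` c \<in> t"
proof
  assume "c \<in> translate n (map flip (rev g)) t"
  then obtain d where "d \<in> t" "c = foldr cancel_cons (map flip (rev g)) ` d"
    unfolding translate_eq by blast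
  then show "foldr cancel_cons g ` c \<in> t"
    using edge_mult_inverse(1)[OF assms(1), of d] assms(2) by auto
next
  assume "foldr cancel_cons g ` c \<in> t"
  then have "foldr cancel_cons (map flip (rev g)) ` foldr cancel_cons g ` c
      \<in> translate n (map flip (rev g)) t"
    unfolding translate_eq by blast
  then show "c \<in> translate n (map flip (rev g)) t"
    using edge_mult_inverse(2)[OF assms(1,3)] by simp
qed

lemma translate_mult:
  assumes "g \<in> carrier (free_group n)" "h \<in> carrier (free_group n)" "t \<subseteq> cayley_edges n"
  shows "translate n g (translate n h t) = translate n (foldr cancel_cons g h) t"
proof -
  have *: "foldr cancel_cons g ` foldr cancel_cons h ` c = foldr cancel_cons (foldr cancel_cons g h) ` c"
    if "c \<in> t" for c
    unfolding image_image
    using that assms by (intro image_cong refl mult_assoc[symmetric]) (auto dest: cayley_edge_carrier)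
  then show ?thesis
    unfolding translate_eq by (subst image_image) (rule image_cong[OF refl *])
qed

text \<open>An edge \<open>c\<close> lies in the pulled-back tree iff its translate by
  \<open>g\<close> lies in the original one, and \<open>g\<close> raises levels by at most its
  length.\<close>

lemma translate_ball_cong:
  assumes g: "g \<in> carrier (free_group n)" and t: "t \<subseteq> cayley_edges n" "t' \<subseteq> cayley_edges n"
    and eq: "cayley_ball n (m + length g) \<inter> t = cayley_ball n (m + length g) \<inter> t'"
  shows "cayley_ball n m \<inter> translate n (map flip (rev g)) t =
    cayley_ball n m \<inter> translate n (map flip (rev g)) t'"
proof -
  have "c \<in> translate n (map flip (rev g)) t \<longleftrightarrow> c \<in> translate n (map flip (rev g)) t'"
    if c: "c \<in> cayley_ball n m" for c
  proof -
    have ce: "c \<in> cayley_edges n"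
      using c cayley_ball_subset by blast
    have "length (foldr cancel_cons g w) \<le> m + length g" if "w \<in> c" for w
    proof -
      have "length w \<le> m" using c that by (simp add: cayley_ball_eq)
      then show ?thesis using length_mult[of g w] by simp
    qed
    then have "foldr cancel_cons g ` c \<in> cayley_ball n (m + length g)"
      using translate_edge[OF g ce] by (simp add: cayley_ball_eq)
    then have "foldr cancel_cons g ` c \<in> t \<longleftrightarrow> foldr cancel_cons g ` c \<in> t'"
      using eq by blast
    then show ?thesis
      using translate_mem_iff[OF g t(1) ce] translate_mem_iff[OF g t(2) ce] by simp
  qed
  then show ?thesis by blast
qed

lemma connected_subgraph_translate:
  assumes "connected_subgraph t"
  shows "connected_subgraph (translate n g t)"
proof -
  have "(foldr cancel_cons g x, foldr cancel_cons g y) \<in> (adjacency (translate n g t))\<^sup>*"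
    if "(x, y) \<in> (adjacency t)\<^sup>*" for x y
    using that
  proof induction
    case (step y z)
    then have "foldr cancel_cons g ` {y, z} \<in> translate n g t"
      unfolding translate_eq by (intro imageI) (simp add: adjacency_def)
    then have "(foldr cancel_cons g y, foldr cancel_cons g z) \<in> adjacency (translate n g t)"
      by (simp add: adjacency_def)
    with step.IH show ?case by simp
  qed simp
  then show ?thesis
    using assms unfolding connected_subgraph_def Union_translate by blast
qed

section \<open>Moving the base point of a pointed subtree to another vertex\<close>

lemma pointed_subtrees_subset: "t \<in> pointed_subtrees n \<Longrightarrow> t \<subseteq> cayley_edges n"
  by (simp add: pointed_subtrees_def)

lemma inj_on_edge_image:
  assumes "g \<in> carrier (free_group n)"
  shows "inj_on ((`) (foldr cancel_cons g)) (cayley_edges n)"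
  by (rule inj_on_inverseI) (rule edge_mult_inverse(2)[OF assms])

lemma translate_degree:
  assumes g: "g \<in> carrier (free_group n)" and t: "t \<subseteq> cayley_edges n" and h: "h \<in> \<Union> t"
  shows "card {c \<in> translate n g t. foldr cancel_cons g h \<in> c} = card {c \<in> t. h \<in> c}"
proof -
  have hc: "h \<in> carrier (free_group n)"
    using h t by (auto intro: cayley_edge_carrier)
  have *: "foldr cancel_cons g h \<in> foldr cancel_cons g ` c \<longleftrightarrow> h \<in> c" if "c \<in> t" for c
    using that t cayley_edge_carrier[of c n] hc
    by (intro inj_on_image_mem_iff[OF mult_inj_on[OF g]]) auto
  have "{c \<in> translate n g t. foldr cancel_cons g h \<in> c} =
      (\<lambda>c. foldr cancel_cons g ` c) ` {c \<in> t. h \<in> c}"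
  proof
    show "{c \<in> translate n g t. foldr cancel_cons g h \<in> c} \<subseteq>
      (\<lambda>c. foldr cancel_cons g ` c) ` {c \<in> t. h \<in> c}"
      unfolding translate_eq using * by auto
    show "(\<lambda>c. foldr cancel_cons g ` c) ` {c \<in> t. h \<in> c} \<subseteq>
      {c \<in> translate n g t. foldr cancel_cons g h \<in> c}"
      unfolding translate_eq using * by auto
  qed
  moreover have "inj_on ((`) (foldr cancel_cons g)) {c \<in> t. h \<in> c}"
    by (rule inj_on_subset[OF inj_on_edge_image[OF g]]) (use t in auto)
  ultimately show ?thesis
    by (simp add: card_image)
qed

lemma translate_no_dead_ends:
  assumes g: "g \<in> carrier (free_group n)" and t: "t \<subseteq> cayley_edges n"
    and deg: "\<forall>h\<in>\<Union> t. card {c \<in> t. h \<in> c} \<noteq> 1"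
  shows "\<forall>h\<in>\<Union> (translate n g t). card {c \<in> translate n g t. h \<in> c} \<noteq> 1"
  unfolding Union_translate using translate_degree[OF g t] deg by auto

lemma translate_pointed:
  assumes t: "t \<in> pointed_subtrees n" and g: "g \<in> \<Union> t"
  shows "translate n (map flip (rev g)) t \<in> pointed_subtrees n"
proof -
  have tsub: "t \<subseteq> cayley_edges n" using t by (rule pointed_subtrees_subset)
  have gc: "g \<in> carrier (free_group n)" using g tsub cayley_edge_carrier by blast
  have ic: "map flip (rev g) \<in> carrier (free_group n)" by (rule flip_word_closed[OF gc])
  have "[] = foldr cancel_cons (map flip (rev g)) g"
    using inverse_word_mult[OF gc Nil_in_carrier] foldr_cancel_cons_Nil[OF gc] by simp
  then have "[] \<in> \<Union> (translate n (map flip (rev g)) t)"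
    using g unfolding Union_translate by blast
  moreover have "infinite (translate n (map flip (rev g)) t)"
    unfolding translate_eq using t finite_imageD inj_on_subset[OF inj_on_edge_image[OF ic] tsub]
    by (auto simp: pointed_subtrees_def)
  ultimately show ?thesis
    using t translate_subset[OF ic tsub] connected_subgraph_translate[of t n]
      translate_no_dead_ends[OF ic tsub]
    by (auto simp: pointed_subtrees_def)
qed

section \<open>The space of pointed subtrees\<close>

lemma mspace_tree_metric [simp]: "mspace (tree_metric n) = Pow (cayley_edges n)"
  and mdist_tree_metric [simp]: "mdist (tree_metric n) = tree_dist n"
proof -
  interpret Metric_space "Pow (cayley_edges n)" "tree_dist n"
    by (rule Metric_space_tree_dist)
  show "mspace (tree_metric n) = Pow (cayley_edges n)" "mdist (tree_metric n) = tree_dist n"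
    by (simp_all add: tree_metric_def)
qed

text \<open>For each \<open>m\<close> an equivalence relation whose classes are the closed metric
  balls of radius \<open>(1/2) ^ m\<close>. Topology and compactness are argued with these classes
  instead of with distances.\<close>

definition agree :: "nat \<Rightarrow> nat \<Rightarrow> subgraph \<Rightarrow> subgraph \<Rightarrow> bool" where
  "agree n m t t' \<longleftrightarrow> cayley_ball n m \<inter> t = cayley_ball n m \<inter> t'"

lemma agree_refl [simp]: "agree n m t t"
  by (simp add: agree_def)

lemma agree_sym: "agree n m t t' \<Longrightarrow> agree n m t' t"
  by (simp add: agree_def)

lemma agree_trans: "\<lbrakk>agree n m t t'; agree n m t' t''\<rbrakk> \<Longrightarrow> agree n m t t''"
  by (simp add: agree_def)

lemma agree_mono: "\<lbrakk>agree n m t t'; k \<le> m\<rbrakk> \<Longrightarrow> agree n k t t'"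
  using cayley_ball_mono[of k m n] unfolding agree_def by blast

lemma agree_mem: "\<lbrakk>agree n m t t'; c \<in> cayley_ball n m\<rbrakk> \<Longrightarrow> c \<in> t \<longleftrightarrow> c \<in> t'"
  unfolding agree_def by blast

lemma agree_0 [simp]: "agree n 0 t t'"
  by (simp add: agree_def cayley_ball_0)

lemma tree_dist_le_agree: "tree_dist n t t' \<le> (1/2) ^ m \<longleftrightarrow> agree n m t t'"
  by (simp add: tree_dist_le_iff agree_def)

text \<open>A vertex is visible only through an edge containing it, and that edge may reach one
  level higher; hence the strict inequality.\<close>

lemma agree_vertex:
  assumes t: "t \<subseteq> cayley_edges n" and eq: "agree n m t t'" and g: "length g < m" "g \<in> \<Union> t"
  shows "g \<in> \<Union> t'"
proof -
  obtain c where c: "c \<in> t" "g \<in> c" using g(2) by blast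
  then have "c \<in> cayley_ball n (Suc (length g))"
    using t by (auto intro: edge_at_in_cayley_ball)
  then have "c \<in> cayley_ball n m"
    using cayley_ball_mono[of "Suc (length g)" m n] g(1) by auto
  then show ?thesis
    using agree_mem[OF eq] c by auto
qed

lemma openin_tree_metric:
  "openin (mtopology_of (tree_metric n)) U \<longleftrightarrow>
     U \<subseteq> Pow (cayley_edges n) \<and>
     (\<forall>t\<in>U. \<exists>m. \<forall>t'. t' \<subseteq> cayley_edges n \<and> agree n m t t' \<longrightarrow> t' \<in> U)" (is "?L \<longleftrightarrow> ?R")
proof -
  interpret Metric_space "Pow (cayley_edges n)" "tree_dist n"
    by (rule Metric_space_tree_dist)
  have top: "mtopology_of (tree_metric n) = mtopology"
    by (simp add: tree_metric_def)
  show ?thesis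
  proof
    assume L: ?L
    have "\<exists>m. \<forall>t'. t' \<subseteq> cayley_edges n \<and> agree n m t t' \<longrightarrow> t' \<in> U" if t: "t \<in> U" for t
    proof -
      obtain r where r: "r > 0" "mball t r \<subseteq> U"
        using L t unfolding top openin_mtopology by blast
      obtain m where m: "(1/2::real) ^ m < r"
        using real_arch_pow_inv[of r "1/2"] r by auto
      have "t \<subseteq> cayley_edges n"
        using L t unfolding top openin_mtopology by blast
      then have "t' \<in> U" if "t' \<subseteq> cayley_edges n" "agree n m t t'" for t'
        using that tree_dist_le_agree[of n t t' m] m r(2) by (auto simp: in_mball subset_eq)
      then show ?thesis by blast
    qed
    moreover have "U \<subseteq> Pow (cayley_edges n)"
      using L unfolding top openin_mtopology by blast
    ultimately show ?R by blast
  next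
    assume R: ?R
    have "\<exists>r>0. mball t r \<subseteq> U" if t: "t \<in> U" for t
    proof -
      obtain m where m: "\<And>t'. t' \<subseteq> cayley_edges n \<Longrightarrow> agree n m t t' \<Longrightarrow> t' \<in> U"
        using R t by metis
      have "mball t ((1/2) ^ m) \<subseteq> U"
      proof
        fix t' assume "t' \<in> mball t ((1/2) ^ m)"
        then show "t' \<in> U"
          using tree_dist_le_agree[of n t t' m] m by auto
      qed
      then show ?thesis by (intro exI[of _ "(1/2) ^ m"]) auto
    qed
    then show ?L
      unfolding top openin_mtopology using R by blast
  qed
qed

abbreviation tspace :: "nat \<Rightarrow> subgraph set" where
  "tspace n \<equiv> topspace (subtree_space n)"

lemma tspace_closure:
  "tspace n = mtopology_of (tree_metric n) closure_of pointed_subtrees n"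
  using closure_of_subset_topspace[of "mtopology_of (tree_metric n)" "pointed_subtrees n"]
  unfolding subtree_space_def topspace_subtopology by auto

lemma openin_subtree_space_iff:
  "openin (subtree_space n) U \<longleftrightarrow>
     (\<exists>V. openin (mtopology_of (tree_metric n)) V \<and> U = V \<inter> tspace n)"
  unfolding tspace_closure unfolding subtree_space_def by (rule openin_subtopology)

lemma open_cylinder:
  assumes "t \<subseteq> cayley_edges n"
  shows "openin (mtopology_of (tree_metric n)) {t'. t' \<subseteq> cayley_edges n \<and> agree n m t t'}"
  unfolding openin_tree_metric
proof (intro conjI ballI)
  fix s assume s: "s \<in> {t'. t' \<subseteq> cayley_edges n \<and> agree n m t t'}"
  show "\<exists>m'. \<forall>t'. t' \<subseteq> cayley_edges n \<and> agree n m' s t' \<longrightarrow>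
      t' \<in> {t'. t' \<subseteq> cayley_edges n \<and> agree n m t t'}"
    by (rule exI[of _ m]) (use s agree_trans in blast)
qed auto

text \<open>A point of the closure looks like a pointed subtree inside every ball. Facts about the
  closure are proved by passing to such an approximation.\<close>

lemma tspace_iff:
  "t \<in> tspace n \<longleftrightarrow> t \<subseteq> cayley_edges n \<and> (\<forall>m. \<exists>t'\<in>pointed_subtrees n. agree n m t t')"
proof -
  let ?T = "mtopology_of (tree_metric n)"
  have "t \<in> tspace n \<longleftrightarrow> t \<in> ?T closure_of pointed_subtrees n"
    unfolding tspace_closure by simp
  also have "\<dots> \<longleftrightarrow> t \<subseteq> cayley_edges n \<and> (\<forall>m. \<exists>t'\<in>pointed_subtrees n. agree n m t t')"
  proof
    assume L: "t \<in> ?T closure_of pointed_subtrees n"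
    then have t: "t \<subseteq> cayley_edges n"
      using closure_of_subset_topspace[of ?T] by auto
    moreover have "\<exists>t'\<in>pointed_subtrees n. agree n m t t'" for m
    proof -
      have "t \<in> {t'. t' \<subseteq> cayley_edges n \<and> agree n m t t'}"
        using t by simp
      then obtain t' where "t' \<in> pointed_subtrees n" "t' \<in> {t'. t' \<subseteq> cayley_edges n \<and> agree n m t t'}"
        using L open_cylinder[OF t, of m] unfolding in_closure_of by metis
      then show ?thesis by blast
    qed
    ultimately show "t \<subseteq> cayley_edges n \<and> (\<forall>m. \<exists>t'\<in>pointed_subtrees n. agree n m t t')"
      by blast
  next
    assume R: "t \<subseteq> cayley_edges n \<and> (\<forall>m. \<exists>t'\<in>pointed_subtrees n. agree n m t t')"
    have "\<exists>t'. t' \<in> pointed_subtrees n \<and> t' \<in> U" if "t \<in> U" "openin ?T U" for U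
    proof -
      obtain m where m: "\<And>t'. t' \<subseteq> cayley_edges n \<Longrightarrow> agree n m t t' \<Longrightarrow> t' \<in> U"
        using \<open>openin ?T U\<close> \<open>t \<in> U\<close> unfolding openin_tree_metric by metis
      obtain t' where "t' \<in> pointed_subtrees n" "agree n m t t'" using R by blast
      then show ?thesis using m[of t'] pointed_subtrees_subset by auto
    qed
    then show "t \<in> ?T closure_of pointed_subtrees n"
      unfolding in_closure_of using R by auto
  qed
  finally show ?thesis .
qed

lemma tspace_subset: "t \<in> tspace n \<Longrightarrow> t \<subseteq> cayley_edges n"
  unfolding tspace_iff by (rule conjunct1)

lemma pointed_in_tspace: "t \<in> pointed_subtrees n \<Longrightarrow> t \<in> tspace n"
  unfolding tspace_iff using pointed_subtrees_subset[of t n] agree_refl[of n _ t] by metis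

lemma openin_subtree_space:
  "openin (subtree_space n) U \<longleftrightarrow>
     U \<subseteq> tspace n \<and> (\<forall>t\<in>U. \<exists>m. \<forall>t'\<in>tspace n. agree n m t t' \<longrightarrow> t' \<in> U)" (is "?L \<longleftrightarrow> ?R")
proof
  assume ?L
  then obtain V where V: "openin (mtopology_of (tree_metric n)) V" "U = V \<inter> tspace n"
    unfolding openin_subtree_space_iff by blast
  show ?R
  proof (intro conjI ballI)
    fix t assume "t \<in> U"
    then have "t \<in> V" using V by simp
    then obtain m where "\<And>t'. t' \<subseteq> cayley_edges n \<Longrightarrow> agree n m t t' \<Longrightarrow> t' \<in> V"
      using V(1) unfolding openin_tree_metric by metis
    then show "\<exists>m. \<forall>t'\<in>tspace n. agree n m t t' \<longrightarrow> t' \<in> U"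
      using V(2) tspace_subset by (intro exI[of _ m]) auto
  qed (use V in simp)
next
  assume R: ?R
  \<comment> \<open>The largest open set whose trace on the space lies in \<open>U\<close>; it
    contains the cylinders that \<open>?R\<close> provides.\<close>
  define V where
    "V = \<Union> {W. openin (mtopology_of (tree_metric n)) W \<and> W \<inter> tspace n \<subseteq> U}"
  have "openin (mtopology_of (tree_metric n)) V"
    unfolding V_def by (rule openin_Union) auto
  moreover have "t \<in> V" if t: "t \<in> U" for t
  proof -
    obtain m where m: "\<And>t'. t' \<in> tspace n \<Longrightarrow> agree n m t t' \<Longrightarrow> t' \<in> U"
      using R t by metis
    have te: "t \<subseteq> cayley_edges n" using R t tspace_subset by blast
    have "{t'. t' \<subseteq> cayley_edges n \<and> agree n m t t'} \<inter> tspace n \<subseteq> U"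
      using m by auto
    then show ?thesis
      unfolding V_def using open_cylinder[OF te, of m] te by auto
  qed
  moreover have "V \<inter> tspace n \<subseteq> U"
    unfolding V_def by auto
  ultimately have "openin (mtopology_of (tree_metric n)) V" "U = V \<inter> tspace n"
    using R by auto
  then show ?L
    unfolding openin_subtree_space_iff by blast
qed

text \<open>A subtree with the root contains the geodesic from the root to each of its vertices: a
  missing edge of it would cut off the root.\<close>

lemma pointed_edge_prefix:
  assumes t: "t \<in> pointed_subtrees n" and x: "x \<in> \<Union> t" and p: "p \<noteq> []" "prefix p x"
  shows "{butlast p, p} \<in> t"
proof (rule ccontr)
  assume "{butlast p, p} \<notin> t"
  moreover have "[] \<in> \<Union> t" "connected_subgraph t" "t \<subseteq> cayley_edges n"
    using t by (auto simp: pointed_subtrees_def)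
  ultimately have "prefix p []"
    using connected_subgraph_prefix[of t n p x "[]"] x p by blast
  then show False using p by simp
qed

lemma tspace_edge_prefix:
  assumes t: "t \<in> tspace n" and x: "x \<in> \<Union> t" and p: "p \<noteq> []" "prefix p x"
  shows "{butlast p, p} \<in> t"
proof -
  obtain t' where t': "t' \<in> pointed_subtrees n" "agree n (Suc (length x)) t t'"
    using t unfolding tspace_iff by blast
  have "x \<in> \<Union> t'"
    using agree_vertex[OF tspace_subset[OF t] t'(2)] x by simp
  then have e: "{butlast p, p} \<in> t'"
    using pointed_edge_prefix[OF t'(1)] p by blast
  then have "{butlast p, p} \<in> cayley_edges n"
    using t'(1) pointed_subtrees_subset by blast
  moreover have "length p \<le> length x" using p by (simp add: prefix_length_le)
  ultimately have "{butlast p, p} \<in> cayley_ball n (Suc (length x))"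
    by (simp add: cayley_ball_eq)
  then show ?thesis using agree_mem[OF t'(2)] e by blast
qed

lemma tspace_vertex_carrier: "\<lbrakk>t \<in> tspace n; g \<in> \<Union> t\<rbrakk> \<Longrightarrow> g \<in> carrier (free_group n)"
  using tspace_subset by (auto intro: cayley_edge_carrier)

lemma tspace_Nil:
  assumes t: "t \<in> tspace n"
  shows "[] \<in> \<Union> t"
proof -
  obtain t' where t': "t' \<in> pointed_subtrees n" "agree n 1 t t'"
    using t unfolding tspace_iff by blast
  have "[] \<in> \<Union> t'" using t'(1) by (simp add: pointed_subtrees_def)
  then show ?thesis
    using agree_vertex[OF pointed_subtrees_subset[OF t'(1)] agree_sym[OF t'(2)]] by simp
qed

text \<open>As \<open>map flip (rev g)\<close> is the inverse of \<open>g\<close>, this moves the base point of \<open>t\<close> to \<open>g\<close>.\<close>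

abbreviation pull :: "nat \<Rightarrow> word \<Rightarrow> subgraph \<Rightarrow> subgraph" where
  "pull n g t \<equiv> translate n (map flip (rev g)) t"

lemma translation_eq:
  "g \<in> carrier (free_group n) \<Longrightarrow> translation n g = graph_on {t \<in> tspace n. g \<in> \<Union> t} (pull n g)"
  by (simp add: translation_def inv_free_group)

lemma agree_pull:
  "\<lbrakk>g \<in> carrier (free_group n); t \<subseteq> cayley_edges n; t' \<subseteq> cayley_edges n;
    agree n (m + length g) t t'\<rbrakk> \<Longrightarrow> agree n m (pull n g t) (pull n g t')"
  unfolding agree_def by (rule translate_ball_cong)

lemma pull_tspace:
  assumes t: "t \<in> tspace n" and g: "g \<in> \<Union> t"
  shows "pull n g t \<in> tspace n"
proof -
  have te: "t \<subseteq> cayley_edges n" and gc: "g \<in> carrier (free_group n)"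
    using t g by (auto intro: tspace_vertex_carrier dest: tspace_subset)
  have "\<exists>s\<in>pointed_subtrees n. agree n m (pull n g t) s" for m
  proof -
    \<comment> \<open>The \<open>Suc\<close> makes the vertex \<open>g\<close> visible in
      \<open>t'\<close>; the summand \<open>length g\<close> is what the translation
      consumes.\<close>
    obtain t' where t': "t' \<in> pointed_subtrees n" "agree n (Suc m + length g) t t'"
      using t unfolding tspace_iff by blast
    have "agree n (m + length g) t t'"
      using t'(2) by (rule agree_mono) simp
    then have "agree n m (pull n g t) (pull n g t')"
      using agree_pull[OF gc te pointed_subtrees_subset[OF t'(1)]] by blast
    moreover have "pull n g t' \<in> pointed_subtrees n"
      using agree_vertex[OF te t'(2)] g by (intro translate_pointed t'(1)) auto
    ultimately show ?thesis by blast
  qed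
  then show ?thesis
    using translate_subset[OF flip_word_closed[OF gc] te] unfolding tspace_iff by blast
qed

lemma inverse_word_inverse [simp]: "map flip (rev (map flip (rev g))) = g"
  by (simp add: rev_map comp_def)

lemma mem_pull_inverse:
  assumes t: "t \<in> tspace n" and g: "g \<in> \<Union> t"
  shows "map flip (rev g) \<in> \<Union> (pull n g t)"
proof -
  have "map flip (rev g) = foldr cancel_cons (map flip (rev g)) []"
    using foldr_cancel_cons_Nil[OF flip_word_closed[OF tspace_vertex_carrier[OF t g]]] by simp
  then show ?thesis
    using tspace_Nil[OF t] unfolding Union_translate by blast
qed

text \<open>Moving the base point to \<open>a # g\<close> is moving it to its neighbour
  \<open>[a]\<close> and from there along \<open>g\<close>. This reduces all translations to those
  by letters.\<close>

lemma pull_Cons: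
  assumes "a # g \<in> carrier (free_group n)" "t \<subseteq> cayley_edges n"
  shows "pull n (a # g) t = pull n g (pull n [a] t)"
proof -
  have "map flip (rev (a # g)) \<in> carrier (free_group n)"
    by (rule flip_word_closed[OF assms(1)])
  then have "map flip (rev g) @ [flip a] \<in> carrier (free_group n)"
    by simp
  note inv = this
  have "map flip (rev g) \<in> carrier (free_group n)" "[flip a] \<in> carrier (free_group n)"
    using inv unfolding carrier_append_iff by simp_all
  then show ?thesis
    using mult_append[OF inv] translate_mult[of "map flip (rev g)" n "[flip a]" t] assms(2) by simp
qed

lemma mem_pull_Cons: "a # g \<in> \<Union> t \<Longrightarrow> g \<in> \<Union> (pull n [a] t)"
  unfolding Union_translate by (rule image_eqI[of _ _ "a # g"]) simp_all

lemma tspace_letter: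
  assumes "t \<in> tspace n" "a # g \<in> \<Union> t"
  shows "[a] \<in> \<Union> t"
  using tspace_edge_prefix[OF assms, of "[a]"] by auto

lemma open_translation_domain: "openin (subtree_space n) {t \<in> tspace n. g \<in> \<Union> t}"
  unfolding openin_subtree_space
proof (intro conjI ballI)
  fix t assume t: "t \<in> {t \<in> tspace n. g \<in> \<Union> t}"
  have "g \<in> \<Union> t'" if "agree n (Suc (length g)) t t'" for t'
    using agree_vertex[OF tspace_subset that] t by auto
  then show "\<exists>m. \<forall>t'\<in>tspace n. agree n m t t' \<longrightarrow> t' \<in> {t \<in> tspace n. g \<in> \<Union> t}"
    by blast
qed auto

lemma closed_translation_domain: "closedin (subtree_space n) {t \<in> tspace n. g \<in> \<Union> t}"
proof -
  have "openin (subtree_space n) {t \<in> tspace n. g \<notin> \<Union> t}"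
    unfolding openin_subtree_space
  proof (intro conjI ballI)
    fix t assume t: "t \<in> {t \<in> tspace n. g \<notin> \<Union> t}"
    have "g \<notin> \<Union> t'" if "t' \<in> tspace n" "agree n (Suc (length g)) t t'" for t'
      using agree_vertex[OF tspace_subset[OF that(1)] agree_sym[OF that(2)]] t by auto
    then show "\<exists>m. \<forall>t'\<in>tspace n. agree n m t t' \<longrightarrow> t' \<in> {t \<in> tspace n. g \<notin> \<Union> t}"
      by blast
  qed auto
  moreover have "{t \<in> tspace n. g \<notin> \<Union> t} = tspace n - {t \<in> tspace n. g \<in> \<Union> t}"
    by auto
  ultimately show ?thesis
    unfolding closedin_def by auto
qed

lemma continuous_map_pull:
  assumes g: "g \<in> carrier (free_group n)"
  shows "continuous_map (subtopology (subtree_space n) {t \<in> tspace n. g \<in> \<Union> t})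
    (subtree_space n) (pull n g)"
proof -
  let ?W = "{t \<in> tspace n. g \<in> \<Union> t}"
  have "openin (subtree_space n) {t \<in> ?W. pull n g t \<in> U}" if U: "openin (subtree_space n) U" for U
    unfolding openin_subtree_space
  proof (intro conjI ballI)
    fix t assume "t \<in> {t \<in> ?W. pull n g t \<in> U}"
    then have t: "t \<in> tspace n" "g \<in> \<Union> t" "pull n g t \<in> U"
      by simp_all
    obtain m where m: "\<forall>s\<in>tspace n. agree n m (pull n g t) s \<longrightarrow> s \<in> U"
      using U t(3) unfolding openin_subtree_space by (elim conjE ballE[where x = "pull n g t"]) auto
    have "t' \<in> {t \<in> ?W. pull n g t \<in> U}"
      if t': "t' \<in> tspace n" and eq: "agree n (Suc m + length g) t t'" for t'
    proof -
      have gt': "g \<in> \<Union> t'"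
        by (rule agree_vertex[OF tspace_subset[OF t(1)] eq]) (use t in simp_all)
      have "agree n (m + length g) t t'"
        using eq by (rule agree_mono) simp
      then have "agree n m (pull n g t) (pull n g t')"
        by (rule agree_pull[OF g tspace_subset[OF t(1)] tspace_subset[OF t']])
      then have "pull n g t' \<in> U"
        using m pull_tspace[OF t' gt'] by simp
      then show ?thesis
        using t' gt' by simp
    qed
    note step = this
    show "\<exists>m. \<forall>t'\<in>tspace n. agree n m t t' \<longrightarrow> t' \<in> {t \<in> ?W. pull n g t \<in> U}"
      by (rule exI[of _ "Suc m + length g"]) (intro ballI impI step)
  qed auto
  note open_preimage = this
  have top: "topspace (subtopology (subtree_space n) ?W) = ?W"
    by auto
  show ?thesis
    unfolding continuous_map_def top
  proof (intro conjI allI impI)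
    show "pull n g \<in> ?W \<rightarrow> tspace n"
      using pull_tspace[of _ n g] by auto
    show "openin (subtopology (subtree_space n) ?W) {t \<in> ?W. pull n g t \<in> U}"
      if "openin (subtree_space n) U" for U
      unfolding openin_open_subtopology[OF open_translation_domain]
      using open_preimage[OF that] by auto
  qed
qed

lemma continuous_map_pull_into:
  assumes g: "g \<in> carrier (free_group n)"
  shows "continuous_map (subtopology (subtree_space n) {t \<in> tspace n. g \<in> \<Union> t})
    (subtopology (subtree_space n) {t \<in> tspace n. map flip (rev g) \<in> \<Union> t}) (pull n g)"
proof (rule continuous_map_into_subtopology[OF continuous_map_pull[OF g]])
  show "pull n g \<in> topspace (subtopology (subtree_space n) {t \<in> tspace n. g \<in> \<Union> t})
      \<rightarrow> {t \<in> tspace n. map flip (rev g) \<in> \<Union> t}"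
    by (auto simp: pull_tspace mem_pull_inverse simp del: Union_iff)
qed

lemma homeomorphic_map_pull:
  assumes g: "g \<in> carrier (free_group n)"
  shows "homeomorphic_map (subtopology (subtree_space n) {t \<in> tspace n. g \<in> \<Union> t})
    (subtopology (subtree_space n) {t \<in> tspace n. map flip (rev g) \<in> \<Union> t}) (pull n g)"
proof -
  let ?g = "map flip (rev g)"
  have g': "?g \<in> carrier (free_group n)"
    by (rule flip_word_closed[OF g])
  have "homeomorphic_maps (subtopology (subtree_space n) {t \<in> tspace n. g \<in> \<Union> t})
    (subtopology (subtree_space n) {t \<in> tspace n. ?g \<in> \<Union> t}) (pull n g) (pull n ?g)"
    unfolding homeomorphic_maps_def
  proof (intro conjI ballI)
    show "continuous_map (subtopology (subtree_space n) {t \<in> tspace n. g \<in> \<Union> t})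
      (subtopology (subtree_space n) {t \<in> tspace n. ?g \<in> \<Union> t}) (pull n g)"
      by (rule continuous_map_pull_into[OF g])
    show "continuous_map (subtopology (subtree_space n) {t \<in> tspace n. ?g \<in> \<Union> t})
      (subtopology (subtree_space n) {t \<in> tspace n. g \<in> \<Union> t}) (pull n ?g)"
      using continuous_map_pull_into[OF g'] unfolding inverse_word_inverse .
  next
    fix t assume "t \<in> topspace (subtopology (subtree_space n) {t \<in> tspace n. g \<in> \<Union> t})"
    then show "pull n ?g (pull n g t) = t"
      using translate_cancel(1)[OF g, of t] tspace_subset by auto
  next
    fix t assume "t \<in> topspace (subtopology (subtree_space n) {t \<in> tspace n. ?g \<in> \<Union> t})"
    then show "pull n g (pull n ?g t) = t"
      using translate_cancel(2)[OF g, of t] tspace_subset by auto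
  qed
  then show ?thesis
    unfolding homeomorphic_map_maps by blast
qed

section \<open>Translations by letters as bi-Lipschitz maps between clopen sets\<close>

lemma partial_homeo_translation:
  assumes g: "g \<in> carrier (free_group n)"
  shows "partial_homeo (subtree_space n) (translation n g)"
  unfolding partial_homeo_def translation_eq[OF g]
  using open_translation_domain homeomorphic_map_pull[OF g] by blast

lemma Range_translation:
  assumes g: "g \<in> carrier (free_group n)"
  shows "Range (translation n g) = {t \<in> tspace n. map flip (rev g) \<in> \<Union> t}"
proof -
  have "Range (translation n g) = pull n g ` {t \<in> tspace n. g \<in> \<Union> t}"
    unfolding translation_eq[OF g] graph_on_def by blast
  moreover have "tspace n \<inter> {t \<in> tspace n. h \<in> \<Union> t} = {t \<in> tspace n. h \<in> \<Union> t}" for h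
    by auto
  ultimately show ?thesis
    using homeomorphic_imp_surjective_map[OF homeomorphic_map_pull[OF g]]
    by (simp only: topspace_subtopology)
qed

lemma subtree_space_metric:
  "mtopology_of (submetric (tree_metric n) (tspace n)) = subtree_space n"
  unfolding mtopology_of_submetric tspace_closure by (simp add: subtree_space_def)

text \<open>One letter costs one level of agreement, and one level is a factor \<open>2\<close> in
  the metric.\<close>

lemma tree_dist_pull_le:
  assumes a: "[a] \<in> carrier (free_group n)" and t: "t \<subseteq> cayley_edges n" "t' \<subseteq> cayley_edges n"
  shows "tree_dist n (pull n [a] t) (pull n [a] t') \<le> 2 * tree_dist n t t'"
proof (cases rule: tree_dist_cases[of n t t'])
  case 1
  then have "agree n m t t'" for m
    using tree_dist_le_agree[of n t t' m] by simp
  then have le: "tree_dist n (pull n [a] t) (pull n [a] t') \<le> (1/2) ^ m" for m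
    using agree_pull[OF a t] by (simp add: tree_dist_le_agree)
  have "tree_dist n (pull n [a] t) (pull n [a] t') \<le> 0"
  proof (rule field_le_epsilon)
    fix e :: real assume "0 < e"
    then obtain m where "(1/2::real) ^ m < e"
      using real_arch_pow_inv[of e "1/2"] by auto
    then show "tree_dist n (pull n [a] t) (pull n [a] t') \<le> 0 + e"
      using le[of m] by simp
  qed
  then show ?thesis using 1 by simp
next
  case (2 m)
  then have "agree n m t t'"
    using tree_dist_le_agree[of n t t' m] by simp
  then show ?thesis
  proof (cases m)
    \<comment> \<open>There is no level left to lose, but all distances are at most
      \<open>1\<close>.\<close>
    case 0
    have "tree_dist n (pull n [a] t) (pull n [a] t') \<le> (1/2) ^ 0"
      unfolding tree_dist_le_agree by simp
    then show ?thesis using 2 0 by simp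
  next
    case (Suc k)
    then have "agree n k (pull n [a] t) (pull n [a] t')"
      using \<open>agree n m t t'\<close> agree_pull[OF a t, of k] by simp
    then have "tree_dist n (pull n [a] t) (pull n [a] t') \<le> (1/2) ^ k"
      unfolding tree_dist_le_agree .
    then show ?thesis using 2 Suc by simp
  qed
qed

text \<open>The reverse estimate is the forward one for the inverse letter.\<close>

lemma clopen_bi_lipschitz_translation:
  assumes a: "[a] \<in> carrier (free_group n)"
  shows "clopen_bi_lipschitz (submetric (tree_metric n) (tspace n)) (translation n [a])"
proof -
  have a': "[flip a] \<in> carrier (free_group n)"
    using flip_word_closed[OF a] by simp
  have D: "Domain (translation n [a]) = {t \<in> tspace n. [a] \<in> \<Union> t}"
    unfolding translation_eq[OF a] graph_on_def by blast
  have "tree_dist n u' v' \<le> 2 * tree_dist n u v \<and> tree_dist n u v \<le> 2 * tree_dist n u' v'"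
    if "(u, u') \<in> translation n [a]" "(v, v') \<in> translation n [a]" for u u' v v'
  proof -
    have u: "u \<subseteq> cayley_edges n" "v \<subseteq> cayley_edges n" "u' = pull n [a] u" "v' = pull n [a] v"
      using that tspace_subset unfolding translation_eq[OF a] graph_on_def by auto
    then have "pull n [flip a] u' = u" "pull n [flip a] v' = v"
      "u' \<subseteq> cayley_edges n" "v' \<subseteq> cayley_edges n"
      using translate_cancel(1)[OF a] translate_subset[OF a'] by simp_all
    then show ?thesis
      using tree_dist_pull_le[OF a u(1,2)] tree_dist_pull_le[OF a', of u' v'] u by simp
  qed
  then have "\<exists>B. \<forall>(u, u')\<in>translation n [a]. \<forall>(v, v')\<in>translation n [a].
      tree_dist n u' v' \<le> B * tree_dist n u v \<and> tree_dist n u v \<le> B * tree_dist n u' v'"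
    by (intro exI[of _ 2]) auto
  then show ?thesis
    unfolding clopen_bi_lipschitz_def subtree_space_metric
    using partial_homeo_translation[OF a] D Range_translation[OF a] closed_translation_domain
    by simp
qed

lemma translation_generators:
  "translation n ` (free_generators n \<union> m_inv (free_group n) ` free_generators n) =
     (\<lambda>a. translation n [a]) ` letters n"
proof -
  have 1: "free_generators n = (\<lambda>i. [(i, True)]) ` {..<n}"
    unfolding free_generators_def by auto
  have "m_inv (free_group n) ` free_generators n = (\<lambda>i. [(i, False)]) ` {..<n}"
    unfolding 1 image_image
    by (intro image_cong refl) (simp add: inv_free_group letter_closed flip_def)
  moreover have "letters n = (\<lambda>i. (i, True)) ` {..<n} \<union> (\<lambda>i. (i, False)) ` {..<n}"
    by (auto simp: image_iff)
  ultimately show ?thesis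
    unfolding 1 by (simp add: image_Un image_image)
qed

text \<open>The limit collects the edges on which the sequence has become stationary. Depths
  \<open>k j\<close> larger than \<open>j\<close> occur in the construction of the dense
  orbit.\<close>

lemma tspace_limit:
  assumes t: "\<And>j. t j \<in> tspace n" and k: "\<And>j. j \<le> k j" "\<And>j. k j \<le> k (Suc j)"
    and eq: "\<And>j. agree n (k j) (t j) (t (Suc j))"
  shows "\<exists>s\<in>tspace n. \<forall>j. agree n (k j) (t j) s"
proof -
  have mono: "k i \<le> k j" if "i \<le> j" for i j
    using k(2) that by (rule lift_Suc_mono_le)
  have ag: "agree n (k i) (t i) (t (i + d))" for i d
  proof (induction d)
    case (Suc d)
    have "agree n (k i) (t (i + d)) (t (Suc (i + d)))"
      using eq[of "i + d"] by (rule agree_mono) (simp add: mono)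
    then show ?case
      using agree_trans[OF Suc.IH] by simp
  qed simp
  define s where "s = (\<Union>j. cayley_ball n (k j) \<inter> t j)"
  have s: "agree n (k j) (t j) s" for j
    unfolding agree_def
  proof (intro equalityI subsetI)
    fix c assume "c \<in> cayley_ball n (k j) \<inter> t j"
    then show "c \<in> cayley_ball n (k j) \<inter> s"
      unfolding s_def by auto
  next
    fix c assume "c \<in> cayley_ball n (k j) \<inter> s"
    then obtain i where c: "c \<in> cayley_ball n (k j)" "c \<in> cayley_ball n (k i)" "c \<in> t i"
      unfolding s_def by auto
    have "c \<in> t j"
    proof (cases "i \<le> j")
      case True
      then obtain d where "j = i + d" using le_Suc_ex by blast
      then show ?thesis using agree_mem[OF ag[of i d] c(2)] c(3) by simp
    next
      case False
      then obtain d where "i = j + d" using le_Suc_ex[of j i] by auto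
      then show ?thesis using agree_mem[OF ag[of j d] c(1)] c(3) by simp
    qed
    then show "c \<in> cayley_ball n (k j) \<inter> t j"
      using c by simp
  qed
  have "s \<subseteq> cayley_edges n"
    unfolding s_def using cayley_ball_subset by auto
  moreover have "\<forall>m. \<exists>t'\<in>pointed_subtrees n. agree n m s t'"
  proof
    fix m
    obtain t' where "t' \<in> pointed_subtrees n" "agree n m (t m) t'"
      using t[of m] unfolding tspace_iff by auto
    moreover have "agree n m s (t m)"
      using agree_sym[OF agree_mono[OF s[of m] k(1)]] .
    ultimately show "\<exists>t'\<in>pointed_subtrees n. agree n m s t'"
      using agree_trans by blast
  qed
  ultimately have "s \<in> tspace n"
    unfolding tspace_iff by (rule conjI)
  then show ?thesis
    using s by blast
qed

text \<open>This is compactness of the space of pointed subtrees.\<close>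

lemma tspace_uniform:
  assumes ex: "\<And>t. t \<in> tspace n \<Longrightarrow> \<exists>m. R t m"
    and mono: "\<And>t t' m m'. \<lbrakk>t \<in> tspace n; t' \<in> tspace n; R t m; m \<le> m'; agree n m t t'\<rbrakk>
      \<Longrightarrow> R t' m'"
  shows "\<exists>m. \<forall>t\<in>tspace n. R t m"
proof (rule ccontr)
  assume "\<not> ?thesis"
  then have bad: "\<exists>t\<in>tspace n. \<not> R t m" for m by blast
  \<comment> \<open>\<open>P k t\<close> says that the cylinder of depth \<open>k\<close> around
    \<open>t\<close> contains counterexamples for every \<open>m\<close>. It has finitely many
    subcylinders of depth \<open>Suc k\<close>, so one of them is bad again; the limit of nested bad
    cylinders contradicts \<open>ex\<close>.\<close>
  define P where
    "P k t \<longleftrightarrow> t \<in> tspace n \<and> (\<forall>m. \<exists>t'\<in>tspace n. agree n k t t' \<and> \<not> R t' m)" for k t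
  have "\<exists>t. P 0 t"
    using bad unfolding P_def by auto
  moreover have "\<exists>t'. P (Suc k) t' \<and> agree n k t t'" if P: "P k t" for k t
  proof -
    have "\<forall>m. \<exists>t'. t' \<in> tspace n \<and> agree n k t t' \<and> \<not> R t' m"
      using P unfolding P_def by blast
    from choice[OF this] obtain f
      where f: "\<And>m. f m \<in> tspace n" "\<And>m. agree n k t (f m)" "\<And>m. \<not> R (f m) m"
      by blast
    have "range (\<lambda>m. cayley_ball n (Suc k) \<inter> f m) \<subseteq> Pow (cayley_ball n (Suc k))"
      by auto
    then have "finite (range (\<lambda>m. cayley_ball n (Suc k) \<inter> f m))"
      by (rule finite_subset) (simp add: finite_cayley_ball)
    from pigeonhole_infinite[OF infinite_UNIV_nat this] obtain m0
      where inf: "infinite {m. cayley_ball n (Suc k) \<inter> f m = cayley_ball n (Suc k) \<inter> f m0}"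
      by auto
    have "\<exists>t'\<in>tspace n. agree n (Suc k) (f m0) t' \<and> \<not> R t' m" for m
    proof -
      obtain m' where m': "m \<le> m'" "cayley_ball n (Suc k) \<inter> f m' = cayley_ball n (Suc k) \<inter> f m0"
        using inf unfolding infinite_nat_iff_unbounded_le by auto
      \<comment> \<open>By monotonicity a counterexample for the larger \<open>m'\<close> is also
        one for \<open>m\<close>.\<close>
      have "\<not> R (f m') m"
        using mono[OF f(1)[of m'] f(1)[of m'] _ m'(1)] f(3)[of m'] agree_refl by auto
      moreover have "agree n (Suc k) (f m0) (f m')"
        using m'(2) unfolding agree_def by simp
      ultimately show ?thesis using f(1)[of m'] by blast
    qed
    then have "P (Suc k) (f m0)"
      unfolding P_def using f(1) by simp
    then show ?thesis using f(2) by blast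
  qed
  ultimately have "\<exists>t. \<forall>k. P k (t k) \<and> agree n k (t k) (t (Suc k))"
    by (rule dependent_nat_choice)
  then obtain t where t: "\<And>k. P k (t k)" "\<And>k. agree n k (t k) (t (Suc k))"
    by auto
  have tm: "t k \<in> tspace n" for k using t(1)[of k] by (simp add: P_def)
  obtain s where s: "s \<in> tspace n" "\<And>k. agree n k (t k) s"
    using tspace_limit[of t n "\<lambda>j. j"] tm t(2) by auto
  obtain m where m: "R s m" using ex[OF s(1)] ..
  obtain t' where t': "t' \<in> tspace n" "agree n m (t m) t'" "\<not> R t' m"
    using t(1)[of m] unfolding P_def by blast
  show False
    using mono[OF s(1) t'(1) m order_refl] agree_trans[OF agree_sym[OF s(2)[of m]] t'(2)] t'(3)
    by simp
qed

section \<open>The first level at which two trees differ\<close>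

lemma edge_cases:
  assumes "t \<subseteq> cayley_edges n" "c \<in> t"
  obtains w a where "w @ [a] \<in> carrier (free_group n)" "c = {w, w @ [a]}"
  using subsetD[OF assms] unfolding cayley_edges_iff by blast

text \<open>An edge that appears only at level \<open>m + 2\<close> lies beyond some first letter
  \<open>a\<close>, and moving the base point there brings it one level closer. Agreement to
  positive depth puts \<open>[a]\<close> into both trees.\<close>

lemma edge_after_letter:
  assumes t: "t \<in> tspace n" "t' \<in> tspace n" and c: "c \<in> cayley_ball n (Suc (Suc m))" "c \<in> t" "c \<notin> t'"
    and eq: "agree n (Suc m) t t'"
  shows "\<exists>a\<in>letters n. [a] \<in> \<Union> t \<and> [a] \<in> \<Union> t' \<and>
    (\<exists>c'\<in>cayley_ball n (Suc m). c' \<in> pull n [a] t \<and> c' \<notin> pull n [a] t')"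
proof -
  have ce: "c \<in> cayley_edges n" using c(1) cayley_ball_subset by blast
  obtain g b where gb: "g @ [b] \<in> carrier (free_group n)" "c = {g, g @ [b]}"
    using ce unfolding cayley_edges_iff by blast
  have "c \<notin> cayley_ball n (Suc m)"
    using agree_mem[OF eq] c by blast
  then have "length g = Suc m"
    using c(1) ce unfolding gb by (auto simp: cayley_ball_eq)
  then obtain a g' where g: "g = a # g'" "length g' = m"
    by (auto simp: length_Suc_conv)
  have "g @ [b] \<in> \<Union> t" using c(2) gb by auto
  then have e: "{[], [a]} \<in> t"
    using tspace_edge_prefix[OF t(1), of "g @ [b]" "[a]"] g by simp
  then have "{[], [a]} \<in> cayley_ball n (Suc m)"
    using tspace_subset[OF t(1)] by (auto simp: cayley_ball_eq)
  then have e': "{[], [a]} \<in> t'"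
    using agree_mem[OF eq] e by blast
  have carr: "a # g' @ [b] \<in> carrier (free_group n)" using gb g by simp
  then have a: "a \<in> letters n" "[a] \<in> carrier (free_group n)" and g'b: "g' @ [b] \<in> carrier (free_group n)"
    unfolding carrier_Cons_iff by (auto simp: letter_closed)
  have "a # g' \<in> carrier (free_group n)"
    using gb g unfolding carrier_snoc_iff by simp
  then have "foldr cancel_cons [a] ` {g', g' @ [b]} = c"
    using mult_append[of "[a]" g' n] mult_append[of "[a]" "g' @ [b]" n] carr gb g by auto
  moreover have c'e: "{g', g' @ [b]} \<in> cayley_edges n"
    using g'b unfolding cayley_edges_iff by blast
  ultimately have "{g', g' @ [b]} \<in> pull n [a] t" "{g', g' @ [b]} \<notin> pull n [a] t'"
    using translate_mem_iff[OF a(2) tspace_subset[OF t(1)] c'e]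
      translate_mem_iff[OF a(2) tspace_subset[OF t(2)] c'e] c by simp_all
  moreover have "{g', g' @ [b]} \<in> cayley_ball n (Suc m)"
    using c'e g by (simp add: cayley_ball_eq)
  ultimately show ?thesis
    using a(1) e e' by blast
qed

text \<open>A suitable letter lowers the level of the first difference by exactly one; this is the
  induction step of the separation estimate.\<close>

lemma agree_step:
  assumes t: "t \<in> tspace n" "t' \<in> tspace n"
    and eq: "agree n (Suc m) t t'" and ne: "\<not> agree n (Suc (Suc m)) t t'"
  shows "\<exists>a\<in>letters n. [a] \<in> \<Union> t \<and> [a] \<in> \<Union> t' \<and>
    agree n m (pull n [a] t) (pull n [a] t') \<and> \<not> agree n (Suc m) (pull n [a] t) (pull n [a] t')"
proof -
  have "\<exists>a\<in>letters n. [a] \<in> \<Union> t \<and> [a] \<in> \<Union> t' \<and> \<not> agree n (Suc m) (pull n [a] t) (pull n [a] t')"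
  proof -
    obtain c where c: "c \<in> cayley_ball n (Suc (Suc m))" "c \<in> t \<and> c \<notin> t' \<or> c \<in> t' \<and> c \<notin> t"
      using ne unfolding agree_def by auto
    from c(2) show ?thesis
    proof
      assume "c \<in> t \<and> c \<notin> t'"
      then obtain a c' where "a \<in> letters n" "[a] \<in> \<Union> t" "[a] \<in> \<Union> t'"
        "c' \<in> cayley_ball n (Suc m)" "c' \<in> pull n [a] t" "c' \<notin> pull n [a] t'"
        using edge_after_letter[OF t c(1) _ _ eq] by blast
      then show ?thesis
        using agree_mem[of n "Suc m" "pull n [a] t" "pull n [a] t'" c'] by blast
    next
      assume "c \<in> t' \<and> c \<notin> t"
      then obtain a c' where "a \<in> letters n" "[a] \<in> \<Union> t'" "[a] \<in> \<Union> t"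
        "c' \<in> cayley_ball n (Suc m)" "c' \<in> pull n [a] t'" "c' \<notin> pull n [a] t"
        using edge_after_letter[OF t(2,1) c(1) _ _ agree_sym[OF eq]] by blast
      then show ?thesis
        using agree_mem[of n "Suc m" "pull n [a] t" "pull n [a] t'" c'] by blast
    qed
  qed
  then obtain a where a: "a \<in> letters n" "[a] \<in> \<Union> t" "[a] \<in> \<Union> t'"
    "\<not> agree n (Suc m) (pull n [a] t) (pull n [a] t')"
    by blast
  have "agree n m (pull n [a] t) (pull n [a] t')"
    using eq by (intro agree_pull letter_closed a(1) tspace_subset t) simp
  then show ?thesis using a by blast
qed

section \<open>Trees described by their vertices\<close>

text \<open>Every pointed subtree is recovered from its vertices in this way, so trees can be built
  and compared as sets of words.\<close>

definition tree_of :: "word set \<Rightarrow> subgraph" where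
  "tree_of V = {{w, w @ [a]} | w a. w @ [a] \<in> V}"

lemma edge_in_tree_of: "{w, w @ [a]} \<in> tree_of V \<longleftrightarrow> w @ [a] \<in> V"
proof
  assume "{w, w @ [a]} \<in> tree_of V"
  then obtain v b where vb: "{w, w @ [a]} = {v, v @ [b]}" "v @ [b] \<in> V"
    unfolding tree_of_def by blast
  then consider "w = v" "w @ [a] = v @ [b]" | "w = v @ [b]" "w @ [a] = v"
    by (auto simp: doubleton_eq_iff)
  then show "w @ [a] \<in> V"
    using vb(2) by cases auto
qed (unfold tree_of_def, blast)

lemma sym_adjacency: "sym (adjacency t)"
  by (auto simp: sym_def adjacency_def insert_commute)

lemma connected_subgraphI:
  assumes "\<And>w. w \<in> \<Union> t \<Longrightarrow> (u, w) \<in> (adjacency t)\<^sup>*"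
  shows "connected_subgraph t"
  unfolding connected_subgraph_def
proof (intro ballI)
  fix g h assume "g \<in> \<Union> t" "h \<in> \<Union> t"
  then have "(u, g) \<in> (adjacency t)\<^sup>*" "(u, h) \<in> (adjacency t)\<^sup>*"
    using assms by simp_all
  then show "(g, h) \<in> (adjacency t)\<^sup>*"
    using sym_rtrancl[OF sym_adjacency[of t]] by (meson rtrancl_trans symD)
qed

lemma card_neq_1I: "\<lbrakk>c \<in> A; c' \<in> A; c \<noteq> c'\<rbrakk> \<Longrightarrow> card A \<noteq> 1"
  by (metis card_1_singletonE singletonD)

lemma ex_other_if_card_neq_1: "\<lbrakk>card A \<noteq> 1; c \<in> A\<rbrakk> \<Longrightarrow> \<exists>c'\<in>A. c' \<noteq> c"
  by (metis card.empty card_insert_if empty_iff finite.emptyI is_singletonI' is_singleton_altdef)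

text \<open>Prefix closure gives connectedness. Extendability gives two edges at every vertex other
  than the root; the root has no parent and therefore needs two children.\<close>

locale vertex_tree =
  fixes n :: nat and V :: "word set"
  assumes carrier: "V \<subseteq> carrier (free_group n)"
    and prefix_closed: "w @ [a] \<in> V \<Longrightarrow> w \<in> V"
    and extendable: "w \<in> V \<Longrightarrow> \<exists>a. w @ [a] \<in> V"
    and root: "\<exists>a b. a \<noteq> b \<and> [a] \<in> V \<and> [b] \<in> V"
begin

lemma Nil_mem: "[] \<in> V"
  using root prefix_closed[of "[]"] by auto

lemma Union_tree_of: "\<Union> (tree_of V) = V"
proof
  show "\<Union> (tree_of V) \<subseteq> V"
    unfolding tree_of_def using prefix_closed by auto
  show "V \<subseteq> \<Union> (tree_of V)"
  proof
    fix w assume "w \<in> V"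
    then obtain a where "w @ [a] \<in> V" using extendable by blast
    then have "{w, w @ [a]} \<in> tree_of V" by (simp only: edge_in_tree_of)
    then show "w \<in> \<Union> (tree_of V)" by blast
  qed
qed

lemma reachable: "w \<in> V \<Longrightarrow> ([], w) \<in> (adjacency (tree_of V))\<^sup>*"
proof (induction w rule: rev_induct)
  case (snoc a w)
  have "(w, w @ [a]) \<in> adjacency (tree_of V)"
    using snoc.prems edge_in_tree_of[of w a V] unfolding adjacency_def by simp
  then show ?case
    using snoc.IH[OF prefix_closed[OF snoc.prems]] by simp
qed simp

lemma infinite_V: "infinite V"
proof
  assume fin: "finite V"
  have "\<exists>w\<in>V. length w = k" for k
  proof (induction k)
    case 0
    then show ?case using Nil_mem by auto
  next
    case (Suc k)
    then obtain w where "w \<in> V" "length w = k" by blast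
    moreover obtain a where "w @ [a] \<in> V" using extendable[OF \<open>w \<in> V\<close>] ..
    ultimately show ?case by (intro bexI[of _ "w @ [a]"]) auto
  qed
  then have "k \<in> length ` V" for k by (metis imageI)
  then have "length ` V = UNIV" by blast
  then show False using fin finite_imageI[OF fin, of length] by simp
qed

lemma tree_of_no_dead_ends:
  assumes "g \<in> V"
  shows "card {c \<in> tree_of V. g \<in> c} \<noteq> 1"
proof (cases g rule: rev_cases)
  case Nil
  obtain a b where ab: "a \<noteq> b" "[a] \<in> V" "[b] \<in> V" using root by blast
  have "{[], [a]} \<in> tree_of V" "{[], [b]} \<in> tree_of V"
    using ab edge_in_tree_of[of "[]" _ V] by simp_all
  moreover have "{[], [a]} \<noteq> {[], [b]}" using ab(1) by (auto simp: doubleton_eq_iff)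
  ultimately show ?thesis
    using Nil by (intro card_neq_1I[of "{[], [a]}" _ "{[], [b]}"]) auto
next
  case (snoc h x)
  obtain a where a: "g @ [a] \<in> V" using extendable[OF assms] ..
  have "{h, g} \<in> tree_of V" "{g, g @ [a]} \<in> tree_of V"
    using edge_in_tree_of[of h x V] edge_in_tree_of[of g a V] a assms snoc by simp_all
  moreover have "{h, g} \<noteq> {g, g @ [a]}" using snoc by (auto simp: doubleton_eq_iff)
  ultimately show ?thesis
    by (intro card_neq_1I[of "{h, g}" _ "{g, g @ [a]}"]) auto
qed

lemma tree_of_pointed: "tree_of V \<in> pointed_subtrees n"
proof -
  have "tree_of V \<subseteq> cayley_edges n"
    unfolding tree_of_def using carrier cayley_edges_iff by blast
  moreover have "connected_subgraph (tree_of V)"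
    using reachable by (intro connected_subgraphI[of _ "[]"]) (simp add: Union_tree_of)
  moreover have "infinite (tree_of V)"
  proof
    assume "finite (tree_of V)"
    moreover have "finite c" if "c \<in> tree_of V" for c
      using that by (auto simp: tree_of_def)
    ultimately have "finite (\<Union> (tree_of V))" by simp
    then show False using infinite_V Union_tree_of by simp
  qed
  moreover have "\<forall>g\<in>V. card {c \<in> tree_of V. g \<in> c} \<noteq> 1"
    using tree_of_no_dead_ends by blast
  ultimately show ?thesis
    unfolding pointed_subtrees_def mem_Collect_eq Union_tree_of using Nil_mem by simp
qed

end

text \<open>
  The vertices of the tree that is \<open>U\<close> up to level \<open>k\<close>, branches freely above the words in \<open>S\<close>
  of length \<open>k\<close> and continues as a straight ray above the others.
\<close>

definition sprout :: "nat \<Rightarrow> word set \<Rightarrow> word set \<Rightarrow> nat \<Rightarrow> word set" where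
  "sprout n U S k = {w \<in> carrier (free_group n). take k w \<in> U \<and>
     (take k w \<notin> S \<longrightarrow> drop k w = replicate (length w - k) (last (take k w)))}"

lemma sprout_short:
  "length w \<le> k \<Longrightarrow> w \<in> sprout n U S k \<longleftrightarrow> w \<in> carrier (free_group n) \<and> w \<in> U"
  by (auto simp: sprout_def)

text \<open>The condition on \<open>k\<close> preserves the branching of \<open>U\<close> at the
  root and gives every truncated word a last letter with which to continue as a ray.\<close>

lemma vertex_tree_sprout:
  assumes U: "U \<subseteq> carrier (free_group n)" "\<And>w a. w @ [a] \<in> U \<Longrightarrow> w \<in> U"
    "\<And>w. w \<in> U \<Longrightarrow> \<exists>a. w @ [a] \<in> U" "\<exists>a b. a \<noteq> b \<and> [a] \<in> U \<and> [b] \<in> U"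
    and k: "1 \<le> k"
  shows "vertex_tree n (sprout n U S k)"
proof
  show "sprout n U S k \<subseteq> carrier (free_group n)" by (auto simp: sprout_def)
  show "\<exists>a b. a \<noteq> b \<and> [a] \<in> sprout n U S k \<and> [b] \<in> sprout n U S k"
  proof -
    obtain a b where "a \<noteq> b" "[a] \<in> U" "[b] \<in> U" using U(4) by blast
    moreover have "length [a] \<le> k" "length [b] \<le> k" using k by simp_all
    ultimately show ?thesis using U(1) sprout_short by blast
  qed
  fix w
  show "w \<in> sprout n U S k" if w: "w @ [a] \<in> sprout n U S k" for a
  proof (cases "k \<le> length w")
    case True
    then have "drop k w = replicate (length w - k) (last (take k w))"
      if "drop k w @ [a] = replicate (Suc (length w) - k) (last (take k w))"
      using that True by (simp add: Suc_diff_le replicate_append_same[symmetric])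
    then show ?thesis
      using w True carrier_snoc_iff[of w a n] unfolding sprout_def by auto
  next
    case False
    then have "w @ [a] \<in> U" "w @ [a] \<in> carrier (free_group n)"
      using w by (simp_all add: sprout_short)
    then have "w \<in> U" "w \<in> carrier (free_group n)"
      using U(2) by (auto simp: carrier_snoc_iff)
    then show ?thesis using False by (simp add: sprout_short)
  qed
  show "\<exists>a. w @ [a] \<in> sprout n U S k" if w: "w \<in> sprout n U S k"
  proof (cases "length w < k")
    case True
    then have "w \<in> U" using w by (simp add: sprout_short)
    then obtain a where "w @ [a] \<in> U" using U(3) by blast
    then have "w @ [a] \<in> sprout n U S k" using True U(1) by (auto simp: sprout_short)
    then show ?thesis ..
  next
    case False
    then have ne: "w \<noteq> []" using k by auto
    have wc: "w \<in> carrier (free_group n)" using w by (simp add: sprout_def)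
    \<comment> \<open>Repeating the last letter never cancels, so the ray stays reduced.\<close>
    have "w @ [last w] \<in> carrier (free_group n)"
      using wc ne carrier_letters[OF wc] last_in_set[OF ne] flip_neq[of "last w"]
      unfolding carrier_snoc_iff by (metis subsetD)
    moreover have "drop k w @ [last w] = replicate (Suc (length w) - k) (last (take k w))"
      if "drop k w = replicate (length w - k) (last (take k w))"
    proof (cases "length w = k")
      case True
      then show ?thesis using that by simp
    next
      case neq: False
      then have "drop k w \<noteq> []" using False by simp
      then have "last w = last (drop k w)" by simp
      also have "\<dots> = last (take k w)"
        using \<open>drop k w \<noteq> []\<close> by (subst that) (simp add: last_replicate)
      finally show ?thesis
        using that False by (simp add: Suc_diff_le replicate_append_same)
    qed
    ultimately have "w @ [last w] \<in> sprout n U S k"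
      using w False unfolding sprout_def by auto
    then show ?thesis ..
  qed
qed

lemma agree_tree_of:
  assumes "\<And>w. \<lbrakk>w \<in> carrier (free_group n); length w \<le> k\<rbrakk> \<Longrightarrow> w \<in> V \<longleftrightarrow> w \<in> V'"
  shows "agree n k (tree_of V) (tree_of V')"
proof -
  have "c \<in> tree_of V \<longleftrightarrow> c \<in> tree_of V'" if c: "c \<in> cayley_ball n k" for c
  proof -
    obtain w a where "w @ [a] \<in> carrier (free_group n)" "c = {w, w @ [a]}"
      using edge_cases[OF cayley_ball_subset c] .
    moreover from this have "length (w @ [a]) \<le> k"
      using c unfolding cayley_ball_eq by simp
    ultimately show ?thesis
      using assms[of "w @ [a]"] edge_in_tree_of by simp
  qed
  then show ?thesis unfolding agree_def by auto
qed

section \<open>Pointed subtrees are given by their vertex sets\<close>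

lemma pointed_prefix_closed:
  assumes "t \<in> pointed_subtrees n" "w @ [a] \<in> \<Union> t"
  shows "{w, w @ [a]} \<in> t" "w \<in> \<Union> t"
proof -
  show *: "{w, w @ [a]} \<in> t"
    using pointed_edge_prefix[OF assms(1,2), of "w @ [a]"] by simp
  show "w \<in> \<Union> t" using * by auto
qed

lemma pointed_eq_tree_of:
  assumes t: "t \<in> pointed_subtrees n"
  shows "t = tree_of (\<Union> t)"
proof (intro equalityI subsetI)
  fix c assume c: "c \<in> t"
  obtain w a where wa: "w @ [a] \<in> carrier (free_group n)" "c = {w, w @ [a]}"
    using edge_cases[OF pointed_subtrees_subset[OF t] c] .
  then have "w @ [a] \<in> \<Union> t" using c by blast
  then show "c \<in> tree_of (\<Union> t)" unfolding wa(2) edge_in_tree_of .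
next
  fix c assume "c \<in> tree_of (\<Union> t)"
  then obtain w a where "c = {w, w @ [a]}" "w @ [a] \<in> \<Union> t"
    unfolding tree_of_def by blast
  then show "c \<in> t" using pointed_prefix_closed(1)[OF t] by simp
qed

lemma pointed_root:
  assumes t: "t \<in> pointed_subtrees n"
  shows "\<exists>a b. a \<noteq> b \<and> [a] \<in> \<Union> t \<and> [b] \<in> \<Union> t"
proof -
  have form: "\<exists>a. c = {[], [a]}" if c: "c \<in> t" and nil: "[] \<in> c" for c
  proof -
    obtain w a where wa: "c = {w, w @ [a]}"
      using edge_cases[OF pointed_subtrees_subset[OF t] c] by metis
    then have "w = []" using nil by simp
    then show ?thesis using wa by blast
  qed
  obtain c where c: "c \<in> {c \<in> t. [] \<in> c}"
    using t unfolding pointed_subtrees_def by auto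
  have "card {c \<in> t. [] \<in> c} \<noteq> 1"
    using t unfolding pointed_subtrees_def by auto
  from ex_other_if_card_neq_1[OF this c] obtain c' where c': "c' \<in> t" "[] \<in> c'" "c' \<noteq> c"
    by auto
  obtain a b where ab: "c = {[], [a]}" "c' = {[], [b]}"
    using form[of c] form[of c'] c c' by auto
  then have "a \<noteq> b" using c'(3) by auto
  moreover have "[a] \<in> \<Union> t" by (rule UnionI[of c]) (use c ab in simp_all)
  moreover have "[b] \<in> \<Union> t" by (rule UnionI[of c']) (use c' ab in simp_all)
  ultimately show ?thesis by blast
qed

lemma pointed_extendable:
  assumes t: "t \<in> pointed_subtrees n" and w: "w \<in> \<Union> t"
  shows "\<exists>a. w @ [a] \<in> \<Union> t"
proof (cases w rule: rev_cases)
  case Nil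
  then show ?thesis using pointed_root[OF t] by auto
next
  case (snoc h x)
  have e: "{h, w} \<in> t" using pointed_prefix_closed(1)[OF t] w snoc by simp
  have "card {c \<in> t. w \<in> c} \<noteq> 1"
    using t w unfolding pointed_subtrees_def by blast
  then obtain c where c: "c \<in> t" "w \<in> c" "c \<noteq> {h, w}"
    using ex_other_if_card_neq_1[of "{c \<in> t. w \<in> c}" "{h, w}"] e by auto
  obtain v a where va: "c = {v, v @ [a]}"
    using edge_cases[OF pointed_subtrees_subset[OF t] c(1)] by metis
  then have "w = v" using c snoc by auto
  then have "w @ [a] \<in> \<Union> t" by (intro UnionI[of c]) (use va c in simp_all)
  then show ?thesis ..
qed

lemma pointed_vertex_tree:
  assumes t: "t \<in> pointed_subtrees n"
  shows "vertex_tree n (\<Union> t)"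
proof
  show "\<Union> t \<subseteq> carrier (free_group n)"
    using pointed_subtrees_subset[OF t] by (auto intro: cayley_edge_carrier)
qed (use pointed_root[OF t] pointed_extendable[OF t] pointed_prefix_closed(2)[OF t] in simp_all)

text \<open>Up to level \<open>k\<close> each tree is the whole Cayley graph; above level
  \<open>k\<close> each vertex of a chosen set may independently branch or continue as a ray. Words
  in two positive letters are automatically reduced, which yields \<open>2 ^ k\<close> such
  vertices.\<close>

lemma many_trees:
  assumes n: "2 \<le> n" and k: "1 \<le> k"
  shows "\<exists>A\<subseteq>tspace n. card A = 2 ^ (2 ^ k) \<and>
    (\<forall>t\<in>A. \<forall>t'\<in>A. agree n k t t' \<and> (t \<noteq> t' \<longrightarrow> \<not> agree n (Suc k) t t'))"
proof -
  let ?C = "carrier (free_group n)"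
  define P where "P = {w. set w \<subseteq> {(0::nat, True), (1, True)} \<and> length w = k}"
  have cP: "card P = 2 ^ k" and finP: "finite P"
    unfolding P_def by (simp_all add: card_lists_length_eq finite_lists_length_eq numeral_2_eq_2)
  have pos: "w \<in> ?C" if "set w \<subseteq> {(0, True), (1, True)}" for w
    using that
  proof (induction w)
    case (Cons a w)
    then have "a = (0, True) \<or> a = (1, True)" "w \<in> ?C" by auto
    moreover have "hd w \<noteq> flip a" if "w \<noteq> []"
    proof -
      have "hd w \<in> {(0, True), (1, True)}" using that Cons.prems by (cases w) auto
      then show ?thesis using \<open>a = _ \<or> _\<close> by (auto simp: flip_def)
    qed
    ultimately show ?case
      using n unfolding carrier_Cons_iff by auto
  qed simp
  define T where "T S = tree_of (sprout n ?C S k)" for S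
  have vt: "vertex_tree n (sprout n ?C S k)" for S
  proof (rule vertex_tree_sprout[OF subset_refl _ _ _ k])
    show "w \<in> ?C" if "w @ [a] \<in> ?C" for w a
      using that by (simp add: carrier_snoc_iff)
    show "\<exists>a. w @ [a] \<in> ?C" if w: "w \<in> ?C" for w
    proof (cases "w = []")
      case True
      then show ?thesis using pos[of "[(0, True)]"] by auto
    next
      case False
      have "w @ [last w] \<in> ?C"
        using w False carrier_letters[OF w] last_in_set[OF False] flip_neq[of "last w"]
        unfolding carrier_snoc_iff by (metis subsetD)
      then show ?thesis ..
    qed
    show "\<exists>a b. a \<noteq> b \<and> [a] \<in> ?C \<and> [b] \<in> ?C"
      using pos[of "[(0, True)]"] pos[of "[(1, True)]"]
      by (intro exI[of _ "(0, True)"] exI[of _ "(1, True)"]) simp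
  qed
  have TX: "T S \<in> tspace n" for S
    unfolding T_def by (intro pointed_in_tspace vertex_tree.tree_of_pointed vt)
  have same: "agree n k (T S) (T S')" for S S'
    unfolding T_def by (intro agree_tree_of) (simp add: sprout_short)
  have sep: "\<not> agree n (Suc k) (T S) (T S')" if p: "p \<in> S" "p \<notin> S'" "p \<in> P" for p S S'
  proof -
    have pk: "length p = k" "set p \<subseteq> {(0, True), (1, True)}" using p(3) by (auto simp: P_def)
    then have ne: "p \<noteq> []" using k by auto
    \<comment> \<open>A positive letter other than \<open>last p\<close>: it continues
      \<open>p\<close> where branching is allowed, but not along the ray.\<close>
    define b where "b = (if last p = (0, True) then (1, True) else (0 :: nat, True))"
    have b: "b \<in> {(0, True), (1, True)}" "b \<noteq> last p"
      by (auto simp: b_def)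
    have pb: "p @ [b] \<in> ?C" using pk b by (intro pos) auto
    then have pc: "p \<in> ?C" by (simp add: carrier_snoc_iff)
    have e: "{p, p @ [b]} \<in> cayley_ball n (Suc k)"
    proof -
      have "{p, p @ [b]} \<in> cayley_edges n" using pb unfolding cayley_edges_iff by blast
      then show ?thesis using pk by (simp add: cayley_ball_eq)
    qed
    have "p @ [b] \<in> sprout n ?C S k" "p @ [b] \<notin> sprout n ?C S' k"
      using p pb pc pk b unfolding sprout_def by auto
    then have "{p, p @ [b]} \<in> T S" "{p, p @ [b]} \<notin> T S'"
      unfolding T_def edge_in_tree_of by simp_all
    then show ?thesis using agree_mem[OF _ e] by blast
  qed
  have sep': "\<not> agree n (Suc k) (T S) (T S')" if S: "S \<subseteq> P" "S' \<subseteq> P" "S \<noteq> S'" for S S'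
  proof -
    obtain p where "p \<in> S \<and> p \<notin> S' \<or> p \<in> S' \<and> p \<notin> S" using S(3) by auto
    then show ?thesis
      using sep[of p S S'] sep[of p S' S] S agree_sym[of n "Suc k" "T S" "T S'"] by auto
  qed
  then have inj: "inj_on T (Pow P)"
    unfolding inj_on_def using agree_refl by (metis PowD)
  have "card (T ` Pow P) = 2 ^ (2 ^ k)"
    using card_image[OF inj] card_Pow[OF finP] cP by simp
  moreover have "\<forall>t\<in>T ` Pow P. \<forall>t'\<in>T ` Pow P. agree n k t t' \<and> (t \<noteq> t' \<longrightarrow> \<not> agree n (Suc k) t t')"
    using same sep' by auto
  moreover have "T ` Pow P \<subseteq> tspace n" using TX by auto
  ultimately show ?thesis by blast
qed

section \<open>A dense orbit\<close>

text \<open>At the vertex \<open>u\<close> on the boundary of the ball only the ray continues, so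
  the other directions away from the root are free for attaching a second tree.\<close>

lemma thin_tree:
  assumes t: "t \<in> pointed_subtrees n" and k: "1 \<le> k"
  obtains s u where "s \<in> pointed_subtrees n" "agree n k t s" "u \<in> \<Union> s" "length u = k"
    "\<And>a. {u, u @ [a]} \<in> s \<Longrightarrow> a = last u"
proof -
  interpret vertex_tree n "\<Union> t" by (rule pointed_vertex_tree[OF t])
  define V where "V = sprout n (\<Union> t) {} k"
  have V: "vertex_tree n V"
    unfolding V_def
    by (intro vertex_tree_sprout carrier k) (fact prefix_closed, fact extendable, fact root)
  have "\<exists>u\<in>\<Union> t. length u = j" for j
  proof (induction j)
    case 0
    then show ?case using Nil_mem by (intro bexI[of _ "[]"]) simp_all
  next
    case (Suc j)
    then obtain u where u: "u \<in> \<Union> t" "length u = j" by blast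
    obtain a where "u @ [a] \<in> \<Union> t" using extendable[OF u(1)] ..
    then show ?case using u(2) by (intro bexI[of _ "u @ [a]"]) simp_all
  qed
  from this[of k] obtain u where u: "u \<in> \<Union> t" "length u = k" by blast
  have "agree n k (tree_of (\<Union> t)) (tree_of V)"
    by (intro agree_tree_of) (simp add: V_def sprout_short del: Union_iff)
  then have "agree n k t (tree_of V)"
    using pointed_eq_tree_of[OF t] by simp
  moreover have "u \<in> V"
    unfolding V_def using u carrier by (simp add: sprout_short del: Union_iff) blast
  then have "u \<in> \<Union> (tree_of V)"
    unfolding vertex_tree.Union_tree_of[OF V] .
  moreover have "a = last u" if "{u, u @ [a]} \<in> tree_of V" for a
    using that u(2) unfolding edge_in_tree_of V_def sprout_def by simp
  ultimately show ?thesis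
    using u(2) by (intro that[OF vertex_tree.tree_of_pointed[OF V]])
qed

text \<open>Used to join two trees by a bridge of two edges, which leaves \<open>u\<close> by the
  letter \<open>x\<close> and reaches the copy of \<open>v\<close> from the direction
  \<open>flip y\<close>. With two letters these directions can be chosen independently.\<close>

lemma connector_mult:
  assumes g: "u @ [x, y] @ map flip (rev v) \<in> carrier (free_group n)"
    and v: "v \<in> carrier (free_group n)" "v @ [flip y] \<in> carrier (free_group n)"
  shows "foldr cancel_cons (u @ [x, y] @ map flip (rev v)) v = u @ [x, y]"
    and "foldr cancel_cons (u @ [x, y] @ map flip (rev v)) (v @ [flip y]) = u @ [x]"
proof -
  have uxy: "u @ [x, y] \<in> carrier (free_group n)" "u @ [x] \<in> carrier (free_group n)"
    using g by (auto simp: carrier_append_iff carrier_Cons_iff)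
  have "foldr cancel_cons (map flip (rev v)) v = []"
    using inverse_word_mult[OF v(1) Nil_in_carrier] foldr_cancel_cons_Nil[OF v(1)] by simp
  then have "foldr cancel_cons (u @ [x, y] @ map flip (rev v)) v = foldr cancel_cons (u @ [x, y]) []"
    by simp
  then show "foldr cancel_cons (u @ [x, y] @ map flip (rev v)) v = u @ [x, y]"
    unfolding foldr_cancel_cons_Nil[OF uxy(1)] .
  have "[flip y] \<in> carrier (free_group n)"
    using v(2) by (simp add: carrier_append_iff)
  then have "foldr cancel_cons (map flip (rev v)) (v @ [flip y]) = [flip y]"
    using inverse_word_mult[OF v(1), of "[flip y]"] mult_append[OF v(2)] by simp
  then have "foldr cancel_cons (u @ [x, y] @ map flip (rev v)) (v @ [flip y]) =
      foldr cancel_cons (u @ [x]) []"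
    by simp
  then show "foldr cancel_cons (u @ [x, y] @ map flip (rev v)) (v @ [flip y]) = u @ [x]"
    unfolding foldr_cancel_cons_Nil[OF uxy(2)] .
qed

text \<open>The edge from \<open>u @ [x, y]\<close> to its parent is the translate of an edge
  missing from \<open>t\<close>, so the connected translated tree cannot leave the branch above
  \<open>u @ [x, y]\<close>.\<close>

lemma translate_beyond:
  assumes t: "t \<in> pointed_subtrees n" and v: "v \<in> \<Union> t" "{v, v @ [flip y]} \<notin> t"
    and vy: "v @ [flip y] \<in> carrier (free_group n)"
    and g: "g = u @ [x, y] @ map flip (rev v)" "g \<in> carrier (free_group n)"
    and w: "w \<in> \<Union> (translate n g t)"
  shows "prefix (u @ [x, y]) w"
proof -
  have te: "t \<subseteq> cayley_edges n" by (rule pointed_subtrees_subset[OF t])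
  have vc: "v \<in> carrier (free_group n)" using v(1) te by (auto intro: cayley_edge_carrier)
  note gv = connector_mult[OF g(2)[unfolded g(1)] vc vy, folded g(1)]
  have img: "foldr cancel_cons g ` {v, v @ [flip y]} = {u @ [x], u @ [x, y]}"
    using gv by auto
  have "{v, v @ [flip y]} \<in> cayley_edges n"
    using vy unfolding cayley_edges_iff by blast
  then have "{u @ [x], u @ [x, y]} \<notin> translate n g t"
    using translate_mem_iff[OF flip_word_closed[OF g(2)] te, of "{u @ [x], u @ [x, y]}"]
      edge_mult_inverse(2)[OF g(2)] translate_edge[OF g(2)] img v(2)
    by (metis inverse_word_inverse)
  then have "{butlast (u @ [x, y]), u @ [x, y]} \<notin> translate n g t"
    by (simp add: butlast_append)
  moreover have "u @ [x, y] \<in> \<Union> (translate n g t)"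
    unfolding Union_translate using v(1) gv(1) by (metis imageI)
  moreover have "connected_subgraph (translate n g t)"
    using t by (intro connected_subgraph_translate) (simp add: pointed_subtrees_def)
  ultimately show ?thesis
    using connected_subgraph_prefix[OF translate_subset[OF g(2) te]] w by blast
qed

lemma cayley_edge_nonempty: "c \<in> cayley_edges n \<Longrightarrow> c \<noteq> {}"
  unfolding cayley_edges_iff by blast

lemma agree_union_far:
  assumes "\<And>c. \<lbrakk>c \<in> s; c \<in> cayley_ball n k\<rbrakk> \<Longrightarrow> c \<in> t"
  shows "agree n k t (t \<union> s)"
  unfolding agree_def using assms by auto

lemma not_in_cayley_ball: "\<lbrakk>w \<in> c; k < length w\<rbrakk> \<Longrightarrow> c \<notin> cayley_ball n k"
  unfolding cayley_ball_eq using leD by auto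

lemma adjacency_mono: "s \<subseteq> t \<Longrightarrow> adjacency s \<subseteq> adjacency t"
  unfolding adjacency_def by auto

lemma degree_mono:
  assumes "card {c \<in> s. w \<in> c} \<noteq> 1" "s \<subseteq> t" "w \<in> \<Union> s"
  shows "card {c \<in> t. w \<in> c} \<noteq> 1"
proof -
  obtain c where c: "c \<in> {c \<in> s. w \<in> c}" using assms(3) by auto
  from ex_other_if_card_neq_1[OF assms(1) c] obtain c' where "c' \<in> s" "w \<in> c'" "c' \<noteq> c"
    by auto
  then show ?thesis
    using c assms(2) by (intro card_neq_1I[of c _ c']) auto
qed

text \<open>Both trees are first thinned beyond the balls that matter, which makes room for the
  bridge. In the union, the view from the root up to level \<open>k\<close> is that of
  \<open>t1\<close>, and the view from \<open>g\<close> up to level \<open>m\<close> is that of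
  \<open>t2\<close>.\<close>

lemma glue_trees:
  assumes n: "2 \<le> n" and t: "t1 \<in> pointed_subtrees n" "t2 \<in> pointed_subtrees n"
    and k: "1 \<le> k" "1 \<le> m"
  shows "\<exists>s\<in>pointed_subtrees n. agree n k t1 s \<and> (\<exists>g\<in>\<Union> s. agree n m (pull n g s) t2)"
proof -
  obtain s1 u where s1: "s1 \<in> pointed_subtrees n" "agree n k t1 s1" "u \<in> \<Union> s1" "length u = k"
    "\<And>a. {u, u @ [a]} \<in> s1 \<Longrightarrow> a = last u"
    using thin_tree[OF t(1) k(1)] by metis
  obtain s2 v where s2: "s2 \<in> pointed_subtrees n" "agree n m t2 s2" "v \<in> \<Union> s2" "length v = m"
    "\<And>a. {v, v @ [a]} \<in> s2 \<Longrightarrow> a = last v"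
    using thin_tree[OF t(2) k(2)] by metis
  have se: "s1 \<subseteq> cayley_edges n" "s2 \<subseteq> cayley_edges n"
    using s1(1) s2(1) by (simp_all add: pointed_subtrees_subset)
  have ne: "u \<noteq> []" "v \<noteq> []" using s1(4) s2(4) k by auto
  have uc: "u \<in> carrier (free_group n)" and vc: "v \<in> carrier (free_group n)"
    using s1(3) s2(3) se by (auto intro: cayley_edge_carrier)
  \<comment> \<open>A generator whose index differs from that of \<open>last u\<close> can neither
    cancel with it nor point along the ray. Taking \<open>x\<close> and \<open>y\<close> both
    positive also excludes \<open>y = flip x\<close>.\<close>
  define x :: "nat \<times> bool" where "x = (if fst (last u) = 0 then 1 else 0, True)"
  define y :: "nat \<times> bool" where "y = (if fst (last v) = 0 then 1 else 0, True)"
  have xy: "x \<in> letters n" "y \<in> letters n" "y \<noteq> flip x" "x \<noteq> last u" "x \<noteq> flip (last u)"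
    "flip y \<noteq> last v" "flip y \<noteq> flip (last v)"
    using n unfolding x_def y_def by (auto simp: flip_def prod_eq_iff)
  define g where "g = u @ [x, y] @ map flip (rev v)"
  have ivc: "map flip (rev v) \<in> carrier (free_group n)" by (rule flip_word_closed[OF vc])
  have vy: "v @ [flip y] \<in> carrier (free_group n)" and ux: "u @ [x] \<in> carrier (free_group n)"
    using xy uc vc unfolding carrier_snoc_iff by simp_all
  have hdv: "hd (map flip (rev v)) = flip (last v)"
    using ne by (simp add: hd_map hd_rev)
  have gc: "g \<in> carrier (free_group n)"
    unfolding g_def carrier_append_iff
    using uc ivc xy ne hdv by (auto simp: carrier_append_iff carrier_Cons_iff)
  have ig: "map flip (rev g) = v @ [flip y, flip x] @ map flip (rev u)"
    by (simp add: g_def rev_map comp_def)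
  have igc: "map flip (rev g) \<in> carrier (free_group n)" by (rule flip_word_closed[OF gc])
  note gv = connector_mult[OF gc[unfolded g_def] vc vy, folded g_def]
  have "u @ [flip (flip x)] \<in> carrier (free_group n)" using ux by simp
  note gu = connector_mult[OF igc[unfolded ig] uc this, folded ig]
  have far2: "prefix (u @ [x, y]) w" if "w \<in> \<Union> (translate n g s2)" for w
    using s2(5)[of "flip y"] xy that by (intro translate_beyond[OF s2(1,3) _ vy g_def gc]) auto
  \<comment> \<open>The inverse of the connecting word has the same form with \<open>u\<close> and
    \<open>v\<close> exchanged; so, seen from \<open>g\<close>, the tree \<open>s1\<close> lies
    beyond the bridge.\<close>
  have far1: "prefix (v @ [flip y, flip x]) w" if "w \<in> \<Union> (pull n g s1)" for w
    using s1(5)[of x] xy that ux by (intro translate_beyond[OF s1(1,3) _ _ ig igc]) auto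
  define e1 e2 where "e1 = {u, u @ [x]}" and "e2 = {u @ [x], u @ [x, y]}"
  define s where "s = s1 \<union> ({e1, e2} \<union> translate n g s2)"
  have uxy: "u @ [x, y] \<in> carrier (free_group n)"
    using gc by (auto simp: g_def carrier_append_iff carrier_Cons_iff)
  have ee: "e1 \<in> cayley_edges n" "e2 \<in> cayley_edges n"
  proof -
    show "e1 \<in> cayley_edges n" using ux unfolding e1_def cayley_edges_iff by blast
    have "(u @ [x]) @ [y] \<in> carrier (free_group n)" "e2 = {u @ [x], (u @ [x]) @ [y]}"
      using uxy by (simp_all add: e2_def)
    then show "e2 \<in> cayley_edges n" unfolding cayley_edges_iff by blast
  qed
  have sub: "s \<subseteq> cayley_edges n"
    unfolding s_def using se ee translate_subset[OF gc se(2)] by simp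
  have uxy2: "u @ [x, y] \<in> \<Union> (translate n g s2)"
    unfolding Union_translate using s2(3) gv(1) by (metis imageI)
  have conn: "connected_subgraph s"
  proof (rule connected_subgraphI[of _ u])
    have m1: "(adjacency s1)\<^sup>* \<subseteq> (adjacency s)\<^sup>*" "(adjacency (translate n g s2))\<^sup>* \<subseteq> (adjacency s)\<^sup>*"
      unfolding s_def by (intro rtrancl_mono adjacency_mono; auto)+
    have "(u, u @ [x]) \<in> adjacency s" "(u @ [x], u @ [x, y]) \<in> adjacency s"
      unfolding s_def adjacency_def e1_def e2_def by auto
    then have r: "(u, u @ [x]) \<in> (adjacency s)\<^sup>*" "(u, u @ [x, y]) \<in> (adjacency s)\<^sup>*"
      by auto
    fix w assume "w \<in> \<Union> s"
    then consider "w \<in> \<Union> s1" | "w \<in> {u, u @ [x], u @ [x, y]}" | "w \<in> \<Union> (translate n g s2)"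
      unfolding s_def e1_def e2_def by auto
    then show "(u, w) \<in> (adjacency s)\<^sup>*"
    proof cases
      case 1
      then have "(u, w) \<in> (adjacency s1)\<^sup>*"
        using s1(1,3) unfolding pointed_subtrees_def connected_subgraph_def by auto
      then show ?thesis using m1 by auto
    next
      case 2
      then show ?thesis using r by auto
    next
      case 3
      have "connected_subgraph (translate n g s2)"
        using s2(1) by (intro connected_subgraph_translate) (simp add: pointed_subtrees_def)
      then have "(u @ [x, y], w) \<in> (adjacency (translate n g s2))\<^sup>*"
        using uxy2 3 unfolding connected_subgraph_def by blast
      then show ?thesis using m1 r(2) by (meson rtrancl_trans subsetD)
    qed
  qed
  have deg: "card {c \<in> s. w \<in> c} \<noteq> 1" if "w \<in> \<Union> s" for w
  proof -
    consider "w \<in> \<Union> s1" | "w = u @ [x]" | "w \<in> \<Union> (translate n g s2)"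
      using \<open>w \<in> \<Union> s\<close> s1(3) uxy2 unfolding s_def e1_def e2_def by auto
    then show ?thesis
    proof cases
      case 1
      then have "card {c \<in> s1. w \<in> c} \<noteq> 1"
        using s1(1) unfolding pointed_subtrees_def by blast
      then show ?thesis
        by (rule degree_mono[OF _ _ 1]) (auto simp: s_def)
    next
      \<comment> \<open>The middle vertex of the bridge gets its two edges from the bridge
        itself.\<close>
      case 2
      have "e1 \<noteq> e2" unfolding e1_def e2_def by (auto simp: doubleton_eq_iff)
      then show ?thesis
        using 2 by (intro card_neq_1I[of e1 _ e2]) (auto simp: s_def e1_def e2_def)
    next
      case 3
      have "\<forall>h\<in>\<Union> s2. card {c \<in> s2. h \<in> c} \<noteq> 1"
        using s2(1) unfolding pointed_subtrees_def by blast
      then have "card {c \<in> translate n g s2. w \<in> c} \<noteq> 1"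
        using translate_no_dead_ends[OF gc se(2)] 3 by blast
      then show ?thesis
        by (rule degree_mono[OF _ _ 3]) (auto simp: s_def)
    qed
  qed
  have "[] \<in> \<Union> s1" "infinite s1"
    using s1(1) by (simp_all add: pointed_subtrees_def)
  then have "[] \<in> \<Union> s" "infinite s"
    unfolding s_def by auto
  then have sp: "s \<in> pointed_subtrees n"
    using sub conn deg unfolding pointed_subtrees_def mem_Collect_eq free_group_simps by blast
  have far: "c \<notin> cayley_ball n k" if "c \<in> {e1, e2} \<union> translate n g s2" for c
  proof -
    have "c \<in> cayley_edges n" using that sub unfolding s_def by blast
    then have cne: "c \<noteq> {}" by (rule cayley_edge_nonempty)
    have "\<exists>w\<in>c. k < length w"
    proof (cases "c \<in> translate n g s2")
      case True
      obtain w where "w \<in> c" using cne by blast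
      moreover from this have "prefix (u @ [x, y]) w" using True by (intro far2) blast
      then have "k < length w" using prefix_length_le s1(4) by fastforce
      ultimately show ?thesis by blast
    next
      case False
      then show ?thesis using that s1(4) unfolding e1_def e2_def by auto
    qed
    then show ?thesis using not_in_cayley_ball by blast
  qed
  have "agree n k s1 s"
    unfolding s_def by (rule agree_union_far) (use far in blast)
  then have a1: "agree n k t1 s" using agree_trans[OF s1(2)] by blast
  have gs: "g \<in> \<Union> s"
  proof -
    have "[] \<in> \<Union> s2" using s2(1) by (simp add: pointed_subtrees_def)
    then have "foldr cancel_cons g [] \<in> \<Union> (translate n g s2)"
      unfolding Union_translate by (rule imageI)
    then show ?thesis
      using foldr_cancel_cons_Nil[OF gc] unfolding s_def by auto
  qed
  have ps: "pull n g s = s2 \<union> (pull n g s1 \<union> pull n g {e1, e2})"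
  proof -
    have "pull n g s = pull n g s1 \<union> pull n g {e1, e2} \<union> pull n g (translate n g s2)"
      unfolding s_def translate_eq by (simp add: image_Un Un_assoc)
    then show ?thesis using translate_cancel(2)[OF gc se(2)] by auto
  qed
  have far': "c \<notin> cayley_ball n m" if c: "c \<in> pull n g s1 \<union> pull n g {e1, e2}" for c
  proof -
    have "c \<in> cayley_edges n"
      using c translate_subset[OF igc, of s1] se translate_subset[OF igc, of "{e1, e2}"] ee by blast
    then have cne: "c \<noteq> {}" by (rule cayley_edge_nonempty)
    have "\<exists>w\<in>c. m < length w"
    proof (cases "c \<in> pull n g s1")
      case True
      obtain w where "w \<in> c" using cne by blast
      moreover from this have "prefix (v @ [flip y, flip x]) w" using True by (intro far1) blast
      then have "m < length w" using prefix_length_le s2(4) by fastforce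
      ultimately show ?thesis by blast
    next
      case False
      then have "c = foldr cancel_cons (map flip (rev g)) ` e1 \<or> c = foldr cancel_cons (map flip (rev g)) ` e2"
        using c unfolding translate_eq by auto
      moreover have "foldr cancel_cons (map flip (rev g)) (u @ [x]) = v @ [flip y]"
        using gu(2) by simp
      ultimately have "v @ [flip y] \<in> c"
        unfolding e1_def e2_def by (metis image_eqI insertCI)
      then show ?thesis using s2(4) by (intro bexI[of _ "v @ [flip y]"]) simp_all
    qed
    then show ?thesis using not_in_cayley_ball by blast
  qed
  have "agree n m s2 (pull n g s)"
    unfolding ps by (rule agree_union_far) (use far' in blast)
  then have "agree n m (pull n g s) t2"
    using agree_trans[OF s2(2)] agree_sym by blast
  then show ?thesis using sp a1 gs by blast
qed

text \<open>There are only countably many finite patterns. Each stage places the next one beyond the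
  part of the tree that is already final, and the limit tree contains them all.\<close>

lemma dense_orbit:
  assumes n: "2 \<le> n"
  shows "\<exists>s\<in>tspace n. \<forall>t\<in>tspace n. \<forall>m. \<exists>g\<in>\<Union> s. agree n m (pull n g s) t"
proof -
  define Pat where "Pat = {(m, cayley_ball n m \<inter> t) | m t. t \<in> pointed_subtrees n \<and> 1 \<le> m}"
  have "Pat \<subseteq> (SIGMA m:UNIV. Pow (cayley_ball n m))" unfolding Pat_def by auto
  moreover have "countable (SIGMA m:UNIV. Pow (cayley_ball n m))"
    by (rule countable_SIGMA) (simp_all add: countable_finite finite_cayley_ball)
  ultimately have cnt: "countable Pat" by (rule countable_subset)
  \<comment> \<open>The counted family serves here only to show that the space, and with it
    \<open>Pat\<close>, is not empty.\<close>
  obtain A where "A \<subseteq> tspace n" "card A = 2 ^ (2 ^ 1)"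
    using many_trees[OF n order_refl] by blast
  then have "tspace n \<noteq> {}"
    by (metis card.empty power_not_zero subset_empty zero_neq_numeral)
  then obtain t where "t \<in> tspace n" by blast
  then obtain p where p: "p \<in> pointed_subtrees n" unfolding tspace_iff by blast
  then have ne: "Pat \<noteq> {}" unfolding Pat_def by blast
  define e where "e = from_nat_into Pat"
  have e: "range e = Pat" unfolding e_def using ne cnt by (rule range_from_nat_into)
  \<comment> \<open>A stage is a tree paired with the depth up to which it is final.\<close>
  define P where "P j tk \<longleftrightarrow> fst tk \<in> pointed_subtrees n \<and> j \<le> snd tk \<and> 1 \<le> snd tk"
    for j and tk :: "subgraph \<times> nat"
  \<comment> \<open>The new final depth exceeds \<open>fst (e j) + length g\<close>, so that the
    pattern seen from \<open>g\<close> survives all later stages.\<close>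
  define Q where "Q j tk tk' \<longleftrightarrow> agree n (snd tk) (fst tk) (fst tk') \<and> snd tk \<le> snd tk' \<and>
      (\<exists>g\<in>\<Union> (fst tk'). fst (e j) + length g < snd tk' \<and>
         cayley_ball n (fst (e j)) \<inter> pull n g (fst tk') = snd (e j))"
    for j and tk tk' :: "subgraph \<times> nat"
  have "\<exists>x. P 0 x" using p unfolding P_def by (intro exI[of _ "(p, 1)"]) simp
  moreover have "\<exists>y. P (Suc j) y \<and> Q j x y" if P: "P j x" for x j
  proof -
    have "e j \<in> Pat" using e by blast
    then obtain m t where mt: "e j = (m, cayley_ball n m \<inter> t)" "t \<in> pointed_subtrees n" "1 \<le> m"
      unfolding Pat_def by blast
    obtain s g where s: "s \<in> pointed_subtrees n" "agree n (snd x) (fst x) s" "g \<in> \<Union> s"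
      "agree n m (pull n g s) t"
      using glue_trees[OF n _ mt(2) _ mt(3), of "fst x" "snd x"] P unfolding P_def by blast
    let ?y = "(s, Suc (j + snd x + m + length g))"
    have "P (Suc j) ?y" unfolding P_def using s(1) by simp
    moreover have "Q j x ?y"
      unfolding Q_def using s mt(1) by (auto simp: agree_def intro!: bexI[of _ g])
    ultimately show ?thesis by blast
  qed
  ultimately have "\<exists>f. \<forall>j. P j (f j) \<and> Q j (f j) (f (Suc j))"
    by (rule dependent_nat_choice)
  then obtain f where f: "\<And>j. P j (f j)" "\<And>j. Q j (f j) (f (Suc j))" by blast
  have "\<exists>s\<in>tspace n. \<forall>j. agree n (snd (f j)) (fst (f j)) s"
    using f unfolding P_def Q_def by (intro tspace_limit) (auto intro: pointed_in_tspace)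
  then obtain s where s: "s \<in> tspace n" "\<And>j. agree n (snd (f j)) (fst (f j)) s" by blast
  have "\<forall>t\<in>tspace n. \<forall>m. \<exists>g\<in>\<Union> s. agree n m (pull n g s) t"
  proof (intro ballI allI)
    fix t m assume t: "t \<in> tspace n"
    show "\<exists>g\<in>\<Union> s. agree n m (pull n g s) t"
  proof -
    obtain t' where t': "t' \<in> pointed_subtrees n" "agree n (Suc m) t t'"
      using t unfolding tspace_iff by blast
    \<comment> \<open>Patterns have positive radius, because gluing needs a nontrivial ball to thin
      out; \<open>Suc m\<close> covers the case \<open>m = 0\<close>.\<close>
    have "(Suc m, cayley_ball n (Suc m) \<inter> t') \<in> Pat" unfolding Pat_def using t'(1) by auto
    then obtain j where j: "e j = (Suc m, cayley_ball n (Suc m) \<inter> t')" using e by (metis imageE)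
    let ?t = "fst (f (Suc j))" and ?k = "snd (f (Suc j))"
    obtain g where g: "g \<in> \<Union> ?t" "Suc m + length g < ?k" "agree n (Suc m) (pull n g ?t) t'"
      using f(2)[of j] j unfolding Q_def agree_def by auto
    have te: "?t \<subseteq> cayley_edges n"
      using f(1)[of "Suc j"] pointed_subtrees_subset unfolding P_def by blast
    have gs: "g \<in> \<Union> s"
      by (rule agree_vertex[OF te s(2)]) (use g in simp_all)
    have "agree n (m + length g) ?t s"
      using s(2)[of "Suc j"] by (rule agree_mono) (use g in simp)
    then have "agree n m (pull n g ?t) (pull n g s)"
      using tspace_vertex_carrier[OF s(1) gs] te tspace_subset[OF s(1)] by (intro agree_pull)
    moreover have "agree n m (pull n g ?t) t"
      using agree_trans[OF g(3) agree_sym[OF t'(2)]] by (rule agree_mono) simp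
    ultimately have "agree n m (pull n g s) t"
      using agree_trans agree_sym by blast
    then show ?thesis using gs by blast
  qed
  qed
  then show ?thesis using s(1) by (rule rev_bexI[rotated])
qed

section \<open>Pseudogroups\<close>

text \<open>A purely relational form, in which stability under converse and composition becomes a
  calculation with images.\<close>

lemma partial_homeo_iff:
  "partial_homeo T r \<longleftrightarrow> single_valued r \<and> single_valued (r\<inverse>) \<and> r \<subseteq> topspace T \<times> topspace T \<and>
     (\<forall>U. openin T U \<longrightarrow> openin T (r `` U)) \<and> (\<forall>U. openin T U \<longrightarrow> openin T (r\<inverse> `` U))"
  (is "?L \<longleftrightarrow> ?R")
proof
  assume ?L
  then obtain W W' f where W: "openin T W" "openin T W'" "r = graph_on W f"
    and hom: "homeomorphic_map (subtopology T W) (subtopology T W') f"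
    unfolding partial_homeo_def by blast
  have top: "topspace (subtopology T W) = W" "topspace (subtopology T W') = W'"
    using W(1,2) openin_subset by (auto simp: topspace_subtopology)
  have f: "f ` W = W'" "inj_on f W"
    using homeomorphic_imp_surjective_map[OF hom] homeomorphic_imp_injective_map[OF hom]
    unfolding top by auto
  have mem: "(u, v) \<in> r \<longleftrightarrow> u \<in> W \<and> v = f u" for u v
    unfolding W(3) graph_on_def by auto
  have "openin T (r `` U)" if U: "openin T U" for U
  proof -
    have "openin (subtopology T W) (U \<inter> W)"
      using U W(1) by (simp add: openin_open_subtopology openin_Int)
    then have "openin (subtopology T W') (f ` (U \<inter> W))"
      using homeomorphic_imp_open_map[OF hom] unfolding open_map_def by blast
    moreover have "r `` U = f ` (U \<inter> W)" by (auto simp: mem)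
    ultimately show ?thesis using W(2) by (simp add: openin_open_subtopology)
  qed
  moreover have "openin T (r\<inverse> `` U)" if U: "openin T U" for U
  proof -
    have "openin (subtopology T W') (U \<inter> W')"
      using U W(2) by (simp add: openin_open_subtopology openin_Int)
    then have "openin (subtopology T W) {x \<in> W. f x \<in> U \<inter> W'}"
      using openin_continuous_map_preimage[OF homeomorphic_imp_continuous_map[OF hom]]
      unfolding top by blast
    moreover have "r\<inverse> `` U = {x \<in> W. f x \<in> U \<inter> W'}" using f(1) by (auto simp: mem)
    ultimately show ?thesis using W(1) by (simp add: openin_open_subtopology)
  qed
  moreover have "single_valued r" "single_valued (r\<inverse>)"
    using f(2) by (auto simp: single_valued_def mem dest: inj_onD)
  moreover have "r \<subseteq> topspace T \<times> topspace T"
    using f(1) openin_subset[OF W(1)] openin_subset[OF W(2)] by (auto simp: mem)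
  ultimately show ?R by blast
next
  assume R: ?R
  define W W' f where "W = r\<inverse> `` topspace T" and "W' = r `` topspace T"
    and "f u = (THE v. (u, v) \<in> r)" for u
  have W: "openin T W" "openin T W'" using R unfolding W_def W'_def by auto
  have top: "topspace (subtopology T W) = W" "topspace (subtopology T W') = W'"
    using W openin_subset by (auto simp: topspace_subtopology)
  have f: "f u = v" if "(u, v) \<in> r" for u v
    unfolding f_def using that R by (intro the_equality) (auto dest: single_valuedD)
  have sub: "r \<subseteq> topspace T \<times> topspace T" using R by blast
  have mem: "(u, v) \<in> r \<longleftrightarrow> u \<in> W \<and> v = f u" for u v
  proof
    show "u \<in> W \<and> v = f u" if "(u, v) \<in> r"
      using that sub f[OF that] unfolding W_def by auto
    assume "u \<in> W \<and> v = f u"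
    then obtain v' where "(u, v') \<in> r" "v = f u" unfolding W_def by auto
    then show "(u, v) \<in> r" using f by simp
  qed
  have img: "r `` U = f ` U" if "U \<subseteq> W" for U
    using that mem by (auto simp: Image_iff image_iff)
  have fW: "f ` W = W'" unfolding W'_def using openin_subset[OF W(1)] by (auto simp: Image_iff image_iff mem)
  have "homeomorphic_map (subtopology T W) (subtopology T W') f"
  proof (rule bijective_open_imp_homeomorphic_map)
    show "continuous_map (subtopology T W) (subtopology T W') f"
      unfolding continuous_map_def top
    proof (intro conjI allI impI)
      show "f \<in> W \<rightarrow> W'" using fW by auto
      fix U assume "openin (subtopology T W') U"
      then have "openin T U" using W(2) by (simp add: openin_open_subtopology)
      then have "openin T (r\<inverse> `` U)" using R by blast
      moreover have "r\<inverse> `` U = {x \<in> W. f x \<in> U}" by (auto simp: mem)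
      ultimately show "openin (subtopology T W) {x \<in> W. f x \<in> U}"
        using W(1) by (auto simp: openin_open_subtopology)
    qed
    show "open_map (subtopology T W) (subtopology T W') f"
      unfolding open_map_def
    proof (intro allI impI)
      fix U assume "openin (subtopology T W) U"
      then have U: "openin T U" "U \<subseteq> W" using W(1) by (auto simp: openin_open_subtopology)
      then have "openin T (r `` U)" using R by blast
      moreover have "r `` U = f ` U" using img[OF U(2)] .
      ultimately show "openin (subtopology T W') (f ` U)"
        using W(2) fW U(2) by (auto simp: openin_open_subtopology)
    qed
    show "f ` topspace (subtopology T W) = topspace (subtopology T W')"
      unfolding top by (rule fW)
    show "inj_on f (topspace (subtopology T W))"
      using R mem unfolding top single_valued_def inj_on_def by (metis converseI)
  qed
  moreover have "r = graph_on W f" unfolding graph_on_def by (auto simp: mem)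
  ultimately show ?L unfolding partial_homeo_def using W by blast
qed

lemma partial_homeo_Id_on: "openin T U \<Longrightarrow> partial_homeo T (Id_on U)"
  unfolding partial_homeo_iff
proof (intro conjI allI impI)
  have "Id_on U `` V = U \<inter> V" "(Id_on U)\<inverse> `` V = U \<inter> V" for V :: "'a set" by auto
  then show "openin T U \<Longrightarrow> openin T V \<Longrightarrow> openin T (Id_on U `` V)"
    "openin T U \<Longrightarrow> openin T V \<Longrightarrow> openin T ((Id_on U)\<inverse> `` V)" for V
    by (simp_all add: openin_Int)
qed (auto simp: single_valued_def dest: openin_subset)

lemma partial_homeo_converse: "partial_homeo T r \<Longrightarrow> partial_homeo T (r\<inverse>)"
  unfolding partial_homeo_iff by auto

lemma partial_homeo_relcomp:
  "\<lbrakk>partial_homeo T r; partial_homeo T s\<rbrakk> \<Longrightarrow> partial_homeo T (r O s)"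
  unfolding partial_homeo_iff converse_relcomp relcomp_Image
  by (auto simp: single_valued_relcomp)

text \<open>The partial homeomorphisms satisfying \<open>P\<close> form a pseudogroup that contains
  the generators, and the generated pseudogroup is the smallest such one.\<close>

lemma generated_pseudogroup_induct:
  assumes r: "r \<in> generated_pseudogroup T \<Gamma>"
    and gen: "\<And>r. r \<in> \<Gamma> \<Longrightarrow> partial_homeo T r \<and> P r"
    and ident: "P (Id_on (topspace T))"
    and conv: "\<And>r. \<lbrakk>partial_homeo T r; P r\<rbrakk> \<Longrightarrow> P (r\<inverse>)"
    and comp: "\<And>r s. \<lbrakk>partial_homeo T r; partial_homeo T s; P r; P s\<rbrakk> \<Longrightarrow> P (r O s)"
    and restr: "\<And>r U. \<lbrakk>partial_homeo T r; openin T U; P r\<rbrakk> \<Longrightarrow> P (Id_on U O r)"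
    and local: "\<And>r. \<lbrakk>partial_homeo T r;
        \<And>u. u \<in> Domain r \<Longrightarrow> \<exists>U. openin T U \<and> u \<in> U \<and> P (Id_on U O r)\<rbrakk> \<Longrightarrow> P r"
  shows "P r"
proof -
  have "pseudogroup T {r. partial_homeo T r \<and> P r}"
    unfolding pseudogroup_def
  proof (intro conjI ballI allI impI)
    fix r assume r: "partial_homeo T r \<and>
      (\<forall>u\<in>Domain r. \<exists>U. openin T U \<and> u \<in> U \<and> Id_on U O r \<in> {r. partial_homeo T r \<and> P r})"
    then have "P r" by (intro local) auto
    then show "r \<in> {r. partial_homeo T r \<and> P r}" using r by simp
  qed (auto intro: partial_homeo_Id_on partial_homeo_converse partial_homeo_relcomp ident conv comp restr)
  moreover have "\<Gamma> \<subseteq> {r. partial_homeo T r \<and> P r}" using gen by auto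
  ultimately have "generated_pseudogroup T \<Gamma> \<subseteq> {r. partial_homeo T r \<and> P r}"
    unfolding generated_pseudogroup_def by (intro Inter_lower) simp
  then show ?thesis using r by auto
qed

lemma generator_in_generated_pseudogroup: "r \<in> \<Gamma> \<Longrightarrow> r \<in> generated_pseudogroup T \<Gamma>"
  unfolding generated_pseudogroup_def by auto

lemma translation_pseudogroup_eq:
  "translation_pseudogroup n =
     generated_pseudogroup (subtree_space n) ((\<lambda>a. translation n [a]) ` letters n)"
  unfolding translation_pseudogroup_def translation_generators ..

text \<open>Every translation is a composition of translations by letters.\<close>

lemma orbit_induct:
  assumes step: "\<And>t a. \<lbrakk>t \<in> tspace n; a \<in> letters n; [a] \<in> \<Union> t\<rbrakk> \<Longrightarrow> R t (pull n [a] t)"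
    and refl: "\<And>t. t \<in> tspace n \<Longrightarrow> R t t"
    and trans: "\<And>t t' t''. \<lbrakk>R t t'; R t' t''\<rbrakk> \<Longrightarrow> R t t''"
    and t: "t \<in> tspace n" and g: "g \<in> \<Union> t"
  shows "R t (pull n g t)"
  using t g
proof (induction g arbitrary: t)
  case Nil
  have "foldr cancel_cons [] = (\<lambda>w. w)" by auto
  then have "pull n [] t = t" by (simp add: translate_eq)
  then show ?case using refl[OF Nil.prems(1)] by simp
next
  case (Cons a g)
  have "a # g \<in> carrier (free_group n)"
    using tspace_vertex_carrier[OF Cons.prems] .
  then have 1: "pull n (a # g) t = pull n g (pull n [a] t)" "a \<in> letters n"
    using pull_Cons tspace_subset[OF Cons.prems(1)] by (auto simp: carrier_Cons_iff)
  have a: "[a] \<in> \<Union> t" using tspace_letter[OF Cons.prems] .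
  have "R (pull n [a] t) (pull n g (pull n [a] t))"
    by (rule Cons.IH[OF pull_tspace[OF Cons.prems(1) a] mem_pull_Cons[OF Cons.prems(2)]])
  then show ?case
    using trans[OF step[OF Cons.prems(1) 1(2) a]] 1(1) by simp
qed

section \<open>Leaves of foliated spaces\<close>

lemma complete_transversal_continuous:
  assumes "complete_transversal M X chart T \<tau>"
  shows "continuous_map T M \<tau>"
proof -
  have "homeomorphic_map T (subtopology M (\<tau> ` topspace T)) \<tau>"
    using assms unfolding complete_transversal_def embedding_map_def by (rule conjunct1)
  then show ?thesis
    by (rule continuous_map_into_fulltopology[OF homeomorphic_imp_continuous_map])
qed

context foliated_space
begin

abbreviation "unit_box \<equiv> box (- One) One :: 'e set"
abbreviation "big_box \<equiv> box (- (2 *\<^sub>R One)) (2 *\<^sub>R One) :: 'e set"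

lemma cbox_subset_big_box: "cbox (- One) One \<subseteq> big_box"
  by (auto simp: mem_box algebra_simps) force+

lemma ext_subset: "x \<in> topspace M \<Longrightarrow> chart_ext (chart x) \<subseteq> topspace M"
  using ext_open openin_subset by blast

lemma trans_subset: "x \<in> topspace M \<Longrightarrow> chart_trans (chart x) \<subseteq> mspace X"
  using trans_compact compactin_subset_topspace by fastforce

lemma chart_map_ext: "x \<in> topspace M \<Longrightarrow>
    chart_map (chart x) ` chart_ext (chart x) = big_box \<times> chart_trans (chart x)"
  using homeomorphic_imp_surjective_map[OF homeo_ext] ext_subset trans_subset
  by (simp add: Int_absorb1 Int_absorb2)

lemma chart_map_core: "x \<in> topspace M \<Longrightarrow>
    chart_map (chart x) ` (M closure_of chart_core (chart x)) = cbox (- One) One \<times> chart_trans (chart x)"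
  using homeomorphic_imp_surjective_map[OF homeo_core] closure_of_subset_topspace[of M] trans_subset
  by (simp add: Int_absorb1 Int_absorb2)

lemma inj_on_chart_map: "x \<in> topspace M \<Longrightarrow> inj_on (chart_map (chart x)) (chart_ext (chart x))"
  using homeomorphic_imp_injective_map[OF homeo_ext] ext_subset by (simp add: Int_absorb1)

text \<open>Both coordinate rectangles are full images under the same \<open>chart_map\<close>,
  which is injective on the larger set; so the coordinate decides. Plaques can then be treated
  inside the open set \<open>chart_ext\<close>.\<close>

lemma closure_core_iff:
  assumes x: "x \<in> topspace M" and z: "z \<in> chart_ext (chart x)"
  shows "z \<in> M closure_of chart_core (chart x) \<longleftrightarrow> fst (chart_map (chart x) z) \<in> cbox (- One) One"
proof
  assume "z \<in> M closure_of chart_core (chart x)"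
  then show "fst (chart_map (chart x) z) \<in> cbox (- One) One"
    using chart_map_core[OF x] by (metis imageI mem_Times_iff)
next
  assume "fst (chart_map (chart x) z) \<in> cbox (- One) One"
  moreover have "snd (chart_map (chart x) z) \<in> chart_trans (chart x)"
    using chart_map_ext[OF x] z by (metis imageI mem_Times_iff)
  ultimately have "chart_map (chart x) z \<in> chart_map (chart x) ` (M closure_of chart_core (chart x))"
    unfolding chart_map_core[OF x] by (simp add: mem_Times_iff)
  then obtain z' where "z' \<in> M closure_of chart_core (chart x)" "chart_map (chart x) z = chart_map (chart x) z'"
    by blast
  then show "z \<in> M closure_of chart_core (chart x)"
    using inj_onD[OF inj_on_chart_map[OF x]] core_ext[OF x] z by blast
qed

lemma plaque_piece_eq:
  assumes x: "x \<in> topspace M" and V: "V \<subseteq> cbox (- One) One"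
  shows "plaque_piece M (chart x) V w =
    {z \<in> chart_ext (chart x). fst (chart_map (chart x) z) \<in> V \<and> snd (chart_map (chart x) z) = w}"
proof (intro equalityI subsetI)
  fix z assume "z \<in> plaque_piece M (chart x) V w"
  then show "z \<in> {z \<in> chart_ext (chart x). fst (chart_map (chart x) z) \<in> V \<and> snd (chart_map (chart x) z) = w}"
    unfolding plaque_piece_def using core_ext[OF x] by auto
next
  fix z assume z: "z \<in> {z \<in> chart_ext (chart x). fst (chart_map (chart x) z) \<in> V \<and> snd (chart_map (chart x) z) = w}"
  then have "z \<in> M closure_of chart_core (chart x)"
    using closure_core_iff[OF x, of z] V by auto
  then show "z \<in> plaque_piece M (chart x) V w"
    unfolding plaque_piece_def using z by simp
qed

lemma plaque_eq:
  assumes x: "x \<in> topspace M"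
  shows "plaque M (chart x) w =
    {z \<in> chart_ext (chart x). fst (chart_map (chart x) z) \<in> unit_box \<and> snd (chart_map (chart x) z) = w}"
  using plaque_piece_eq[OF x box_subset_cbox] .

lemma plaque_in_basis:
  "\<lbrakk>x \<in> topspace M; w \<in> chart_trans (chart x)\<rbrakk> \<Longrightarrow> plaque M (chart x) w \<in> plaque_basis M chart"
  unfolding plaque_basis_def by blast

lemma openin_plaque:
  "\<lbrakk>x \<in> topspace M; w \<in> chart_trans (chart x)\<rbrakk> \<Longrightarrow>
     openin (fine_topology M chart) (plaque M (chart x) w)"
  unfolding fine_topology_def by (intro topology_generated_by_Basis plaque_in_basis)

lemma centre_in_ext: "x \<in> topspace M \<Longrightarrow> x \<in> chart_ext (chart x)"
  by (metis closure_of_subset core_ext core_mem core_open openin_subset subsetD)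

lemma trans_coordinate:
  "\<lbrakk>x \<in> topspace M; z \<in> chart_ext (chart x)\<rbrakk> \<Longrightarrow> snd (chart_map (chart x) z) \<in> chart_trans (chart x)"
  using chart_map_ext by (metis imageI mem_Times_iff)

lemma centre_in_plaque:
  assumes x: "x \<in> topspace M"
  shows "x \<in> plaque M (chart x) (snd (chart_map (chart x) x))"
  unfolding plaque_eq[OF x] using centre_in_ext[OF x] centered[OF x] by (simp add: mem_box)

lemma topspace_fine [simp]: "topspace (fine_topology M chart) = topspace M"
proof
  show "topspace M \<subseteq> topspace (fine_topology M chart)"
    using centre_in_plaque openin_subset[OF openin_plaque] trans_coordinate centre_in_ext by blast
  show "topspace (fine_topology M chart) \<subseteq> topspace M"
    unfolding fine_topology_def topology_generated_by_topspace plaque_basis_def plaque_piece_def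
    using closure_of_subset_topspace[of M] by auto
qed

text \<open>In the fine product topology a plaque is a box times one point, and
  \<open>foliated_ext\<close> carries its connectedness back.\<close>

lemma connectedin_plaque:
  assumes x: "x \<in> topspace M" and w: "w \<in> chart_trans (chart x)"
  shows "connectedin (fine_topology M chart) (plaque M (chart x) w)"
proof -
  let ?f = "chart_map (chart x)" and ?P = "plaque M (chart x) w"
  have img: "?f ` ?P = unit_box \<times> {w}"
  proof
    show "?f ` ?P \<subseteq> unit_box \<times> {w}" unfolding plaque_eq[OF x] by (rule image_subsetI) (simp add: mem_Times_iff)
    show "unit_box \<times> {w} \<subseteq> ?f ` ?P"
    proof
      fix p assume p: "p \<in> unit_box \<times> {w}"
      then have "p \<in> ?f ` chart_ext (chart x)"
        unfolding chart_map_ext[OF x] using w box_subset_cbox cbox_subset_big_box by fastforce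
      then obtain z where z: "z \<in> chart_ext (chart x)" "p = ?f z" by blast
      then have "z \<in> ?P" using p unfolding plaque_eq[OF x] by (simp add: mem_Times_iff)
      then show "p \<in> ?f ` ?P" using z(2) by (rule rev_image_eqI)
    qed
  qed
  have "connectedin (top_of_set big_box) unit_box"
    unfolding connectedin_subtopology using box_subset_cbox cbox_subset_big_box
    by (auto intro!: convex_connected)
  moreover have "connectedin (discrete_topology (chart_trans (chart x))) {w}"
    using w by (simp add: connectedin_discrete_topology)
  ultimately have "connectedin (prod_topology (top_of_set big_box)
      (discrete_topology (chart_trans (chart x)))) (?f ` ?P)"
    unfolding img connectedin_Times by blast
  moreover have "?P \<subseteq> topspace (subtopology (fine_topology M chart) (chart_ext (chart x)))"
    unfolding plaque_eq[OF x] using ext_subset[OF x] by auto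
  ultimately have "connectedin (subtopology (fine_topology M chart) (chart_ext (chart x))) ?P"
    using homeomorphic_map_connectedness[OF foliated_ext[OF x]] by blast
  then show ?thesis unfolding connectedin_subtopology by blast
qed

abbreviation same_leaf :: "'a \<Rightarrow> 'a \<Rightarrow> bool" where
  "same_leaf \<equiv> connected_component_of (fine_topology M chart)"

lemma plaque_same_leaf:
  "\<lbrakk>x \<in> topspace M; w \<in> chart_trans (chart x); z \<in> plaque M (chart x) w; z' \<in> plaque M (chart x) w\<rbrakk>
     \<Longrightarrow> same_leaf z z'"
  unfolding connected_component_of_def using connectedin_plaque by blast

lemma leaves_eq: "leaves M chart = {{z'. same_leaf z z'} | z. z \<in> topspace M}"
  unfolding leaves_def connected_components_of_def by auto

lemma leaf_closed_under: "\<lbrakk>L \<in> leaves M chart; z \<in> L; same_leaf z z'\<rbrakk> \<Longrightarrow> z' \<in> L"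
  unfolding leaves_eq using connected_component_of_trans by fastforce

text \<open>The local product structure carries the density of a leaf along the plaques.\<close>

lemma plaque_in_closure_of_leaf:
  assumes L: "L \<in> leaves M chart" and x: "x \<in> topspace M" and w: "w \<in> chart_trans (chart x)"
    and z: "z \<in> plaque M (chart x) w" "z \<in> M closure_of L"
    and z': "z' \<in> plaque M (chart x) w"
  shows "z' \<in> M closure_of L"
  unfolding in_closure_of
proof (intro conjI allI impI)
  let ?f = "chart_map (chart x)" and ?B = "chart_ext (chart x)"
  let ?Y = "subtopology (mtopology_of X) (chart_trans (chart x))"
  let ?P = "prod_topology (top_of_set big_box) ?Y"
  have zB: "z \<in> ?B" "z' \<in> ?B" "fst (?f z) \<in> unit_box" "fst (?f z') \<in> unit_box"
    "snd (?f z) = w" "snd (?f z') = w"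
    using z(1) z' unfolding plaque_eq[OF x] by auto
  show "z' \<in> topspace M" using zB ext_subset[OF x] by blast
  fix Q assume Q: "z' \<in> Q \<and> openin M Q"
  have "openin (subtopology M ?B) (Q \<inter> ?B)"
    using Q ext_open[OF x] by (simp add: openin_open_subtopology openin_Int)
  then have "openin ?P (?f ` (Q \<inter> ?B))"
    using homeomorphic_imp_open_map[OF homeo_ext[OF x]] unfolding open_map_def by blast
  moreover have "(fst (?f z'), w) \<in> ?f ` (Q \<inter> ?B)"
    using zB Q by (auto intro!: image_eqI[of _ _ z'] simp: prod_eq_iff)
  ultimately obtain V W where VW: "openin (top_of_set big_box) V" "openin ?Y W" "fst (?f z') \<in> V" "w \<in> W"
    "V \<times> W \<subseteq> ?f ` (Q \<inter> ?B)"
    unfolding openin_prod_topology_alt by metis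
  \<comment> \<open>The union of the plaques over \<open>W\<close>: an open neighbourhood of
    \<open>z\<close>, all of whose plaques enter \<open>Q\<close> at the leaf coordinate of
    \<open>z'\<close>.\<close>
  let ?N = "{y \<in> ?B. ?f y \<in> unit_box \<times> W}"
  have "openin (top_of_set big_box) unit_box"
    using box_subset_cbox cbox_subset_big_box by (intro open_subset) auto
  then have "openin ?P (unit_box \<times> W)"
    using VW(2) unfolding openin_prod_Times_iff by blast
  then have "openin (subtopology M ?B) {y \<in> topspace (subtopology M ?B). ?f y \<in> unit_box \<times> W}"
    by (rule openin_continuous_map_preimage[OF homeomorphic_imp_continuous_map[OF homeo_ext[OF x]]])
  moreover have top: "topspace (subtopology M ?B) = ?B" using ext_subset[OF x] by auto
  ultimately have "openin M ?N"
    unfolding openin_open_subtopology[OF ext_open[OF x]] top by simp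
  moreover have "z \<in> ?N" using zB VW(4) by (simp add: mem_Times_iff)
  ultimately have "\<exists>y. y \<in> L \<and> y \<in> ?N"
    using z(2) unfolding in_closure_of by (elim conjE allE[where x = ?N]) simp
  then obtain y where y: "y \<in> L" "y \<in> ?N" by (elim exE conjE) (rule that)
  then have yB: "y \<in> ?B" "fst (?f y) \<in> unit_box" "snd (?f y) \<in> W"
    by (simp_all add: mem_Times_iff)
  then have "(fst (?f z'), snd (?f y)) \<in> ?f ` (Q \<inter> ?B)"
    using VW(3,5) by auto
  then obtain y' where "(fst (?f z'), snd (?f y)) = ?f y'" "y' \<in> Q \<inter> ?B"
    by (rule imageE)
  then have y': "y' \<in> Q" "y' \<in> ?B" "?f y' = (fst (?f z'), snd (?f y))" by simp_all
  have "snd (?f y) \<in> chart_trans (chart x)" using trans_coordinate[OF x yB(1)] .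
  then have "same_leaf y y'"
    by (rule plaque_same_leaf[OF x]) (use yB y' zB in \<open>auto simp: plaque_eq[OF x]\<close>)
  then show "\<exists>y. y \<in> L \<and> y \<in> Q"
    using leaf_closed_under[OF L y(1)] y'(1) by blast
qed

text \<open>Each plaque lies in the closure of \<open>L\<close> entirely or not at all, so this
  closure is clopen in the fine topology, where leaves are connected.\<close>

lemma leaf_subset_closure_of_leaf:
  assumes L: "L \<in> leaves M chart" and L': "L' \<in> leaves M chart" and z: "z \<in> L'" "z \<in> M closure_of L"
  shows "L' \<subseteq> M closure_of L"
proof -
  let ?C = "M closure_of L"
  have nb: "openin (fine_topology M chart) (plaque M (chart y) (snd (chart_map (chart y) y)))"
    "snd (chart_map (chart y) y) \<in> chart_trans (chart y)" if "y \<in> topspace M" for y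
    using openin_plaque[OF that] trans_coordinate[OF that centre_in_ext[OF that]] by auto
  have "openin (fine_topology M chart) ?C"
  proof (subst openin_subopen, intro ballI)
    fix y assume y: "y \<in> ?C"
    then have yM: "y \<in> topspace M" using closure_of_subset_topspace[of M L] by blast
    have "plaque M (chart y) (snd (chart_map (chart y) y)) \<subseteq> ?C"
      by (intro subsetI) (rule plaque_in_closure_of_leaf[OF L yM nb(2)[OF yM] centre_in_plaque[OF yM] y])
    then show "\<exists>T. openin (fine_topology M chart) T \<and> y \<in> T \<and> T \<subseteq> ?C"
      using nb(1)[OF yM] centre_in_plaque[OF yM] by blast
  qed
  moreover have "openin (fine_topology M chart) (topspace M - ?C)"
  proof (subst openin_subopen, intro ballI)
    fix y assume y: "y \<in> topspace M - ?C"
    then have yM: "y \<in> topspace M" by blast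
    let ?P = "plaque M (chart y) (snd (chart_map (chart y) y))"
    have "y' \<notin> ?C" if "y' \<in> ?P" for y'
      using plaque_in_closure_of_leaf[OF L yM nb(2)[OF yM] that _ centre_in_plaque[OF yM]] y by auto
    then have "?P \<inter> ?C = {}" by auto
    moreover have "?P \<subseteq> topspace M"
      using openin_subset[OF nb(1)[OF yM]] by simp
    ultimately show "\<exists>T. openin (fine_topology M chart) T \<and> y \<in> T \<and> T \<subseteq> topspace M - ?C"
      using nb(1)[OF yM] centre_in_plaque[OF yM] by blast
  qed
  then have "closedin (fine_topology M chart) ?C"
    unfolding closedin_def using closure_of_subset_topspace[of M L] by simp
  moreover have "connectedin (fine_topology M chart) L'"
    using L' unfolding leaves_def by (rule connectedin_connected_components_of)
  ultimately have "L' \<subseteq> ?C \<or> disjnt L' ?C"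
    using connectedin_clopen_cases by blast
  then show ?thesis using z by (auto simp: disjnt_iff)
qed

section \<open>Holonomy orbits lie in leaves, and a dense orbit gives a dense leaf\<close>

lemma holonomy_same_leaf:
  assumes "holonomy_transformation M chart T \<tau> r" "(u, v) \<in> r"
  shows "same_leaf (\<tau> u) (\<tau> v)"
proof -
  obtain m y p where mp: "\<forall>i\<le>m::nat. y i \<in> topspace M"
    "\<forall>(u, v)\<in>r. p 0 u = \<tau> u \<and> p (Suc m) u = \<tau> v"
    "\<forall>i\<le>m. \<forall>u\<in>Domain r. \<exists>w\<in>chart_trans (chart (y i)).
       p i u \<in> plaque M (chart (y i)) w \<and> p (Suc i) u \<in> plaque M (chart (y i)) w"
    using assms(1) unfolding holonomy_transformation_def by blast
  have u: "u \<in> Domain r" using assms(2) by blast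
  have step: "same_leaf (p i u) (p (Suc i) u)" if "i \<le> m" for i
    using mp(1,3) that u plaque_same_leaf by blast
  have "i \<le> m \<Longrightarrow> same_leaf (p 0 u) (p (Suc i) u)" for i
  proof (induction i)
    case 0
    then show ?case using step by simp
  next
    case (Suc i)
    then show ?case using step[of "Suc i"] connected_component_of_trans by fastforce
  qed
  from this[of m] show ?thesis using mp(2) assms(2) by auto
qed

lemma holonomy_pseudogroup_same_leaf:
  assumes T: "\<And>t. t \<in> topspace T \<Longrightarrow> \<tau> t \<in> topspace M"
    and r: "r \<in> holonomy_pseudogroup M chart T \<tau>" "(u, v) \<in> r"
  shows "same_leaf (\<tau> u) (\<tau> v)"
proof -
  have "\<forall>(u, v)\<in>r. same_leaf (\<tau> u) (\<tau> v)"
    using r(1) unfolding holonomy_pseudogroup_def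
  proof (rule generated_pseudogroup_induct)
    show "partial_homeo T r \<and> (\<forall>(u, v)\<in>r. same_leaf (\<tau> u) (\<tau> v))"
      if "r \<in> {r. holonomy_transformation M chart T \<tau> r}" for r
    proof -
      have r: "holonomy_transformation M chart T \<tau> r" using that by simp
      then have "partial_homeo T r" by (simp add: holonomy_transformation_def)
      then show ?thesis using holonomy_same_leaf[OF r] by auto
    qed
    show "\<forall>(u, v)\<in>Id_on (topspace T). same_leaf (\<tau> u) (\<tau> v)"
      using T by (auto simp: connected_component_of_refl)
    show "\<forall>(u, v)\<in>r\<inverse>. same_leaf (\<tau> u) (\<tau> v)"
      if "\<forall>(u, v)\<in>r. same_leaf (\<tau> u) (\<tau> v)" for r
      using that by (auto simp: connected_component_of_sym)
    show "\<forall>(u, v)\<in>r O s. same_leaf (\<tau> u) (\<tau> v)"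
      if "\<forall>(u, v)\<in>r. same_leaf (\<tau> u) (\<tau> v)" "\<forall>(u, v)\<in>s. same_leaf (\<tau> u) (\<tau> v)" for r s
      using that connected_component_of_trans by fastforce
    show "\<forall>(u, v)\<in>Id_on U O r. same_leaf (\<tau> u) (\<tau> v)"
      if "\<forall>(u, v)\<in>r. same_leaf (\<tau> u) (\<tau> v)" for r U
      using that by auto
    show "\<forall>(u, v)\<in>r. same_leaf (\<tau> u) (\<tau> v)"
      if local: "\<And>u. u \<in> Domain r \<Longrightarrow>
        \<exists>U. openin T U \<and> u \<in> U \<and> (\<forall>(u, v)\<in>Id_on U O r. same_leaf (\<tau> u) (\<tau> v))"
      for r
    proof clarify
      fix u v assume uv: "(u, v) \<in> r"
      then obtain U where "u \<in> U" "\<forall>(u, v)\<in>Id_on U O r. same_leaf (\<tau> u) (\<tau> v)"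
        using local[of u] by blast
      then show "same_leaf (\<tau> u) (\<tau> v)" using uv by auto
    qed
  qed
  then show ?thesis using r(2) by blast
qed

text \<open>The leaf through a dense orbit has the whole transversal in its closure; every leaf
  meets the transversal and is then contained in this closure.\<close>

lemma transitive_if_translation_pseudogroup:
  assumes n: "2 \<le> n" and ct: "complete_transversal M X chart (subtree_space n) \<tau>"
    and hol: "holonomy_pseudogroup M chart (subtree_space n) \<tau> = translation_pseudogroup n"
  shows "transitive M chart"
proof -
  have cont: "continuous_map (subtree_space n) M \<tau>"
    by (rule complete_transversal_continuous[OF ct])
  have \<tau>M: "\<tau> t \<in> topspace M" if "t \<in> tspace n" for t
    using continuous_map_image_subset_topspace[OF cont] that by blast
  have leaf: "same_leaf (\<tau> t) (\<tau> (pull n g t))" if t: "t \<in> tspace n" "g \<in> \<Union> t" for t g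
    using _ _ _ t
  proof (rule orbit_induct)
    fix t a assume t: "t \<in> tspace n" and a: "a \<in> letters n" "[a] \<in> \<Union> t"
    have 1: "translation n [a] \<in> holonomy_pseudogroup M chart (subtree_space n) \<tau>"
      unfolding hol translation_pseudogroup_eq using a(1) by (intro generator_in_generated_pseudogroup) simp
    have 2: "(t, pull n [a] t) \<in> translation n [a]"
      unfolding translation_eq[OF letter_closed[OF a(1)]] graph_on_def using t a by blast
    show "same_leaf (\<tau> t) (\<tau> (pull n [a] t))"
      by (rule holonomy_pseudogroup_same_leaf[OF _ 1 2]) (rule \<tau>M)
  qed (auto simp: connected_component_of_refl \<tau>M intro: connected_component_of_trans)
  obtain s where s: "s \<in> tspace n" "\<forall>t\<in>tspace n. \<forall>m. \<exists>g\<in>\<Union> s. agree n m (pull n g s) t"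
    using dense_orbit[OF n] by blast
  define L where "L = {z. same_leaf (\<tau> s) z}"
  have L: "L \<in> leaves M chart" unfolding leaves_eq L_def using \<tau>M[OF s(1)] by blast
  have dense: "\<tau> t \<in> M closure_of L" if t: "t \<in> tspace n" for t
    unfolding in_closure_of
  proof (intro conjI allI impI \<tau>M t)
    fix Q assume Q: "\<tau> t \<in> Q \<and> openin M Q"
    then have "openin (subtree_space n) {t' \<in> tspace n. \<tau> t' \<in> Q}"
      using openin_continuous_map_preimage[OF cont] by blast
    moreover have "t \<in> {t' \<in> tspace n. \<tau> t' \<in> Q}" using t Q by simp
    ultimately obtain m where m: "\<forall>t'\<in>tspace n. agree n m t t' \<longrightarrow> t' \<in> {t' \<in> tspace n. \<tau> t' \<in> Q}"
      unfolding openin_subtree_space by (elim conjE ballE[where x = t]) auto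
    obtain g where g: "g \<in> \<Union> s" "agree n m (pull n g s) t"
      using s(2)[rule_format, OF t, of m] by (elim bexE) (rule that)
    have "\<tau> (pull n g s) \<in> Q"
      using m pull_tspace[OF s(1) g(1)] agree_sym[OF g(2)] by blast
    moreover have "\<tau> (pull n g s) \<in> L" unfolding L_def using leaf[OF s(1) g(1)] by simp
    ultimately show "\<exists>y. y \<in> L \<and> y \<in> Q" by blast
  qed
  have "topspace M \<subseteq> M closure_of L"
  proof
    fix z assume z: "z \<in> topspace M"
    define L' where "L' = {z'. same_leaf z z'}"
    have L': "L' \<in> leaves M chart" unfolding leaves_eq L'_def using z by blast
    then have "L' \<inter> \<tau> ` tspace n \<noteq> {}"
      using ct unfolding complete_transversal_def by blast
    then obtain t where t: "t \<in> tspace n" "\<tau> t \<in> L'" by blast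
    have "z \<in> L'" unfolding L'_def using z by (simp add: connected_component_of_refl)
    then show "z \<in> M closure_of L"
      using leaf_subset_closure_of_leaf[OF L L' t(2) dense[OF t(1)]] by blast
  qed
  then show ?thesis
    unfolding transitive_def using L closure_of_subset_topspace[of M L] by blast
qed

end

lemma lipschitz_if_translation_pseudogroup:
  assumes "holonomy_pseudogroup M chart (subtree_space n) \<tau> = translation_pseudogroup n"
  shows "lipschitz_transversal M chart (subtree_space n) \<tau>"
  unfolding lipschitz_transversal_def
proof (intro exI conjI)
  show "mtopology_of (submetric (tree_metric n) (tspace n)) = subtree_space n"
    by (rule subtree_space_metric)
  show "finite ((\<lambda>a. translation n [a]) ` letters n)" by simp
  show "\<forall>r\<in>(\<lambda>a. translation n [a]) ` letters n.
      clopen_bi_lipschitz (submetric (tree_metric n) (tspace n)) r"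
    using clopen_bi_lipschitz_translation letter_closed by blast
  show "holonomy_pseudogroup M chart (subtree_space n) \<tau> =
      generated_pseudogroup (subtree_space n) ((\<lambda>a. translation n [a]) ` letters n)"
    unfolding assms translation_pseudogroup_eq ..
qed

section \<open>Transverse distances in a \<open>C\<^sup>1\<close>-foliation\<close>

text \<open>
  For a chart \<open>\<phi>\<close> of the foliation, \<open>infdist (\<phi> z - \<phi> z') E\<close> is the distance of the plaques of
  \<open>z\<close> and \<open>z'\<close> in the transverse Euclidean space.
\<close>

lemma infdist_subspace_eq_0:
  fixes E :: "'m::euclidean_space set"
  assumes "subspace E"
  shows "infdist x E = 0 \<longleftrightarrow> x \<in> E"
  using in_closed_iff_infdist_zero[OF closed_subspace[OF assms]] subspace_0[OF assms] by blast

lemma infdist_subspace_le_norm: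
  assumes "subspace E"
  shows "infdist x E \<le> norm (x :: 'm::real_normed_vector)"
  using infdist_le[OF subspace_0[OF assms], of x] by simp

text \<open>The distance to \<open>E\<close> depends only on the class modulo \<open>E\<close>. It
  therefore serves as the norm on the transverse space, and no complement of \<open>E\<close> has to
  be chosen.\<close>

lemma infdist_subspace_add:
  fixes x :: "'m::real_normed_vector"
  assumes E: "subspace E" and e: "e \<in> E"
  shows "infdist (x + e) E = infdist x E"
proof -
  have ne: "E \<noteq> {}" using subspace_0[OF E] by blast
  have le: "infdist (y + v) E \<le> infdist y E" if v: "v \<in> E" for y v
  proof -
    have "infdist (y + v) E \<le> dist y a" if "a \<in> E" for a
      using infdist_le[OF subspace_add[OF E that v], of "y + v"] by simp
    then show ?thesis
      unfolding infdist_notempty[OF ne, of y] by (intro cINF_greatest[OF ne])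
  qed
  have "infdist (x + e + - e) E \<le> infdist (x + e) E"
    by (rule le[OF subspace_neg[OF E e]])
  then show ?thesis using le[OF e, of x] by simp
qed

locale C1_foliated =
  fixes N :: "'b topology" and E :: "'m::euclidean_space set" and \<A> :: "('b set \<times> ('b \<Rightarrow> 'm)) set"
  assumes foliation: "C1_foliation N E \<A>"
begin

lemma subspace_E: "subspace E"
  using foliation unfolding C1_foliation_def by blast

lemma fol_chart:
  assumes "(U, \<phi>) \<in> \<A>"
  shows "openin N U" "open (\<phi> ` U)" "homeomorphic_map (subtopology N U) (top_of_set (\<phi> ` U)) \<phi>"
  using assms foliation unfolding C1_foliation_def by blast+

lemma fol_chart_subset: "(U, \<phi>) \<in> \<A> \<Longrightarrow> U \<subseteq> topspace N"
  using fol_chart(1) openin_subset by blast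

lemma fol_chart_exists:
  assumes "z \<in> topspace N"
  obtains U \<phi> where "(U, \<phi>) \<in> \<A>" "z \<in> U"
proof -
  have "(\<Union>(U, \<phi>)\<in>\<A>. U) = topspace N"
    using foliation unfolding C1_foliation_def by blast
  then show ?thesis using assms that by blast
qed

lemma fol_transition:
  assumes "(U, \<phi>) \<in> \<A>" "(V, \<psi>) \<in> \<A>"
  obtains h where "\<And>z. \<lbrakk>z \<in> U; z \<in> V\<rbrakk> \<Longrightarrow> h (\<phi> z) = \<psi> z" "C1_on h (\<phi> ` (U \<inter> V))"
    "\<And>p. p \<in> \<phi> ` (U \<inter> V) \<Longrightarrow> \<exists>W. open W \<and> p \<in> W \<and> W \<subseteq> \<phi> ` (U \<inter> V) \<and>
      (\<forall>q\<in>W. \<forall>q'\<in>W. q - q' \<in> E \<longrightarrow> h q - h q' \<in> E)"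
proof -
  have "\<forall>(U, \<phi>)\<in>\<A>. \<forall>(V, \<psi>)\<in>\<A>. \<exists>h.
      (\<forall>z\<in>U \<inter> V. h (\<phi> z) = \<psi> z) \<and> C1_on h (\<phi> ` (U \<inter> V)) \<and>
      (\<forall>p\<in>\<phi> ` (U \<inter> V). \<exists>W. open W \<and> p \<in> W \<and> W \<subseteq> \<phi> ` (U \<inter> V) \<and>
         (\<forall>q\<in>W. \<forall>q'\<in>W. q - q' \<in> E \<longrightarrow> h q - h q' \<in> E))"
    using foliation unfolding C1_foliation_def by (elim conjE)
  from bspec[OF this assms(1)] have "\<forall>(V, \<psi>)\<in>\<A>. \<exists>h.
      (\<forall>z\<in>U \<inter> V. h (\<phi> z) = \<psi> z) \<and> C1_on h (\<phi> ` (U \<inter> V)) \<and>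
      (\<forall>p\<in>\<phi> ` (U \<inter> V). \<exists>W. open W \<and> p \<in> W \<and> W \<subseteq> \<phi> ` (U \<inter> V) \<and>
         (\<forall>q\<in>W. \<forall>q'\<in>W. q - q' \<in> E \<longrightarrow> h q - h q' \<in> E))"
    by simp
  from bspec[OF this assms(2)] obtain h where h:
      "\<forall>z\<in>U \<inter> V. h (\<phi> z) = \<psi> z" "C1_on h (\<phi> ` (U \<inter> V))"
      "\<forall>p\<in>\<phi> ` (U \<inter> V). \<exists>W. open W \<and> p \<in> W \<and> W \<subseteq> \<phi> ` (U \<inter> V) \<and>
         (\<forall>q\<in>W. \<forall>q'\<in>W. q - q' \<in> E \<longrightarrow> h q - h q' \<in> E)"
    by auto
  show ?thesis
    using h(1) by (intro that[OF _ h(2) bspec[OF h(3)]]) simp_all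
qed

text \<open>
  A \<open>C\<^sup>1\<close> coordinate change is Lipschitz on a small ball; since it preserves plaques, it is
  Lipschitz for the transverse distance, which is realized inside a slightly larger ball.
\<close>

lemma transition_transverse_lipschitz:
  assumes c: "(U, \<phi>) \<in> \<A>" "(V, \<psi>) \<in> \<A>" and z0: "z0 \<in> U" "z0 \<in> V"
  shows "\<exists>\<rho>>0. \<exists>L>0. ball (\<phi> z0) \<rho> \<subseteq> \<phi> ` (U \<inter> V) \<and>
    (\<forall>z z'. z \<in> U \<inter> V \<and> z' \<in> U \<inter> V \<and> \<phi> z \<in> ball (\<phi> z0) \<rho> \<and> \<phi> z' \<in> ball (\<phi> z0) \<rho> \<longrightarrow>
       infdist (\<psi> z - \<psi> z') E \<le> L * infdist (\<phi> z - \<phi> z') E)"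
proof -
  let ?p = "\<phi> z0" and ?D = "\<phi> ` (U \<inter> V)"
  obtain h where h: "\<And>z. \<lbrakk>z \<in> U; z \<in> V\<rbrakk> \<Longrightarrow> h (\<phi> z) = \<psi> z" "C1_on h ?D"
    "\<And>p. p \<in> ?D \<Longrightarrow> \<exists>W. open W \<and> p \<in> W \<and> W \<subseteq> ?D \<and>
      (\<forall>q\<in>W. \<forall>q'\<in>W. q - q' \<in> E \<longrightarrow> h q - h q' \<in> E)"
    using fol_transition[OF c] by metis
  have "?p \<in> ?D" using z0 by simp
  from h(3)[OF this] obtain W where W: "open W" "?p \<in> W" "W \<subseteq> ?D"
    "\<forall>q\<in>W. \<forall>q'\<in>W. q - q' \<in> E \<longrightarrow> h q - h q' \<in> E"
    by (elim exE conjE) (rule that)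
  obtain h' where h': "\<And>x. x \<in> ?D \<Longrightarrow> (h has_derivative blinfun_apply (h' x)) (at x)"
    "continuous_on ?D h'"
    using h(2) unfolding C1_on_def by blast
  have "continuous_on W h'" using h'(2) W(3) by (rule continuous_on_subset)
  then have "isCont h' ?p" using W(1,2) by (simp add: continuous_on_eq_continuous_at)
  then obtain \<delta> where \<delta>: "\<delta> > 0" "\<And>x. dist x ?p < \<delta> \<Longrightarrow> dist (h' x) (h' ?p) < 1"
    unfolding continuous_at_eps_delta by (metis zero_less_one)
  obtain \<epsilon> where \<epsilon>: "\<epsilon> > 0" "ball ?p \<epsilon> \<subseteq> W"
    using W(1,2) openE by blast
  define r where "r = min \<delta> \<epsilon>"
  \<comment> \<open>By the choice of \<open>\<delta>\<close> the derivative varies by less than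
    \<open>1\<close> on the ball, so \<open>K\<close> bounds its norm there.\<close>
  define K where "K = norm (h' ?p) + 1"
  have r: "r > 0" "ball ?p r \<subseteq> W" using \<delta>(1) \<epsilon> unfolding r_def by auto
  have K: "K > 0" unfolding K_def by (simp add: add_nonneg_pos)
  have lip: "norm (h x - h y) \<le> K * norm (x - y)" if "x \<in> ball ?p r" "y \<in> ball ?p r" for x y
  proof (rule differentiable_bound[OF convex_ball _ _ that])
    fix x assume x: "x \<in> ball ?p r"
    then have "x \<in> ?D" using r(2) W(3) by auto
    then show "(h has_derivative blinfun_apply (h' x)) (at x within ball ?p r)"
      using h'(1) has_derivative_at_withinI by blast
    have "dist x ?p < \<delta>" using x unfolding r_def by (simp add: dist_commute)
    then have "norm (h' x - h' ?p) < 1" using \<delta>(2) by (simp add: dist_norm)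
    then have "norm (h' x) \<le> K"
      unfolding K_def using norm_triangle_sub[of "h' x" "h' ?p"] by linarith
    then show "onorm (blinfun_apply (h' x)) \<le> K" by (simp add: norm_blinfun.rep_eq)
  qed
  \<comment> \<open>Shifting \<open>q\<close> along \<open>E\<close> to \<open>q''\<close> realizes
    the transverse distance to \<open>q'\<close>. Since \<open>q''\<close> is no farther from
    \<open>q'\<close> than \<open>q\<close> is, the radius \<open>r / 3\<close> keeps
    \<open>q''\<close> in the ball of radius \<open>r\<close>, where the Lipschitz bound and the
    preservation of plaques hold.\<close>
  have tr: "infdist (h q - h q') E \<le> K * infdist (q - q') E"
    if q: "q \<in> ball ?p (r / 3)" "q' \<in> ball ?p (r / 3)" for q q'
  proof -
    have "E \<noteq> {}" using subspace_0[OF subspace_E] by blast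
    then obtain e where e: "e \<in> E" "infdist (q - q') E = dist (q - q') e"
      using infdist_attains_inf[OF closed_subspace[OF subspace_E]] by blast
    define q'' where "q'' = q - e"
    have n: "norm (q'' - q') = infdist (q - q') E"
      unfolding q''_def e(2) dist_norm by (simp add: algebra_simps)
    also have "\<dots> \<le> norm (q - q')" by (rule infdist_subspace_le_norm[OF subspace_E])
    also have "\<dots> = dist q q'" by (simp add: dist_norm)
    also have "\<dots> \<le> dist q ?p + dist q' ?p" by (rule dist_triangle2)
    finally have "dist q'' q' \<le> dist q ?p + dist q' ?p" by (simp add: dist_norm)
    moreover have "dist q'' ?p \<le> dist q'' q' + dist q' ?p" by (rule dist_triangle)
    ultimately have "dist q'' ?p < r"
      using q by (simp add: dist_commute)
    then have q'': "q'' \<in> ball ?p r" by (simp add: dist_commute)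
    have q2: "q \<in> ball ?p r" "q' \<in> ball ?p r" using q r(1) by auto
    have "q - q'' \<in> E" unfolding q''_def using e(1) by simp
    then have "h q - h q'' \<in> E" using W(4) q'' q2 r(2) by blast
    then have "infdist ((h q'' - h q') + (h q - h q'')) E = infdist (h q'' - h q') E"
      by (rule infdist_subspace_add[OF subspace_E])
    then have "infdist (h q - h q') E = infdist (h q'' - h q') E" by (simp add: algebra_simps)
    also have "\<dots> \<le> norm (h q'' - h q')" by (rule infdist_subspace_le_norm[OF subspace_E])
    also have "\<dots> \<le> K * norm (q'' - q')" by (rule lip[OF q'' q2(2)])
    finally show ?thesis unfolding n .
  qed
  show ?thesis
  proof (intro exI conjI allI impI)
    show "0 < r / 3" "0 < K" using r K by simp_all
    show "ball ?p (r / 3) \<subseteq> ?D"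
      using r W(3) subset_ball[of "r / 3" r ?p] by auto
    fix z z' assume "z \<in> U \<inter> V \<and> z' \<in> U \<inter> V \<and> \<phi> z \<in> ball ?p (r / 3) \<and> \<phi> z' \<in> ball ?p (r / 3)"
    then show "infdist (\<psi> z - \<psi> z') E \<le> K * infdist (\<phi> z - \<phi> z') E"
      using tr[of "\<phi> z" "\<phi> z'"] h(1) by auto
  qed
qed

section \<open>The leaf topology and the connectedness of plaques of the foliation\<close>

abbreviation leaf_basis :: "'b set set" where
  "leaf_basis \<equiv> {{z \<in> U. \<phi> z \<in> V \<and> \<phi> z - a \<in> E} | U \<phi> V a. (U, \<phi>) \<in> \<A> \<and> open V}"

definition leaf_topology :: "'b topology" where
  "leaf_topology = topology_generated_by leaf_basis"

lemma topspace_leaf_topology: "topspace leaf_topology \<subseteq> topspace N"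
  unfolding leaf_topology_def topology_generated_by_topspace using fol_chart_subset by blast

text \<open>Basic sets of other charts pull back to relatively open sets, because a coordinate
  change is continuous and locally maps cosets of \<open>E\<close> into cosets of
  \<open>E\<close>.\<close>

lemma continuous_plaque_param:
  assumes c: "(U, \<phi>) \<in> \<A>" and S: "S \<subseteq> \<phi> ` U" "\<And>q q'. \<lbrakk>q \<in> S; q' \<in> S\<rbrakk> \<Longrightarrow> q - q' \<in> E"
  shows "continuous_map (top_of_set S) leaf_topology (inv_into U \<phi>)"
  unfolding leaf_topology_def
proof (rule continuous_on_generated_topo)
  let ?g = "inv_into U \<phi>"
  have inj: "inj_on \<phi> U"
    using homeomorphic_imp_injective_map[OF fol_chart(3)[OF c]] fol_chart_subset[OF c]
    by (simp add: Int_absorb1)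
  have g: "?g q \<in> U" "\<phi> (?g q) = q" if "q \<in> S" for q
    using that S(1) by (auto simp: inv_into_into f_inv_into_f)
  fix B assume "B \<in> leaf_basis"
  then obtain U' \<psi> V a where B: "B = {z \<in> U'. \<psi> z \<in> V \<and> \<psi> z - a \<in> E}"
    and c': "(U', \<psi>) \<in> \<A>" and V: "open V"
    by blast
  obtain h where h: "\<And>z. \<lbrakk>z \<in> U; z \<in> U'\<rbrakk> \<Longrightarrow> h (\<phi> z) = \<psi> z" "C1_on h (\<phi> ` (U \<inter> U'))"
    "\<And>p. p \<in> \<phi> ` (U \<inter> U') \<Longrightarrow> \<exists>W. open W \<and> p \<in> W \<and> W \<subseteq> \<phi> ` (U \<inter> U') \<and>
      (\<forall>q\<in>W. \<forall>q'\<in>W. q - q' \<in> E \<longrightarrow> h q - h q' \<in> E)"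
    using fol_transition[OF c c'] by metis
  have "\<exists>T. openin (top_of_set S) T \<and> q0 \<in> T \<and> T \<subseteq> ?g -` B \<inter> topspace (top_of_set S)"
    if q0: "q0 \<in> ?g -` B \<inter> topspace (top_of_set S)" for q0
  proof -
    have q0S: "q0 \<in> S" and q0B: "?g q0 \<in> U'" "\<psi> (?g q0) \<in> V" "\<psi> (?g q0) - a \<in> E"
      using q0 unfolding B by auto
    have q0D: "q0 \<in> \<phi> ` (U \<inter> U')"
      using g[OF q0S] q0B(1) by (metis IntI imageI)
    from h(3)[OF this] obtain W where W: "open W" "q0 \<in> W" "W \<subseteq> \<phi> ` (U \<inter> U')"
      "\<forall>q\<in>W. \<forall>q'\<in>W. q - q' \<in> E \<longrightarrow> h q - h q' \<in> E"
      by (elim exE conjE) (rule that)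
    have "\<forall>x\<in>W. isCont h x"
      using h(2) W(3) unfolding C1_on_def by (meson has_derivative_continuous subsetD)
    then have "continuous_on W h" using W(1) by (simp add: continuous_on_eq_continuous_at)
    then have o: "open (W \<inter> h -` V)"
      using W(1) V by (simp add: continuous_on_open_vimage Int_commute)
    have hq0: "h q0 = \<psi> (?g q0)"
      using h(1)[of "?g q0"] g[OF q0S] q0B(1) by simp
    have "q \<in> ?g -` B" if q: "q \<in> S" "q \<in> W" "h q \<in> V" for q
    proof -
      obtain z where z: "z \<in> U" "z \<in> U'" "q = \<phi> z" using W(3) q(2) by blast
      then have gz: "?g q = z" using inj by simp
      have hq: "h q = \<psi> z" using h(1) z by simp
      have "h q - h q0 \<in> E" using W(2,4) q S(2)[OF q(1) q0S] by blast
      then have "(h q - h q0) + (h q0 - a) \<in> E"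
        using q0B(3) unfolding hq0[symmetric] by (intro subspace_add[OF subspace_E])
      then have "\<psi> z - a \<in> E" unfolding hq by simp
      then show ?thesis unfolding B using gz z(2) q(3) hq by simp
    qed
    then have "S \<inter> (W \<inter> h -` V) \<subseteq> ?g -` B \<inter> topspace (top_of_set S)" by auto
    moreover have "q0 \<in> S \<inter> (W \<inter> h -` V)" using q0S W(2) q0B(2) hq0 by simp
    moreover have "openin (top_of_set S) (S \<inter> (W \<inter> h -` V))" using o by (rule openin_open_Int)
    ultimately show ?thesis by blast
  qed
  then show "openin (top_of_set S) (?g -` B \<inter> topspace (top_of_set S))"
    by (subst openin_subopen) blast
next
  have "inv_into U \<phi> q \<in> \<Union> leaf_basis" if q: "q \<in> S" for q
  proof -
    have "inv_into U \<phi> q \<in> U" using q S(1) by (auto intro: inv_into_into)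
    moreover have "{z \<in> U. \<phi> z \<in> UNIV \<and> \<phi> z - \<phi> (inv_into U \<phi> q) \<in> E} \<in> leaf_basis"
      using c open_UNIV by blast
    moreover have "inv_into U \<phi> q \<in> {z \<in> U. \<phi> z \<in> UNIV \<and> \<phi> z - \<phi> (inv_into U \<phi> q) \<in> E}"
      using \<open>inv_into U \<phi> q \<in> U\<close> subspace_0[OF subspace_E] by simp
    ultimately show ?thesis by (intro UnionI)
  qed
  then show "inv_into U \<phi> ` topspace (top_of_set S) \<subseteq> \<Union> leaf_basis" by auto
qed

text \<open>The plaque is the image of a convex slice. Connectedness in \<open>leaf_topology\<close>
  keeps it inside one leaf, hence inside an invariant set; connectedness in \<open>N\<close> allows
  its preimage to be compared with the plaques of \<open>M\<close>.\<close>

lemma connectedin_fol_plaque: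
  assumes c: "(U, \<phi>) \<in> \<A>" and B: "convex B" "B \<subseteq> \<phi> ` U"
  shows "connectedin leaf_topology {z \<in> U. \<phi> z \<in> B \<and> \<phi> z - p \<in> E}"
    and "connectedin N {z \<in> U. \<phi> z \<in> B \<and> \<phi> z - p \<in> E}"
proof -
  let ?g = "inv_into U \<phi>"
  define S where "S = B \<inter> {q. q - p \<in> E}"
  have inj: "inj_on \<phi> U"
    using homeomorphic_imp_injective_map[OF fol_chart(3)[OF c]] fol_chart_subset[OF c]
    by (simp add: Int_absorb1)
  have "{q. q - p \<in> E} = (\<lambda>x. p + x) ` E"
    by (force simp: image_iff)
  then have "convex {q. q - p \<in> E}"
    using subspace_imp_convex[OF subspace_E] convex_translation by metis
  then have "connected S" unfolding S_def using B(1) by (intro convex_connected convex_Int)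
  then have conn: "connectedin (top_of_set S) S" by (simp add: connectedin_subtopology)
  have "q - q' \<in> E" if "q \<in> S" "q' \<in> S" for q q'
    using subspace_diff[OF subspace_E, of "q - p" "q' - p"] that unfolding S_def by simp
  then have cont: "continuous_map (top_of_set S) leaf_topology ?g"
    using B(2) unfolding S_def by (intro continuous_plaque_param[OF c]) auto
  have img: "?g ` S = {z \<in> U. \<phi> z \<in> B \<and> \<phi> z - p \<in> E}"
  proof
    show "?g ` S \<subseteq> {z \<in> U. \<phi> z \<in> B \<and> \<phi> z - p \<in> E}"
      unfolding S_def using B(2) by (auto simp: inv_into_into f_inv_into_f subset_eq)
    show "{z \<in> U. \<phi> z \<in> B \<and> \<phi> z - p \<in> E} \<subseteq> ?g ` S"
    proof
      fix z assume z: "z \<in> {z \<in> U. \<phi> z \<in> B \<and> \<phi> z - p \<in> E}"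
      then have "z = ?g (\<phi> z)" using inj by simp
      then show "z \<in> ?g ` S" using z unfolding S_def by blast
    qed
  qed
  show "connectedin leaf_topology {z \<in> U. \<phi> z \<in> B \<and> \<phi> z - p \<in> E}"
    using connectedin_continuous_map_image[OF cont conn] unfolding img .
  obtain k where k: "homeomorphic_maps (subtopology N U) (top_of_set (\<phi> ` U)) \<phi> k"
    using fol_chart(3)[OF c] unfolding homeomorphic_map_maps by blast
  have "continuous_map (top_of_set (\<phi> ` U)) (subtopology N U) k"
    using k unfolding homeomorphic_maps_def by blast
  moreover have "?g q = k q" if "q \<in> \<phi> ` U" for q
    using that k fol_chart_subset[OF c] inj unfolding homeomorphic_maps_def by auto
  ultimately have "continuous_map (top_of_set (\<phi> ` U)) (subtopology N U) ?g"
    by (rule_tac continuous_map_eq[of _ _ k]) auto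
  moreover have "connectedin (top_of_set (\<phi> ` U)) S"
    using \<open>connected S\<close> B(2) unfolding S_def connectedin_subtopology by auto
  ultimately have "connectedin (subtopology N U) (?g ` S)"
    by (rule connectedin_continuous_map_image)
  then show "connectedin N {z \<in> U. \<phi> z \<in> B \<and> \<phi> z - p \<in> E}"
    unfolding img connectedin_subtopology by blast
qed

lemma invariant_subset_topspace: "invariant_subset E \<A> K \<Longrightarrow> K \<subseteq> topspace N"
proof
  fix z assume "invariant_subset E \<A> K" "z \<in> K"
  then obtain L where "L \<in> connected_components_of leaf_topology" "z \<in> L"
    unfolding invariant_subset_def foliation_leaves_def leaf_topology_def[symmetric] by blast
  then show "z \<in> topspace N"
    using Union_connected_components_of[of leaf_topology] topspace_leaf_topology by blast
qed

lemma plaque_subset_invariant: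
  assumes K: "invariant_subset E \<A> K" and z: "z \<in> K" "z \<in> P" and P: "connectedin leaf_topology P"
  shows "P \<subseteq> K"
proof -
  obtain L where L: "L \<in> connected_components_of leaf_topology" "z \<in> L" "L \<subseteq> K"
    using K z(1) unfolding invariant_subset_def foliation_leaves_def leaf_topology_def[symmetric]
    by blast
  then obtain y where "L = connected_component_of_set leaf_topology y"
    unfolding connected_components_of_def by blast
  then have "connected_component_of leaf_topology y z" using L(2) by simp
  moreover have "connected_component_of leaf_topology z w" if "w \<in> P" for w
    using P z(2) that unfolding connected_component_of_def by blast
  ultimately have "P \<subseteq> L"
    unfolding \<open>L = _\<close> using connected_component_of_trans[of leaf_topology y z] by blast
  then show ?thesis using L(3) by blast
qed

end

section \<open>Foliated spaces embedded in foliations\<close>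

text \<open>Equality of the leaf dimensions, \<open>dim_E\<close>, is what makes invariance of
  domain applicable to the plaques.\<close>

locale foliated_embedding = foliated_space M X chart + C1_foliated N E \<A>
  for M :: "'a topology" and X :: "'x metric"
    and chart :: "'a \<Rightarrow> ('a, 'e::euclidean_space, 'x) foliated_chart"
    and N :: "'b topology" and E :: "'m::euclidean_space set" and \<A> :: "('b set \<times> ('b \<Rightarrow> 'm)) set" +
  fixes K :: "'b set" and f :: "'a \<Rightarrow> 'b"
  assumes dim_E: "dim E = DIM('e)"
    and invariant: "invariant_subset E \<A> K"
    and homeo: "homeomorphic_map M (subtopology N K) f"
    and totally_disconnected: "connectedin (mtopology_of X) S \<Longrightarrow> \<exists>w. S \<subseteq> {w}"
begin

lemma image_f: "f ` topspace M = K"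
  using homeomorphic_imp_surjective_map[OF homeo] invariant_subset_topspace[OF invariant]
  by (simp add: Int_absorb1)

lemma f_in_topspace: "z \<in> topspace M \<Longrightarrow> f z \<in> topspace N"
  using image_f invariant_subset_topspace[OF invariant] by blast

lemma continuous_f: "continuous_map M N f"
  using homeomorphic_imp_continuous_map[OF homeo] by (rule continuous_map_into_fulltopology)

lemma openin_fol_chart_preimage:
  assumes c: "(U, \<phi>) \<in> \<A>" and B: "open B"
  shows "openin N {w \<in> U. \<phi> w \<in> B}"
proof -
  have "openin (top_of_set (\<phi> ` U)) (\<phi> ` U \<inter> B)" using B by (rule openin_open_Int)
  then have "openin (subtopology N U) {w \<in> topspace (subtopology N U). \<phi> w \<in> \<phi> ` U \<inter> B}"
    by (rule openin_continuous_map_preimage[OF homeomorphic_imp_continuous_map[OF fol_chart(3)[OF c]]])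
  moreover have "{w \<in> topspace (subtopology N U). \<phi> w \<in> \<phi> ` U \<inter> B} = {w \<in> U. \<phi> w \<in> B}"
    using fol_chart_subset[OF c] by auto
  ultimately show ?thesis
    using fol_chart(1)[OF c] by (simp add: openin_open_subtopology)
qed

lemma openin_preimage_ball:
  assumes c: "(U, \<phi>) \<in> \<A>" and B: "open B"
  shows "openin M {z \<in> topspace M. f z \<in> U \<and> \<phi> (f z) \<in> B}"
  using openin_continuous_map_preimage[OF continuous_f openin_fol_chart_preimage[OF c B]] by simp

lemma inj_on_fol_chart: "(U, \<phi>) \<in> \<A> \<Longrightarrow> inj_on \<phi> U"
  using homeomorphic_imp_injective_map[OF fol_chart(3)] fol_chart_subset by (simp add: Int_absorb1)

text \<open>The image of \<open>G\<close> under \<open>f\<close> is open only relative to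
  \<open>K\<close>, so the ball is controlled only at its points in \<open>K\<close>.\<close>

lemma small_ball:
  assumes c: "(U, \<phi>) \<in> \<A>" and G: "openin M G" and z0: "z0 \<in> G" "f z0 \<in> U"
  obtains \<rho> where "\<rho> > 0" "ball (\<phi> (f z0)) \<rho> \<subseteq> \<phi> ` U"
    "\<And>w. \<lbrakk>w \<in> U; w \<in> K; \<phi> w \<in> ball (\<phi> (f z0)) \<rho>\<rbrakk> \<Longrightarrow> w \<in> f ` G"
proof -
  have "openin (subtopology N K) (f ` G)"
    using homeomorphic_imp_open_map[OF homeo] G unfolding open_map_def by blast
  then obtain Q where Q: "openin N Q" "f ` G = Q \<inter> K"
    unfolding openin_subtopology by blast
  have "openin (subtopology N U) (Q \<inter> U)"
    using Q(1) fol_chart(1)[OF c] by (simp add: openin_open_subtopology openin_Int)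
  then have "openin (top_of_set (\<phi> ` U)) (\<phi> ` (Q \<inter> U))"
    using homeomorphic_imp_open_map[OF fol_chart(3)[OF c]] unfolding open_map_def by blast
  then have "open (\<phi> ` (Q \<inter> U))"
    using fol_chart(2)[OF c] by (rule openin_open_trans)
  moreover have "\<phi> (f z0) \<in> \<phi> ` (Q \<inter> U)" using z0 Q(2) by blast
  ultimately obtain \<rho> where \<rho>: "\<rho> > 0" "ball (\<phi> (f z0)) \<rho> \<subseteq> \<phi> ` (Q \<inter> U)"
    using openE by blast
  have "w \<in> f ` G" if w: "w \<in> U" "w \<in> K" "\<phi> w \<in> ball (\<phi> (f z0)) \<rho>" for w
  proof -
    obtain w' where "w' \<in> Q \<inter> U" "\<phi> w = \<phi> w'" using \<rho>(2) w(3) by blast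
    then have "w \<in> Q" using inj_onD[OF inj_on_fol_chart[OF c]] w(1) by blast
    then show ?thesis using Q(2) w(2) by simp
  qed
  moreover have "ball (\<phi> (f z0)) \<rho> \<subseteq> \<phi> ` U" using \<rho>(2) by blast
  ultimately show ?thesis using \<rho>(1) that by blast
qed

text \<open>
  A small plaque of the foliation is connected, so its preimage lies in one plaque of \<open>M\<close>, the
  transversal being totally disconnected; by invariance of domain the preimage is open there.
\<close>

lemma local_product:
  assumes z0: "z0 \<in> topspace M" and c: "(U, \<phi>) \<in> \<A>" "f z0 \<in> U"
    and y: "y \<in> topspace M" "z0 \<in> chart_ext (chart y)"
  shows "\<exists>Q. openin M Q \<and> z0 \<in> Q \<and> Q \<subseteq> chart_ext (chart y) \<and> (\<forall>z\<in>Q. f z \<in> U) \<and>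
    (\<forall>z\<in>Q. \<forall>z'\<in>Q. \<phi> (f z) - \<phi> (f z') \<in> E \<longrightarrow>
       snd (chart_map (chart y) z) = snd (chart_map (chart y) z')) \<and>
    (\<forall>z\<in>Q. \<exists>R. openin M R \<and> z \<in> R \<and>
       (\<forall>z'\<in>R. snd (chart_map (chart y) z') = snd (chart_map (chart y) z) \<longrightarrow>
          \<phi> (f z') - \<phi> (f z) \<in> E))"
proof -
  let ?X = "chart_ext (chart y)" and ?q = "chart_map (chart y)"
  let ?Y = "subtopology (mtopology_of X) (chart_trans (chart y))"
  let ?P = "prod_topology (top_of_set big_box) ?Y"
  obtain \<rho> where \<rho>: "\<rho> > 0" "ball (\<phi> (f z0)) \<rho> \<subseteq> \<phi> ` U"
    "\<And>w. \<lbrakk>w \<in> U; w \<in> K; \<phi> w \<in> ball (\<phi> (f z0)) \<rho>\<rbrakk> \<Longrightarrow> w \<in> f ` ?X"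
    using small_ball[OF c(1) ext_open[OF y(1)] y(2) c(2)] by metis
  define B where "B = ball (\<phi> (f z0)) \<rho>"
  define Q where "Q = {z \<in> topspace M. f z \<in> U \<and> \<phi> (f z) \<in> B}"
  have injf: "inj_on f (topspace M)" by (rule homeomorphic_imp_injective_map[OF homeo])
  have XM: "?X \<subseteq> topspace M" by (rule ext_subset[OF y(1)])
  have in_ext: "z \<in> ?X" if "z \<in> topspace M" "f z \<in> U" "\<phi> (f z) \<in> B" for z
  proof -
    have "f z \<in> f ` ?X" using \<rho>(3)[of "f z"] that image_f unfolding B_def by blast
    then show ?thesis using inj_onD[OF injf] that(1) XM by blast
  qed
  have "openin M Q"
    unfolding Q_def B_def by (rule openin_preimage_ball[OF c(1) open_ball])
  moreover have "z0 \<in> Q" unfolding Q_def B_def using z0 c(2) \<rho>(1) by simp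
  moreover have "Q \<subseteq> ?X" unfolding Q_def using in_ext by auto
  ultimately have Q: "openin M Q" "z0 \<in> Q" "Q \<subseteq> ?X" by blast+
  obtain g where g: "homeomorphic_maps M (subtopology N K) f g"
    using homeo unfolding homeomorphic_map_maps by blast
  have gf: "g (f z) = z" if "z \<in> topspace M" for z
    using g that unfolding homeomorphic_maps_def by blast
  have gcont: "continuous_map (subtopology N K) M g"
    using g unfolding homeomorphic_maps_def by blast
  have fg: "f (g w) = w" "g w \<in> topspace M" if "w \<in> K" for w
    using that image_f gf by auto
  define P where "P z = {w \<in> U. \<phi> w \<in> B \<and> \<phi> w - \<phi> (f z) \<in> E}" for z
  have PK: "P z \<subseteq> K" and Pconn: "connectedin N (P z)" and zP: "f z \<in> P z" if "z \<in> Q" for z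
  proof -
    show zP: "f z \<in> P z"
      using that subspace_0[OF subspace_E] unfolding P_def Q_def by simp
    have B: "convex B" "B \<subseteq> \<phi> ` U" using \<rho>(2) unfolding B_def by auto
    have "f z \<in> K" using that image_f unfolding Q_def by blast
    then show "P z \<subseteq> K"
      using plaque_subset_invariant[OF invariant _ zP] connectedin_fol_plaque(1)[OF c(1) B]
      unfolding P_def by blast
    show "connectedin N (P z)"
      using connectedin_fol_plaque(2)[OF c(1) B] unfolding P_def .
  qed
  have gP: "g w \<in> ?X" if "z \<in> Q" "w \<in> P z" for z w
  proof -
    have "w \<in> K" using PK that by blast
    then show ?thesis
      using fg[of w] that(2) unfolding P_def by (intro in_ext) auto
  qed
  have snd_const: "snd (?q (g w)) = snd (?q z)" if z: "z \<in> Q" and w: "w \<in> P z" for z w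
  proof -
    have "connectedin (subtopology N K) (P z)"
      using Pconn[OF z] PK[OF z] by (simp add: connectedin_subtopology)
    then have "connectedin M (g ` P z)"
      by (rule connectedin_continuous_map_image[OF gcont])
    then have "connectedin (subtopology M ?X) (g ` P z)"
      using gP[OF z] by (auto simp: connectedin_subtopology)
    then have "connectedin ?P (?q ` g ` P z)"
      by (rule connectedin_continuous_map_image[OF homeomorphic_imp_continuous_map[OF homeo_ext[OF y(1)]]])
    then have "connectedin ?Y (snd ` ?q ` g ` P z)"
      by (rule connectedin_continuous_map_image[OF continuous_map_snd])
    then have "connectedin (mtopology_of X) (snd ` ?q ` g ` P z)"
      by (simp add: connectedin_subtopology)
    then obtain v where v: "snd ` ?q ` g ` P z \<subseteq> {v}" using totally_disconnected by blast
    have "z \<in> topspace M" using z unfolding Q_def by simp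
    then have "z \<in> g ` P z" using zP[OF z] gf by (metis imageI)
    then have "snd (?q z) \<in> {v}" "snd (?q (g w)) \<in> {v}" using v w by blast+
    then show ?thesis by simp
  qed
  have A: "snd (?q z) = snd (?q z')"
    if z: "z \<in> Q" "z' \<in> Q" "\<phi> (f z) - \<phi> (f z') \<in> E" for z z'
  proof -
    have zM: "z \<in> topspace M" using z(1) unfolding Q_def by simp
    have "f z \<in> P z'" using z unfolding P_def Q_def by simp
    then show ?thesis using snd_const[OF z(2)] gf[OF zM] by metis
  qed
  \<comment> \<open>The converse is claimed only locally: one plaque of \<open>M\<close> may meet
    \<open>Q\<close> in pieces that lie in several plaques of the foliation chart.\<close>
  have R: "\<exists>R. openin M R \<and> z \<in> R \<and> (\<forall>z'\<in>R. snd (?q z') = snd (?q z) \<longrightarrow> \<phi> (f z') - \<phi> (f z) \<in> E)"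
    if z: "z \<in> Q" for z
  proof -
    \<comment> \<open>\<open>S\<close> is the plaque of \<open>f z\<close> in the coordinates of
      \<open>E\<close>, and \<open>h\<close> parametrizes the corresponding points of
      \<open>M\<close>. The leaf coordinate of \<open>h\<close> is injective because the transverse
      coordinate is constant along the plaque.\<close>
    define S where "S = E \<inter> (\<lambda>e. \<phi> (f z) + e) -` B"
    define h where "h e = g (inv_into U \<phi> (\<phi> (f z) + e))" for e
    have zM: "z \<in> topspace M" "f z \<in> U" "\<phi> (f z) \<in> B" using z unfolding Q_def by simp_all
    have inv: "inv_into U \<phi> (\<phi> (f z) + e) \<in> P z" "\<phi> (inv_into U \<phi> (\<phi> (f z) + e)) = \<phi> (f z) + e"
      if "e \<in> S" for e
    proof -
      have "\<phi> (f z) + e \<in> \<phi> ` U" using that \<rho>(2) unfolding S_def B_def by auto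
      then have "\<phi> (inv_into U \<phi> (\<phi> (f z) + e)) = \<phi> (f z) + e" "inv_into U \<phi> (\<phi> (f z) + e) \<in> U"
        by (auto intro: f_inv_into_f inv_into_into)
      then show "inv_into U \<phi> (\<phi> (f z) + e) \<in> P z" "\<phi> (inv_into U \<phi> (\<phi> (f z) + e)) = \<phi> (f z) + e"
        using that unfolding P_def S_def by simp_all
    qed
    have h: "h e \<in> ?X" "snd (?q (h e)) = snd (?q z)" "\<phi> (f (h e)) = \<phi> (f z) + e" if "e \<in> S" for e
    proof -
      have i: "inv_into U \<phi> (\<phi> (f z) + e) \<in> P z" by (rule inv(1)[OF that])
      show "h e \<in> ?X" unfolding h_def by (rule gP[OF z i])
      show "snd (?q (h e)) = snd (?q z)" unfolding h_def by (rule snd_const[OF z i])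
      have "inv_into U \<phi> (\<phi> (f z) + e) \<in> K" using PK[OF z] i by blast
      then show "\<phi> (f (h e)) = \<phi> (f z) + e" unfolding h_def by (simp add: fg(1) inv(2)[OF that])
    qed
    have "openin (top_of_set E) S"
      unfolding S_def by (intro openin_open_Int open_vimage) (auto simp: B_def intro!: continuous_intros)
    moreover have "continuous_on S (\<lambda>e. fst (?q (h e)))"
    proof -
      obtain k where k: "homeomorphic_maps (subtopology N U) (top_of_set (\<phi> ` U)) \<phi> k"
        using fol_chart(3)[OF c(1)] unfolding homeomorphic_map_maps by blast
      have kcont: "continuous_map (top_of_set (\<phi> ` U)) (subtopology N U) k"
        using k unfolding homeomorphic_maps_def by blast
      have keq: "inv_into U \<phi> p = k p" if "p \<in> \<phi> ` U" for p
        using that k fol_chart_subset[OF c(1)] inj_on_fol_chart[OF c(1)]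
        unfolding homeomorphic_maps_def by auto
      have "continuous_map (top_of_set (\<phi> ` U)) (subtopology N U) (inv_into U \<phi>)"
        by (rule continuous_map_eq[OF kcont]) (simp add: keq)
      then have "continuous_map (top_of_set (\<phi> ` U)) N (inv_into U \<phi>)"
        by (rule continuous_map_into_fulltopology)
      moreover have "continuous_map (top_of_set S) (top_of_set (\<phi> ` U)) (\<lambda>e. \<phi> (f z) + e)"
        using \<rho>(2) unfolding S_def B_def
        by (auto simp: continuous_map_in_subtopology intro!: continuous_intros)
      ultimately have "continuous_map (top_of_set S) N (\<lambda>e. inv_into U \<phi> (\<phi> (f z) + e))"
        using continuous_map_compose[unfolded comp_def] by blast
      then have "continuous_map (top_of_set S) (subtopology N K) (\<lambda>e. inv_into U \<phi> (\<phi> (f z) + e))"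
        using inv(1) PK[OF z] by (intro continuous_map_into_subtopology) auto
      then have "continuous_map (top_of_set S) M h"
        unfolding h_def using continuous_map_compose[OF _ gcont, unfolded comp_def] by blast
      then have "continuous_map (top_of_set S) (subtopology M ?X) h"
        using h(1) by (intro continuous_map_into_subtopology) auto
      then have "continuous_map (top_of_set S) ?P (\<lambda>e. ?q (h e))"
        using continuous_map_compose[OF _ homeomorphic_imp_continuous_map[OF homeo_ext[OF y(1)]],
            unfolded comp_def] by blast
      then have "continuous_map (top_of_set S) (top_of_set big_box) (\<lambda>e. fst (?q (h e)))"
        using continuous_map_compose[OF _ continuous_map_fst, unfolded comp_def] by blast
      then show ?thesis
        using continuous_map_into_fulltopology continuous_map_iff_continuous by blast
    qed
    moreover have "inj_on (\<lambda>e. fst (?q (h e))) S"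
    proof (rule inj_onI)
      fix e e' assume e: "e \<in> S" "e' \<in> S" "fst (?q (h e)) = fst (?q (h e'))"
      then have "?q (h e) = ?q (h e')" using h(2) by (simp add: prod_eq_iff)
      then have "h e = h e'" using inj_onD[OF inj_on_chart_map[OF y(1)]] h(1) e(1,2) by blast
      then have "\<phi> (f z) + e = \<phi> (f z) + e'" using h(3) e(1,2) by metis
      then show "e = e'" by simp
    qed
    \<comment> \<open>Invariance of domain for a continuous injection from an open subset of
      \<open>E\<close> into a space of the same dimension.\<close>
    ultimately have "openin (top_of_set UNIV) ((\<lambda>e. fst (?q (h e))) ` S)"
      using dim_E by (intro invariance_of_domain_subspaces[OF _ subspace_E subspace_UNIV]) auto
    then have op: "open ((\<lambda>e. fst (?q (h e))) ` S)" by simp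
    \<comment> \<open>Over the open image, the points with the transverse coordinate of
      \<open>z\<close> are exactly the values of \<open>h\<close>.\<close>
    define R where "R = {z' \<in> ?X. fst (?q z') \<in> (\<lambda>e. fst (?q (h e))) ` S}"
    have "continuous_map (subtopology M ?X) (top_of_set big_box) (\<lambda>z'. fst (?q z'))"
      using continuous_map_compose[OF homeomorphic_imp_continuous_map[OF homeo_ext[OF y(1)]]
          continuous_map_fst, unfolded comp_def] .
    then have "continuous_map (subtopology M ?X) euclidean (\<lambda>z'. fst (?q z'))"
      by (rule continuous_map_into_fulltopology)
    from openin_continuous_map_preimage[OF this, of "(\<lambda>e. fst (?q (h e))) ` S"] op
    have "openin (subtopology M ?X) {z' \<in> topspace (subtopology M ?X). fst (?q z') \<in> (\<lambda>e. fst (?q (h e))) ` S}"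
      by simp
    moreover have top: "topspace (subtopology M ?X) = ?X" using XM by auto
    ultimately have "openin M R"
      unfolding R_def openin_open_subtopology[OF ext_open[OF y(1)]] top by simp
    moreover have "z \<in> R"
    proof -
      have "0 \<in> S" unfolding S_def using subspace_0[OF subspace_E] zM(3) by simp
      moreover have "h 0 = z"
        unfolding h_def using inj_on_fol_chart[OF c(1)] zM gf by simp
      ultimately show ?thesis
        unfolding R_def using Q(3) z by (auto intro!: image_eqI[of _ _ 0])
    qed
    moreover have "\<phi> (f z') - \<phi> (f z) \<in> E" if z': "z' \<in> R" "snd (?q z') = snd (?q z)" for z'
    proof -
      obtain e where e: "e \<in> S" "fst (?q z') = fst (?q (h e))" "z' \<in> ?X"
        using z'(1) unfolding R_def by blast
      then have "?q z' = ?q (h e)" using z'(2) h(2) by (simp add: prod_eq_iff)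
      then have "z' = h e" using inj_onD[OF inj_on_chart_map[OF y(1)]] h(1) e by blast
      then show ?thesis using h(3)[OF e(1)] e(1) unfolding S_def by simp
    qed
    ultimately show ?thesis by blast
  qed
  have "\<forall>z\<in>Q. f z \<in> U" unfolding Q_def by simp
  moreover have "\<forall>z\<in>Q. \<forall>z'\<in>Q. \<phi> (f z) - \<phi> (f z') \<in> E \<longrightarrow> snd (?q z) = snd (?q z')"
    using A by (intro ballI impI)
  moreover have "\<forall>z\<in>Q. \<exists>R. openin M R \<and> z \<in> R \<and>
      (\<forall>z'\<in>R. snd (?q z') = snd (?q z) \<longrightarrow> \<phi> (f z') - \<phi> (f z) \<in> E)"
    using R by (rule ballI)
  ultimately show ?thesis
    using Q by (intro exI[of _ Q] conjI)
qed

text \<open>The transverse coordinate in \<open>M\<close> is constant along a curve in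
  \<open>Q\<close>, its values lying in a totally disconnected space. The local converse in
  \<open>local_product\<close> then makes the foliation coordinate locally constant modulo
  \<open>E\<close> along the curve, and the interval is connected.\<close>

lemma curves_in_small_sets:
  assumes z0: "z0 \<in> topspace M" and c: "(U, \<phi>) \<in> \<A>" "f z0 \<in> U"
  obtains Q where "openin M Q" "z0 \<in> Q" "\<And>z. z \<in> Q \<Longrightarrow> f z \<in> U"
    "\<And>(I :: real set) \<gamma> s s'. \<lbrakk>connected I; continuous_map (top_of_set I) M \<gamma>; \<gamma> ` I \<subseteq> Q;
       s \<in> I; s' \<in> I\<rbrakk> \<Longrightarrow> \<phi> (f (\<gamma> s)) - \<phi> (f (\<gamma> s')) \<in> E"
proof -
  let ?X = "chart_ext (chart z0)" and ?q = "chart_map (chart z0)"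
  let ?Y = "subtopology (mtopology_of X) (chart_trans (chart z0))"
  obtain Q where Q: "openin M Q" "z0 \<in> Q" "Q \<subseteq> ?X" "\<forall>z\<in>Q. f z \<in> U"
    "\<forall>z\<in>Q. \<exists>R. openin M R \<and> z \<in> R \<and>
       (\<forall>z'\<in>R. snd (?q z') = snd (?q z) \<longrightarrow> \<phi> (f z') - \<phi> (f z) \<in> E)"
    using local_product[OF z0 c z0 centre_in_ext[OF z0]] by (elim exE conjE) (rule that)
  have "\<phi> (f (\<gamma> s)) - \<phi> (f (\<gamma> s')) \<in> E"
    if I: "connected I" and \<gamma>: "continuous_map (top_of_set I) M \<gamma>" "\<gamma> ` I \<subseteq> Q"
      and s: "s \<in> I" "s' \<in> I" for I :: "real set" and \<gamma> s s'
  proof -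
    have "continuous_map (top_of_set I) (subtopology M ?X) \<gamma>"
      using \<gamma> Q(3) by (intro continuous_map_into_subtopology) auto
    then have "continuous_map (top_of_set I) (prod_topology (top_of_set big_box) ?Y) (\<lambda>s. ?q (\<gamma> s))"
      using continuous_map_compose[OF _ homeomorphic_imp_continuous_map[OF homeo_ext[OF z0]],
          unfolded comp_def] by blast
    then have "continuous_map (top_of_set I) ?Y (\<lambda>s. snd (?q (\<gamma> s)))"
      using continuous_map_compose[OF _ continuous_map_snd, unfolded comp_def] by blast
    then have "connectedin ?Y ((\<lambda>s. snd (?q (\<gamma> s))) ` I)"
      using I by (rule_tac connectedin_continuous_map_image) (auto simp: connectedin_subtopology)
    then have "connectedin (mtopology_of X) ((\<lambda>s. snd (?q (\<gamma> s))) ` I)"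
      by (simp add: connectedin_subtopology)
    then obtain v where v: "(\<lambda>s. snd (?q (\<gamma> s))) ` I \<subseteq> {v}" using totally_disconnected by blast
    show ?thesis
      using I s
    proof (rule connected_equivalence_relation[where R = "\<lambda>s s'. \<phi> (f (\<gamma> s)) - \<phi> (f (\<gamma> s')) \<in> E"])
      show "\<phi> (f (\<gamma> b)) - \<phi> (f (\<gamma> a)) \<in> E" if "\<phi> (f (\<gamma> a)) - \<phi> (f (\<gamma> b)) \<in> E" for a b
        using subspace_neg[OF subspace_E that] by simp
      show "\<phi> (f (\<gamma> a)) - \<phi> (f (\<gamma> d)) \<in> E"
        if "\<phi> (f (\<gamma> a)) - \<phi> (f (\<gamma> b)) \<in> E" "\<phi> (f (\<gamma> b)) - \<phi> (f (\<gamma> d)) \<in> E" for a b d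
        using subspace_add[OF subspace_E that] by simp
      fix a assume a: "a \<in> I"
      then have "\<gamma> a \<in> Q" using \<gamma>(2) by blast
      from bspec[OF Q(5) this] obtain R where R: "openin M R" "\<gamma> a \<in> R"
        "\<forall>z'\<in>R. snd (?q z') = snd (?q (\<gamma> a)) \<longrightarrow> \<phi> (f z') - \<phi> (f (\<gamma> a)) \<in> E"
        by (elim exE conjE) (rule that)
      have "openin (top_of_set I) {s \<in> topspace (top_of_set I). \<gamma> s \<in> R}"
        by (rule openin_continuous_map_preimage[OF \<gamma>(1) R(1)])
      moreover have "\<phi> (f (\<gamma> a)) - \<phi> (f (\<gamma> b)) \<in> E" if "b \<in> I" "\<gamma> b \<in> R" for b
      proof -
        have "snd (?q (\<gamma> b)) = snd (?q (\<gamma> a))" using v a that(1) by auto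
        then have "\<phi> (f (\<gamma> b)) - \<phi> (f (\<gamma> a)) \<in> E" using R(3) that(2) by blast
        then show ?thesis using subspace_neg[OF subspace_E] by fastforce
      qed
      ultimately show "\<exists>T. openin (top_of_set I) T \<and> a \<in> T \<and>
          (\<forall>x\<in>T. \<phi> (f (\<gamma> a)) - \<phi> (f (\<gamma> x)) \<in> E)"
        using a R(2) by (intro exI[of _ "{s \<in> topspace (top_of_set I). \<gamma> s \<in> R}"]) simp
    qed
  qed
  then show ?thesis using Q by (intro that[of Q]) auto
qed

end

lemma continuous_map_scaleR:
  fixes g :: "'t \<Rightarrow> 'v::real_normed_vector"
  shows "\<lbrakk>continuous_map T euclidean a; continuous_map T euclidean g\<rbrakk> \<Longrightarrow>
    continuous_map T euclidean (\<lambda>x. a x *\<^sub>R g x)"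
  by (simp add: continuous_map_atin tendsto_scaleR)

section \<open>Holonomy is locally Lipschitz in the transverse direction\<close>

context C1_foliated
begin

text \<open>A property of germs at \<open>u0\<close>, so that estimates with different
  neighbourhoods and constants can be composed.\<close>

definition trans_lip :: "'t topology \<Rightarrow> ('t \<Rightarrow> 'm) \<Rightarrow> ('t \<Rightarrow> 'm) \<Rightarrow> 't \<Rightarrow> bool" where
  "trans_lip T p q u0 \<longleftrightarrow> (\<exists>\<Omega> L. openin T \<Omega> \<and> u0 \<in> \<Omega> \<and> 0 < L \<and>
     (\<forall>u\<in>\<Omega>. \<forall>u'\<in>\<Omega>. infdist (q u - q u') E \<le> L * infdist (p u - p u') E))"

lemma trans_lip_trans:
  assumes "trans_lip T p q u0" "trans_lip T q r u0"
  shows "trans_lip T p r u0"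
proof -
  obtain \<Omega> L where 1: "openin T \<Omega>" "u0 \<in> \<Omega>" "0 < L"
    "\<And>u u'. \<lbrakk>u \<in> \<Omega>; u' \<in> \<Omega>\<rbrakk> \<Longrightarrow> infdist (q u - q u') E \<le> L * infdist (p u - p u') E"
    using assms(1) unfolding trans_lip_def by blast
  obtain \<Omega>' L' where 2: "openin T \<Omega>'" "u0 \<in> \<Omega>'" "0 < L'"
    "\<And>u u'. \<lbrakk>u \<in> \<Omega>'; u' \<in> \<Omega>'\<rbrakk> \<Longrightarrow> infdist (r u - r u') E \<le> L' * infdist (q u - q u') E"
    using assms(2) unfolding trans_lip_def by blast
  have "infdist (r u - r u') E \<le> (L' * L) * infdist (p u - p u') E"
    if "u \<in> \<Omega> \<inter> \<Omega>'" "u' \<in> \<Omega> \<inter> \<Omega>'" for u u'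
  proof -
    have "infdist (r u - r u') E \<le> L' * infdist (q u - q u') E" using 2(4) that by simp
    also have "\<dots> \<le> L' * (L * infdist (p u - p u') E)"
      using 1(4) that 2(3) by (intro mult_left_mono) simp_all
    finally show ?thesis by simp
  qed
  then show ?thesis
    unfolding trans_lip_def using 1 2
    by (intro exI[of _ "\<Omega> \<inter> \<Omega>'"] exI[of _ "L' * L"]) (simp add: openin_Int)
qed

text \<open>Moving points within plaques of a fixed chart leaves transverse distances unchanged, so
  the constant is \<open>1\<close>.\<close>

lemma trans_lip_same_plaques:
  assumes \<Omega>: "openin T \<Omega>" "u0 \<in> \<Omega>" and eq: "\<And>u. u \<in> \<Omega> \<Longrightarrow> q u - p u \<in> E"
  shows "trans_lip T p q u0"
proof -
  have "infdist (q u - q u') E \<le> 1 * infdist (p u - p u') E" if u: "u \<in> \<Omega>" "u' \<in> \<Omega>" for u u'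
  proof -
    have "(q u - p u) - (q u' - p u') \<in> E"
      by (rule subspace_diff[OF subspace_E eq[OF u(1)] eq[OF u(2)]])
    then have "infdist ((p u - p u') + ((q u - p u) - (q u' - p u'))) E = infdist (p u - p u') E"
      by (rule infdist_subspace_add[OF subspace_E])
    moreover have "(p u - p u') + ((q u - p u) - (q u' - p u')) = q u - q u'" by simp
    ultimately show ?thesis by simp
  qed
  then show ?thesis
    unfolding trans_lip_def using \<Omega> by (intro exI[of _ \<Omega>] exI[of _ 1]) simp
qed

end

context foliated_embedding
begin

text \<open>Quantifying over all charts at both ends makes the property independent of choices; a
  composition may then use any chart at the middle point.\<close>

definition transversely_lipschitz :: "'t topology \<Rightarrow> ('t \<Rightarrow> 'a) \<Rightarrow> ('t \<Rightarrow> 'a) \<Rightarrow> 't \<Rightarrow> bool" where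
  "transversely_lipschitz T p q u0 \<longleftrightarrow>
     (\<forall>U \<phi> V \<psi>. (U, \<phi>) \<in> \<A> \<and> (V, \<psi>) \<in> \<A> \<and> f (p u0) \<in> U \<and> f (q u0) \<in> V \<longrightarrow>
        trans_lip T (\<lambda>u. \<phi> (f (p u))) (\<lambda>u. \<psi> (f (q u))) u0)"

text \<open>The content lies in two different charts around the same point, where it is the
  Lipschitz estimate for coordinate changes.\<close>

lemma transversely_lipschitz_refl:
  assumes D: "openin T D" "u0 \<in> D" and p: "continuous_map (subtopology T D) M p"
  shows "transversely_lipschitz T p p u0"
  unfolding transversely_lipschitz_def
proof (intro allI impI, elim conjE)
  fix U \<phi> V \<psi> assume c: "(U, \<phi>) \<in> \<A>" "(V, \<psi>) \<in> \<A>" and u0: "f (p u0) \<in> U" "f (p u0) \<in> V"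
  obtain \<rho> L where \<rho>: "\<rho> > 0" "L > 0"
    and L: "\<forall>z z'. z \<in> U \<inter> V \<and> z' \<in> U \<inter> V \<and> \<phi> z \<in> ball (\<phi> (f (p u0))) \<rho> \<and>
      \<phi> z' \<in> ball (\<phi> (f (p u0))) \<rho> \<longrightarrow> infdist (\<psi> z - \<psi> z') E \<le> L * infdist (\<phi> z - \<phi> z') E"
    using transition_transverse_lipschitz[OF c u0] by (elim exE conjE) (rule that)
  define G where "G = {w \<in> U. \<phi> w \<in> ball (\<phi> (f (p u0))) \<rho>} \<inter> V"
  have "openin N G"
    unfolding G_def by (intro openin_Int openin_fol_chart_preimage[OF c(1)] fol_chart(1)[OF c(2)]) simp
  moreover have "continuous_map (subtopology T D) N (\<lambda>u. f (p u))"
    using continuous_map_compose[OF p continuous_f, unfolded comp_def] .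
  ultimately have "openin (subtopology T D) {u \<in> topspace (subtopology T D). f (p u) \<in> G}"
    by (rule openin_continuous_map_preimage[rotated])
  moreover have top: "topspace (subtopology T D) = D" using openin_subset[OF D(1)] by auto
  ultimately have "openin T {u \<in> D. f (p u) \<in> G}"
    unfolding openin_open_subtopology[OF D(1)] top by simp
  moreover have "u0 \<in> {u \<in> D. f (p u) \<in> G}" unfolding G_def using D(2) u0 \<rho>(1) by simp
  moreover have "infdist (\<psi> (f (p u)) - \<psi> (f (p u'))) E \<le> L * infdist (\<phi> (f (p u)) - \<phi> (f (p u'))) E"
    if "u \<in> {u \<in> D. f (p u) \<in> G}" "u' \<in> {u \<in> D. f (p u) \<in> G}" for u u'
    using L[rule_format, of "f (p u)" "f (p u')"] that unfolding G_def by simp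
  ultimately show "trans_lip T (\<lambda>u. \<phi> (f (p u))) (\<lambda>u. \<psi> (f (p u))) u0"
    unfolding trans_lip_def using \<rho>(2) by blast
qed

lemma transversely_lipschitz_trans:
  assumes "transversely_lipschitz T p q u0" "transversely_lipschitz T q r u0" and q: "q u0 \<in> topspace M"
  shows "transversely_lipschitz T p r u0"
  unfolding transversely_lipschitz_def
proof (intro allI impI, elim conjE)
  fix U \<phi> V \<psi> assume c: "(U, \<phi>) \<in> \<A>" "(V, \<psi>) \<in> \<A>" "f (p u0) \<in> U" "f (r u0) \<in> V"
  obtain W \<kappa> where W: "(W, \<kappa>) \<in> \<A>" "f (q u0) \<in> W"
    using fol_chart_exists[OF f_in_topspace[OF q]] .
  have "trans_lip T (\<lambda>u. \<phi> (f (p u))) (\<lambda>u. \<kappa> (f (q u))) u0"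
    using assms(1)[unfolded transversely_lipschitz_def, rule_format, of U \<phi> W \<kappa>] c W by simp
  moreover have "trans_lip T (\<lambda>u. \<kappa> (f (q u))) (\<lambda>u. \<psi> (f (r u))) u0"
    using assms(2)[unfolded transversely_lipschitz_def, rule_format, of W \<kappa> V \<psi>] c W by simp
  ultimately show "trans_lip T (\<lambda>u. \<phi> (f (p u))) (\<lambda>u. \<psi> (f (r u))) u0"
    by (rule trans_lip_trans)
qed

text \<open>Changes of chart at either end are covered by reflexivity, so a single common chart
  suffices.\<close>

lemma transversely_lipschitzI:
  assumes D: "openin T D" "u0 \<in> D"
    and p: "continuous_map (subtopology T D) M p" "continuous_map (subtopology T D) M q"
    and c: "(U, \<phi>) \<in> \<A>" "f (p u0) \<in> U" "f (q u0) \<in> U"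
    and lip: "trans_lip T (\<lambda>u. \<phi> (f (p u))) (\<lambda>u. \<phi> (f (q u))) u0"
  shows "transversely_lipschitz T p q u0"
  unfolding transversely_lipschitz_def
proof (intro allI impI, elim conjE)
  fix U' \<phi>' V \<psi> assume c': "(U', \<phi>') \<in> \<A>" "(V, \<psi>) \<in> \<A>" "f (p u0) \<in> U'" "f (q u0) \<in> V"
  have "trans_lip T (\<lambda>u. \<phi>' (f (p u))) (\<lambda>u. \<phi> (f (p u))) u0"
    "trans_lip T (\<lambda>u. \<phi> (f (q u))) (\<lambda>u. \<psi> (f (q u))) u0"
    using transversely_lipschitz_refl[OF D p(1)] transversely_lipschitz_refl[OF D p(2)] c c'
    unfolding transversely_lipschitz_def by simp_all
  note change = this
  show "trans_lip T (\<lambda>u. \<phi>' (f (p u))) (\<lambda>u. \<psi> (f (q u))) u0"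
    by (rule trans_lip_trans[OF change(1) trans_lip_trans[OF lip change(2)]])
qed

lemma transversely_lipschitz_cong:
  assumes D: "openin T D" "u0 \<in> D" and eq: "\<And>u. u \<in> D \<Longrightarrow> p u = p' u" "\<And>u. u \<in> D \<Longrightarrow> q u = q' u"
    and lip: "transversely_lipschitz T p q u0"
  shows "transversely_lipschitz T p' q' u0"
  unfolding transversely_lipschitz_def
proof (intro allI impI, elim conjE)
  fix U \<phi> V \<psi> assume c: "(U, \<phi>) \<in> \<A>" "(V, \<psi>) \<in> \<A>" "f (p' u0) \<in> U" "f (q' u0) \<in> V"
  have pq: "trans_lip T (\<lambda>u. \<phi> (f (p u))) (\<lambda>u. \<psi> (f (q u))) u0"
    using lip c D(2) eq unfolding transversely_lipschitz_def by simp
  have ends: "trans_lip T (\<lambda>u. \<phi> (f (p' u))) (\<lambda>u. \<phi> (f (p u))) u0"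
    "trans_lip T (\<lambda>u. \<psi> (f (q u))) (\<lambda>u. \<psi> (f (q' u))) u0"
    using eq subspace_0[OF subspace_E] by (intro trans_lip_same_plaques[OF D]; simp)+
  show "trans_lip T (\<lambda>u. \<phi> (f (p' u))) (\<lambda>u. \<psi> (f (q' u))) u0"
    by (rule trans_lip_trans[OF ends(1) trans_lip_trans[OF pq ends(2)]])
qed

text \<open>Along a homotopy the transverse coordinate in a foliation chart is locally constant.\<close>

lemma transversely_lipschitz_homotopy:
  fixes h :: "real \<Rightarrow> 't \<Rightarrow> 'a"
  assumes D: "openin T D" "u0 \<in> D"
    and h: "continuous_map (prod_topology (top_of_set {0..1}) (subtopology T D)) M (\<lambda>x. h (fst x) (snd x))"
  shows "transversely_lipschitz T (h 0) (h 1) u0 \<and> transversely_lipschitz T (h 1) (h 0) u0"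
proof -
  have top: "topspace (subtopology T D) = D" using openin_subset[OF D(1)] by auto
  have hs: "continuous_map (subtopology T D) M (h s)" if "s \<in> {0..1}" for s
  proof -
    have "continuous_map (subtopology T D) (prod_topology (top_of_set {0..1}) (subtopology T D)) (\<lambda>u. (s, u))"
      using that by (simp add: continuous_map_paired)
    from continuous_map_compose[OF this h] show ?thesis by (simp add: comp_def)
  qed
  have hM: "h s u \<in> topspace M" if "s \<in> {0..1}" "u \<in> D" for s u
    using continuous_map_image_subset_topspace[OF hs[OF that(1)]] that(2) unfolding top by blast
  let ?R = "\<lambda>s s'. transversely_lipschitz T (h s) (h s') u0 \<and> transversely_lipschitz T (h s') (h s) u0"
  have "connected {0..1::real}" by simp
  moreover have "(0::real) \<in> {0..1}" "(1::real) \<in> {0..1}" by simp_all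
  ultimately show ?thesis
  \<comment> \<open>Being Lipschitz in both directions is an equivalence relation between
    parameters; it remains to see that nearby parameters are equivalent.\<close>
  proof (rule connected_equivalence_relation[where R = ?R])
    show "?R s s'" if "?R s' s" for s s' using that by blast
    show "?R s s''" if "?R s s'" "?R s' s''" "s \<in> {0..1}" "s' \<in> {0..1}" "s'' \<in> {0..1}" for s s' s''
      using that(1,2) hM[OF that(4) D(2)] transversely_lipschitz_trans[of T "h s" "h s'" u0 "h s''"]
        transversely_lipschitz_trans[of T "h s''" "h s'" u0 "h s"] by simp
    fix s0 :: real assume s0: "s0 \<in> {0..1}"
    obtain U \<phi> where c: "(U, \<phi>) \<in> \<A>" "f (h s0 u0) \<in> U"
      using fol_chart_exists[OF f_in_topspace[OF hM[OF s0 D(2)]]] .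
    obtain Q where Q: "openin M Q" "h s0 u0 \<in> Q" "\<And>z. z \<in> Q \<Longrightarrow> f z \<in> U"
      "\<And>(I :: real set) \<gamma> s s'. \<lbrakk>connected I; continuous_map (top_of_set I) M \<gamma>; \<gamma> ` I \<subseteq> Q;
         s \<in> I; s' \<in> I\<rbrakk> \<Longrightarrow> \<phi> (f (\<gamma> s)) - \<phi> (f (\<gamma> s')) \<in> E"
      using curves_in_small_sets[OF hM[OF s0 D(2)] c] by metis
    have op: "openin (prod_topology (top_of_set {0..1}) (subtopology T D))
        {x \<in> topspace (prod_topology (top_of_set {0..1}) (subtopology T D)). h (fst x) (snd x) \<in> Q}"
      by (rule openin_continuous_map_preimage[OF h Q(1)])
    have mem: "(s0, u0) \<in> {x \<in> topspace (prod_topology (top_of_set {0..1}) (subtopology T D)).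
        h (fst x) (snd x) \<in> Q}"
      using s0 D Q(2) unfolding topspace_prod_topology top by simp
    obtain J \<Omega> where J: "openin (top_of_set {0..1}) J" "openin (subtopology T D) \<Omega>" "s0 \<in> J" "u0 \<in> \<Omega>"
      "J \<times> \<Omega> \<subseteq> {x \<in> topspace (prod_topology (top_of_set {0..1}) (subtopology T D)). h (fst x) (snd x) \<in> Q}"
      using op[unfolded openin_prod_topology_alt, rule_format, OF mem] by (elim exE conjE) (rule that)
    have \<Omega>: "openin T \<Omega>" "\<Omega> \<subseteq> D" using J(2) unfolding openin_open_subtopology[OF D(1)] by simp_all
    obtain \<delta> where \<delta>: "\<delta> > 0" "ball s0 \<delta> \<inter> {0..1} \<subseteq> J"
      using bspec[OF conjunct2[OF iffD1[OF openin_contains_ball J(1)]] J(3)]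
      by (elim exE conjE) (rule that)
    define I where "I = ball s0 \<delta> \<inter> {0..1::real}"
    have I: "connected I" "s0 \<in> I" "I \<subseteq> {0..1}"
      unfolding I_def using s0 \<delta>(1) by (auto intro!: convex_connected convex_Int)
    have hQ: "h s u \<in> Q" if "s \<in> I" "u \<in> \<Omega>" for s u
    proof -
      have "(s, u) \<in> J \<times> \<Omega>" using that \<delta>(2) unfolding I_def by auto
      from subsetD[OF J(5) this] show ?thesis by simp
    qed
    \<comment> \<open>For fixed \<open>u\<close> the curve with parameter \<open>s\<close> stays in
      \<open>Q\<close> on the interval \<open>I\<close>, uniformly in \<open>u\<close> by the
      product neighbourhood.\<close>
    have plaque: "\<phi> (f (h s u)) - \<phi> (f (h s' u)) \<in> E" if s: "s \<in> I" "s' \<in> I" and u: "u \<in> \<Omega>" for s s' u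
    proof (rule Q(4)[OF I(1) _ _ s])
      have "continuous_map (top_of_set I) (prod_topology (top_of_set {0..1}) (subtopology T D)) (\<lambda>s. (s, u))"
        using u \<Omega>(2) I(3) openin_subset[OF D(1)]
        by (auto simp: continuous_map_paired continuous_map_in_subtopology)
      from continuous_map_compose[OF this h] show "continuous_map (top_of_set I) M (\<lambda>s. h s u)"
        by (simp add: comp_def)
      show "(\<lambda>s. h s u) ` I \<subseteq> Q" using hQ[OF _ u] by blast
    qed
    have "?R s0 s" if s: "s \<in> I" for s
    proof
      have fU: "f (h s0 u0) \<in> U" "f (h s u0) \<in> U" using Q(3) hQ[OF _ J(4)] I(2) s by blast+
      have cont: "continuous_map (subtopology T D) M (h s0)" "continuous_map (subtopology T D) M (h s)"
        using hs s0 s I(3) by blast+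
      have lip: "trans_lip T (\<lambda>u. \<phi> (f (h s0 u))) (\<lambda>u. \<phi> (f (h s u))) u0"
        "trans_lip T (\<lambda>u. \<phi> (f (h s u))) (\<lambda>u. \<phi> (f (h s0 u))) u0"
        by (rule trans_lip_same_plaques[OF \<Omega>(1) J(4)], erule plaque[OF s I(2)],
          rule trans_lip_same_plaques[OF \<Omega>(1) J(4)], erule plaque[OF I(2) s])
      show "transversely_lipschitz T (h s0) (h s) u0"
        by (rule transversely_lipschitzI[OF D cont c(1) fU lip(1)])
      show "transversely_lipschitz T (h s) (h s0) u0"
        by (rule transversely_lipschitzI[OF D cont(2,1) c(1) fU(2,1) lip(2)])
    qed
    moreover have "openin (top_of_set {0..1}) I"
      unfolding I_def by (subst Int_commute) (rule openin_open_Int[OF open_ball])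
    ultimately show "\<exists>J. openin (top_of_set {0..1}) J \<and> s0 \<in> J \<and> (\<forall>s\<in>J. ?R s0 s)"
      using I(2) by blast
  qed
qed

text \<open>The straight line between the leaf coordinates of \<open>p u\<close> and
  \<open>p' u\<close>, with the transverse coordinate kept fixed, stays in the convex box and is a
  homotopy along plaques.\<close>

lemma transversely_lipschitz_plaque:
  fixes T :: "'t topology"
  assumes D: "openin T D" "u0 \<in> D" and y: "y \<in> topspace M"
    and p: "continuous_map (subtopology T D) M p" "continuous_map (subtopology T D) M p'"
    and w: "\<And>u. u \<in> D \<Longrightarrow> \<exists>w\<in>chart_trans (chart y). p u \<in> plaque M (chart y) w \<and> p' u \<in> plaque M (chart y) w"
  shows "transversely_lipschitz T p p' u0 \<and> transversely_lipschitz T p' p u0"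
proof -
  let ?B = "chart_ext (chart y)" and ?q = "chart_map (chart y)"
  let ?Y = "subtopology (mtopology_of X) (chart_trans (chart y))"
  let ?P = "prod_topology (top_of_set big_box) ?Y"
  let ?I = "prod_topology (top_of_set {0..1::real}) (subtopology T D)"
  have top: "topspace (subtopology T D) = D" using openin_subset[OF D(1)] by auto
  obtain k where k: "homeomorphic_maps (subtopology M ?B) ?P ?q k"
    using homeo_ext[OF y] unfolding homeomorphic_map_maps by blast
  have topB: "topspace (subtopology M ?B) = ?B" using ext_subset[OF y] by auto
  have kq: "k (?q z) = z" if "z \<in> ?B" for z
    using k that topB unfolding homeomorphic_maps_def by simp
  have qcont: "continuous_map (subtopology M ?B) ?P ?q" and kcont: "continuous_map ?P (subtopology M ?B) k"
    using k unfolding homeomorphic_maps_def by blast+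
  have pw: "p u \<in> ?B" "p' u \<in> ?B" "fst (?q (p u)) \<in> unit_box" "fst (?q (p' u)) \<in> unit_box"
    "snd (?q (p u)) = snd (?q (p' u))" if "u \<in> D" for u
    using w[OF that] unfolding plaque_eq[OF y] by auto
  have coord: "continuous_map ?I ?P (\<lambda>x. ?q (r (snd x)))"
    if "continuous_map (subtopology T D) M r" "\<And>u. u \<in> D \<Longrightarrow> r u \<in> ?B" for r
  proof -
    have "continuous_map (subtopology T D) (subtopology M ?B) r"
      using that by (intro continuous_map_into_subtopology) (auto simp: top)
    from continuous_map_compose[OF this qcont]
    have "continuous_map (subtopology T D) ?P (\<lambda>u. ?q (r u))" by (simp add: comp_def)
    from continuous_map_compose[OF continuous_map_snd this] show ?thesis by (simp add: comp_def)
  qed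
  have a: "continuous_map ?I euclidean (\<lambda>x. fst (?q (r (snd x))))"
    if "continuous_map (subtopology T D) M r" "\<And>u. u \<in> D \<Longrightarrow> r u \<in> ?B" for r
  proof -
    have "continuous_map ?I (top_of_set big_box) (\<lambda>x. fst (?q (r (snd x))))"
      using continuous_map_compose[OF coord continuous_map_fst] that by (simp add: comp_def)
    then show ?thesis by (rule continuous_map_into_fulltopology)
  qed
  define \<xi> where "\<xi> x = (1 - fst x) *\<^sub>R fst (?q (p (snd x))) + fst x *\<^sub>R fst (?q (p' (snd x)))"
    for x :: "real \<times> 't"
  have "continuous_map ?I euclidean fst"
    using continuous_map_fst by (rule continuous_map_into_fulltopology)
  then have "continuous_map ?I euclidean \<xi>"
    unfolding \<xi>_def using a[OF p(1)] a[OF p(2)] pw(1,2)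
    by (intro continuous_map_add continuous_map_scaleR continuous_map_diff) simp_all
  moreover have \<xi>box: "\<xi> x \<in> unit_box" if "x \<in> topspace ?I" for x
  proof -
    have "snd x \<in> D" "0 \<le> fst x" "fst x \<le> 1"
      using that unfolding topspace_prod_topology top by (auto simp: mem_Times_iff)
    then show ?thesis
      unfolding \<xi>_def using pw(3,4)[of "snd x"] by (intro convexD[OF convex_box(2)]) simp_all
  qed
  ultimately have "continuous_map ?I (top_of_set big_box) \<xi>"
    using box_subset_cbox[of "- One :: 'e" One] cbox_subset_big_box
    by (intro continuous_map_into_subtopology) blast+
  moreover have "continuous_map ?I ?Y (\<lambda>x. snd (?q (p (snd x))))"
    using continuous_map_compose[OF coord[OF p(1)] continuous_map_snd, unfolded comp_def] pw(1) by blast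
  ultimately have "continuous_map ?I ?P (\<lambda>x. (\<xi> x, snd (?q (p (snd x)))))"
    by (simp add: continuous_map_paired)
  from continuous_map_compose[OF this kcont]
  have "continuous_map ?I M (\<lambda>x. k (\<xi> x, snd (?q (p (snd x)))))"
    using continuous_map_into_fulltopology by (simp add: comp_def) blast
  then have "continuous_map ?I M (\<lambda>x. (\<lambda>s u. k (\<xi> (s, u), snd (?q (p u)))) (fst x) (snd x))"
    by simp
  from transversely_lipschitz_homotopy[OF D this]
  have lip: "transversely_lipschitz T (\<lambda>u. k (\<xi> (0, u), snd (?q (p u)))) (\<lambda>u. k (\<xi> (1, u), snd (?q (p u)))) u0"
    "transversely_lipschitz T (\<lambda>u. k (\<xi> (1, u), snd (?q (p u)))) (\<lambda>u. k (\<xi> (0, u), snd (?q (p u)))) u0"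
    by blast+
  have e0: "k (\<xi> (0, u), snd (?q (p u))) = p u" if "u \<in> D" for u
    unfolding \<xi>_def using kq[OF pw(1)[OF that]] by simp
  have e1: "k (\<xi> (1, u), snd (?q (p u))) = p' u" if "u \<in> D" for u
    unfolding \<xi>_def pw(5)[OF that] using kq[OF pw(2)[OF that]] by simp
  show ?thesis
    using transversely_lipschitz_cong[OF D e0 e1 lip(1)] transversely_lipschitz_cong[OF D e1 e0 lip(2)] by simp
qed

section \<open>Bi-Lipschitz estimates for the holonomy pseudogroup\<close>

abbreviation transverse_dist :: "('b \<Rightarrow> 'm) \<Rightarrow> 'a \<Rightarrow> 'a \<Rightarrow> real" where
  "transverse_dist \<phi> z z' \<equiv> infdist (\<phi> (f z) - \<phi> (f z')) E"

abbreviation bilipschitz_near ::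
    "('t \<Rightarrow> 'a) \<Rightarrow> ('t \<times> 't) set \<Rightarrow> ('b \<Rightarrow> 'm) \<Rightarrow> ('b \<Rightarrow> 'm) \<Rightarrow> 't set \<Rightarrow> real \<Rightarrow> bool" where
  "bilipschitz_near \<tau> r \<phi> \<psi> \<Omega> L \<equiv>
     \<forall>u v u' v'. (u, v) \<in> r \<and> (u', v') \<in> r \<and> u \<in> \<Omega> \<and> u' \<in> \<Omega> \<longrightarrow>
       transverse_dist \<psi> (\<tau> v) (\<tau> v') \<le> L * transverse_dist \<phi> (\<tau> u) (\<tau> u') \<and>
       transverse_dist \<phi> (\<tau> u) (\<tau> u') \<le> L * transverse_dist \<psi> (\<tau> v) (\<tau> v')"

text \<open>Stated for relations and in both directions, so that it is stable under converse and
  composition, as induction over the pseudogroup requires.\<close>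

definition transversely_bilipschitz :: "'t topology \<Rightarrow> ('t \<Rightarrow> 'a) \<Rightarrow> ('t \<times> 't) set \<Rightarrow> bool" where
  "transversely_bilipschitz T \<tau> r \<longleftrightarrow> (\<forall>u0 v0 U \<phi> V \<psi>.
     (u0, v0) \<in> r \<and> (U, \<phi>) \<in> \<A> \<and> (V, \<psi>) \<in> \<A> \<and> f (\<tau> u0) \<in> U \<and> f (\<tau> v0) \<in> V \<longrightarrow>
     (\<exists>\<Omega> L. openin T \<Omega> \<and> u0 \<in> \<Omega> \<and> 0 < L \<and> bilipschitz_near \<tau> r \<phi> \<psi> \<Omega> L))"

lemma transversely_bilipschitzD:
  assumes "transversely_bilipschitz T \<tau> r" "(u0, v0) \<in> r" "(U, \<phi>) \<in> \<A>" "(V, \<psi>) \<in> \<A>"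
    "f (\<tau> u0) \<in> U" "f (\<tau> v0) \<in> V"
  obtains \<Omega> L where "openin T \<Omega>" "u0 \<in> \<Omega>" "0 < L" "bilipschitz_near \<tau> r \<phi> \<psi> \<Omega> L"
  using assms(1)[unfolded transversely_bilipschitz_def, rule_format, of u0 v0 U \<phi> V \<psi>] assms(2-6)
  by (elim meta_impE exE conjE) (simp, rule that)

lemma transversely_bilipschitzI:
  assumes "\<And>u0 v0 U \<phi> V \<psi>. \<lbrakk>(u0, v0) \<in> r; (U, \<phi>) \<in> \<A>; (V, \<psi>) \<in> \<A>; f (\<tau> u0) \<in> U; f (\<tau> v0) \<in> V\<rbrakk>
    \<Longrightarrow> \<exists>\<Omega> L. openin T \<Omega> \<and> u0 \<in> \<Omega> \<and> 0 < L \<and> bilipschitz_near \<tau> r \<phi> \<psi> \<Omega> L"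
  shows "transversely_bilipschitz T \<tau> r"
  unfolding transversely_bilipschitz_def by (intro allI impI, elim conjE) (rule assms)

lemma transversely_bilipschitz_if_lipschitz:
  assumes "\<And>u0 v0. (u0, v0) \<in> r \<Longrightarrow> \<exists>D p q. openin T D \<and> u0 \<in> D \<and>
    transversely_lipschitz T p q u0 \<and> transversely_lipschitz T q p u0 \<and>
    (\<forall>u v. (u, v) \<in> r \<and> u \<in> D \<longrightarrow> p u = \<tau> u \<and> q u = \<tau> v)"
  shows "transversely_bilipschitz T \<tau> r"
proof (rule transversely_bilipschitzI)
  fix u0 v0 U \<phi> V \<psi>
  assume r0: "(u0, v0) \<in> r" and c: "(U, \<phi>) \<in> \<A>" "(V, \<psi>) \<in> \<A>" "f (\<tau> u0) \<in> U" "f (\<tau> v0) \<in> V"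
  obtain D p q where D: "openin T D" "u0 \<in> D" and lip: "transversely_lipschitz T p q u0"
    "transversely_lipschitz T q p u0" and
    eq: "\<And>u v. \<lbrakk>(u, v) \<in> r; u \<in> D\<rbrakk> \<Longrightarrow> p u = \<tau> u \<and> q u = \<tau> v"
    using assms[OF r0] by blast
  have "f (p u0) \<in> U" "f (q u0) \<in> V" using c eq[OF r0 D(2)] by simp_all
  then have tl: "trans_lip T (\<lambda>u. \<phi> (f (p u))) (\<lambda>u. \<psi> (f (q u))) u0"
    "trans_lip T (\<lambda>u. \<psi> (f (q u))) (\<lambda>u. \<phi> (f (p u))) u0"
    using lip c unfolding transversely_lipschitz_def by simp_all
  obtain \<Omega> L where 1: "openin T \<Omega>" "u0 \<in> \<Omega>" "0 < L" "\<forall>u\<in>\<Omega>. \<forall>u'\<in>\<Omega>.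
      transverse_dist \<psi> (q u) (q u') \<le> L * transverse_dist \<phi> (p u) (p u')"
    using tl(1) unfolding trans_lip_def by blast
  obtain \<Omega>' L' where 2: "openin T \<Omega>'" "u0 \<in> \<Omega>'" "0 < L'" "\<forall>u\<in>\<Omega>'. \<forall>u'\<in>\<Omega>'.
      transverse_dist \<phi> (p u) (p u') \<le> L' * transverse_dist \<psi> (q u) (q u')"
    using tl(2) unfolding trans_lip_def by blast
  show "\<exists>\<Omega> L. openin T \<Omega> \<and> u0 \<in> \<Omega> \<and> 0 < L \<and> bilipschitz_near \<tau> r \<phi> \<psi> \<Omega> L"
  proof (intro exI conjI allI impI)
    show "openin T (D \<inter> (\<Omega> \<inter> \<Omega>'))" using D 1 2 by (intro openin_Int)
    show "u0 \<in> D \<inter> (\<Omega> \<inter> \<Omega>')" "0 < max L L'" using D 1 2 by simp_all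
    fix u v u' v' assume u: "(u, v) \<in> r \<and> (u', v') \<in> r \<and> u \<in> D \<inter> (\<Omega> \<inter> \<Omega>') \<and> u' \<in> D \<inter> (\<Omega> \<inter> \<Omega>')"
    then have e: "p u = \<tau> u" "q u = \<tau> v" "p u' = \<tau> u'" "q u' = \<tau> v'" using eq by blast+
    have le: "a * infdist x E \<le> max a b * infdist x E" "b * infdist x E \<le> max a b * infdist x E"
      for a b :: real and x :: 'm
      by (simp_all add: mult_right_mono infdist_nonneg)
    have "transverse_dist \<psi> (q u) (q u') \<le> L * transverse_dist \<phi> (p u) (p u')"
      using 1(4) u by blast
    then show "transverse_dist \<psi> (\<tau> v) (\<tau> v') \<le> max L L' * transverse_dist \<phi> (\<tau> u) (\<tau> u')"
      unfolding e using le(1) by (rule order_trans)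
    have "transverse_dist \<phi> (p u) (p u') \<le> L' * transverse_dist \<psi> (q u) (q u')"
      using 2(4) u by blast
    then show "transverse_dist \<phi> (\<tau> u) (\<tau> u') \<le> max L L' * transverse_dist \<psi> (\<tau> v) (\<tau> v')"
      unfolding e using le(2) by (rule order_trans)
  qed
qed

lemma openin_Domain: "partial_homeo T r \<Longrightarrow> openin T (Domain r)"
proof -
  assume r: "partial_homeo T r"
  then have "openin T (r\<inverse> `` topspace T)" and sub: "r \<subseteq> topspace T \<times> topspace T"
    unfolding partial_homeo_iff by auto
  moreover have "r\<inverse> `` topspace T = Domain r" using sub by auto
  ultimately show ?thesis by simp
qed

text \<open>Each link of the chain of charts moves points within plaques, continuously in
  \<open>u\<close>, so the estimates for the links compose.\<close>

lemma holonomy_transversely_bilipschitz: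
  assumes "holonomy_transformation M chart T \<tau> r"
  shows "transversely_bilipschitz T \<tau> r"
proof (rule transversely_bilipschitz_if_lipschitz)
  fix u0 v0 assume r0: "(u0, v0) \<in> r"
  obtain m y p where mp: "\<forall>i\<le>m::nat. y i \<in> topspace M"
    "\<forall>i\<le>Suc m. continuous_map (subtopology T (Domain r)) M (p i)"
    "\<forall>(u, v)\<in>r. p 0 u = \<tau> u \<and> p (Suc m) u = \<tau> v"
    "\<forall>i\<le>m. \<forall>u\<in>Domain r. \<exists>w\<in>chart_trans (chart (y i)).
       p i u \<in> plaque M (chart (y i)) w \<and> p (Suc i) u \<in> plaque M (chart (y i)) w"
    using assms unfolding holonomy_transformation_def by (elim exE conjE) (rule that)
  have D: "openin T (Domain r)" "u0 \<in> Domain r"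
    using assms r0 openin_Domain unfolding holonomy_transformation_def by auto
  have step: "transversely_lipschitz T (p i) (p (Suc i)) u0 \<and> transversely_lipschitz T (p (Suc i)) (p i) u0"
    if "i \<le> m" for i
    using mp that by (intro transversely_lipschitz_plaque[OF D, of "y i"]) simp_all
  have pM: "p i u0 \<in> topspace M" if "i \<le> Suc m" for i
    using continuous_map_image_subset_topspace[OF mp(2)[rule_format, OF that]] D openin_subset[OF D(1)]
    by auto
  have "i \<le> m \<Longrightarrow>
    transversely_lipschitz T (p 0) (p (Suc i)) u0 \<and> transversely_lipschitz T (p (Suc i)) (p 0) u0" for i
  proof (induction i)
    case 0
    then show ?case by (rule step)
  next
    case (Suc i)
    then have "transversely_lipschitz T (p 0) (p (Suc i)) u0" "transversely_lipschitz T (p (Suc i)) (p 0) u0"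
      by simp_all
    then show ?case
      using step[OF Suc.prems] pM[of "Suc i"] Suc.prems
        transversely_lipschitz_trans[of T "p 0" "p (Suc i)" u0 "p (Suc (Suc i))"]
        transversely_lipschitz_trans[of T "p (Suc (Suc i))" "p (Suc i)" u0 "p 0"] by simp
  qed
  from this[of m] have "transversely_lipschitz T (p 0) (p (Suc m)) u0"
    "transversely_lipschitz T (p (Suc m)) (p 0) u0"
    by simp_all
  then show "\<exists>D p q. openin T D \<and> u0 \<in> D \<and>
    transversely_lipschitz T p q u0 \<and> transversely_lipschitz T q p u0 \<and>
    (\<forall>u v. (u, v) \<in> r \<and> u \<in> D \<longrightarrow> p u = \<tau> u \<and> q u = \<tau> v)"
    using D mp(3) by (intro exI[of _ "Domain r"] exI[of _ "p 0"] exI[of _ "p (Suc m)"]) auto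
qed

text \<open>Inversion is covered by the symmetry of the estimate, composition by multiplying
  constants, restriction and patching by its local nature.\<close>

lemma holonomy_pseudogroup_transversely_bilipschitz:
  assumes \<tau>: "continuous_map T M \<tau>" and r: "r \<in> holonomy_pseudogroup M chart T \<tau>"
  shows "transversely_bilipschitz T \<tau> r"
proof -
  have \<tau>M: "\<tau> t \<in> topspace M" if "t \<in> topspace T" for t
    using continuous_map_image_subset_topspace[OF \<tau>] that by blast
  show ?thesis
    using r unfolding holonomy_pseudogroup_def
  proof (rule generated_pseudogroup_induct)
    fix r assume "r \<in> {r. holonomy_transformation M chart T \<tau> r}"
    then show "partial_homeo T r \<and> transversely_bilipschitz T \<tau> r"
      using holonomy_transversely_bilipschitz unfolding holonomy_transformation_def by simp
  next
    show "transversely_bilipschitz T \<tau> (Id_on (topspace T))"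
    proof (rule transversely_bilipschitz_if_lipschitz)
      fix u0 v0 assume "(u0, v0) \<in> Id_on (topspace T)"
      then have u0: "u0 \<in> topspace T" by auto
      have "transversely_lipschitz T \<tau> \<tau> u0"
        using \<tau> by (intro transversely_lipschitz_refl[OF openin_topspace u0]) simp
      then show "\<exists>D p q. openin T D \<and> u0 \<in> D \<and>
          transversely_lipschitz T p q u0 \<and> transversely_lipschitz T q p u0 \<and>
          (\<forall>u v. (u, v) \<in> Id_on (topspace T) \<and> u \<in> D \<longrightarrow> p u = \<tau> u \<and> q u = \<tau> v)"
        using u0 by (intro exI[of _ "topspace T"] exI[of _ \<tau>]) auto
    qed
  next
    fix r assume r: "partial_homeo T r" "transversely_bilipschitz T \<tau> r"
    show "transversely_bilipschitz T \<tau> (r\<inverse>)"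
    proof (rule transversely_bilipschitzI)
      fix v0 u0 V \<psi> U \<phi>
      assume "(v0, u0) \<in> r\<inverse>" and c: "(V, \<psi>) \<in> \<A>" "(U, \<phi>) \<in> \<A>" "f (\<tau> v0) \<in> V" "f (\<tau> u0) \<in> U"
      then have r0: "(u0, v0) \<in> r" by simp
      obtain \<Omega> L where \<Omega>: "openin T \<Omega>" "u0 \<in> \<Omega>" "0 < L" "bilipschitz_near \<tau> r \<phi> \<psi> \<Omega> L"
        by (rule transversely_bilipschitzD[OF r(2) r0 c(2,1,4,3)])
      have op: "openin T (r `` \<Omega>)" and sv: "single_valued (r\<inverse>)"
        using r(1) \<Omega>(1) unfolding partial_homeo_iff by auto
      \<comment> \<open>Injectivity of \<open>r\<close>: only points of \<Omega> are mapped into the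
        image of \<Omega>.\<close>
      have pre: "u \<in> \<Omega>" if "(u, v) \<in> r" "v \<in> r `` \<Omega>" for u v
        using that sv unfolding single_valued_def by blast
      have "bilipschitz_near \<tau> (r\<inverse>) \<psi> \<phi> (r `` \<Omega>) L"
      proof (intro allI impI)
        fix v u v' u' assume a: "(v, u) \<in> r\<inverse> \<and> (v', u') \<in> r\<inverse> \<and> v \<in> r `` \<Omega> \<and> v' \<in> r `` \<Omega>"
        then have "u \<in> \<Omega>" "u' \<in> \<Omega>"
          using pre[of u v] pre[of u' v'] by simp_all
        then show "transverse_dist \<phi> (\<tau> u) (\<tau> u') \<le> L * transverse_dist \<psi> (\<tau> v) (\<tau> v') \<and>
            transverse_dist \<psi> (\<tau> v) (\<tau> v') \<le> L * transverse_dist \<phi> (\<tau> u) (\<tau> u')"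
          using \<Omega>(4)[rule_format, of u v u' v'] a by simp
      qed
      moreover have "v0 \<in> r `` \<Omega>" using r0 \<Omega>(2) by blast
      ultimately show "\<exists>\<Omega> L. openin T \<Omega> \<and> v0 \<in> \<Omega> \<and> 0 < L \<and> bilipschitz_near \<tau> (r\<inverse>) \<psi> \<phi> \<Omega> L"
        using op \<Omega>(3) by (intro exI[of _ "r `` \<Omega>"] exI[of _ L] conjI)
    qed
  next
    fix r s assume r: "partial_homeo T r" "partial_homeo T s"
      and P: "transversely_bilipschitz T \<tau> r" "transversely_bilipschitz T \<tau> s"
    show "transversely_bilipschitz T \<tau> (r O s)"
    proof (rule transversely_bilipschitzI)
      fix u0 w0 U \<phi> V \<psi>
      assume "(u0, w0) \<in> r O s" and c: "(U, \<phi>) \<in> \<A>" "(V, \<psi>) \<in> \<A>" "f (\<tau> u0) \<in> U" "f (\<tau> w0) \<in> V"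
      then obtain v0 where v0: "(u0, v0) \<in> r" "(v0, w0) \<in> s" by blast
      then have "v0 \<in> topspace T" using r(1) unfolding partial_homeo_iff by blast
      then obtain W \<kappa> where W: "(W, \<kappa>) \<in> \<A>" "f (\<tau> v0) \<in> W"
        using fol_chart_exists[OF f_in_topspace[OF \<tau>M]] by metis
      obtain \<Omega> L where 1: "openin T \<Omega>" "u0 \<in> \<Omega>" "0 < L" "bilipschitz_near \<tau> r \<phi> \<kappa> \<Omega> L"
        by (rule transversely_bilipschitzD[OF P(1) v0(1) c(1) W(1) c(3) W(2)])
      obtain \<Omega>' L' where 2: "openin T \<Omega>'" "v0 \<in> \<Omega>'" "0 < L'" "bilipschitz_near \<tau> s \<kappa> \<psi> \<Omega>' L'"
        by (rule transversely_bilipschitzD[OF P(2) v0(2) W(1) c(2) W(2) c(4)])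
      have op: "openin T (r\<inverse> `` \<Omega>')" and sv: "single_valued r"
        using r(1) 2(1) unfolding partial_homeo_iff by auto
      show "\<exists>\<Omega> L. openin T \<Omega> \<and> u0 \<in> \<Omega> \<and> 0 < L \<and> bilipschitz_near \<tau> (r O s) \<phi> \<psi> \<Omega> L"
      proof (intro exI[of _ "\<Omega> \<inter> r\<inverse> `` \<Omega>'"] exI[of _ "L * L'"] conjI allI impI)
        show "openin T (\<Omega> \<inter> r\<inverse> `` \<Omega>')" by (rule openin_Int[OF 1(1) op])
        show "u0 \<in> \<Omega> \<inter> r\<inverse> `` \<Omega>'" using 1(2) 2(2) v0(1) by blast
        show "0 < L * L'" using 1(3) 2(3) by simp
        fix u w u' w'
        assume a: "(u, w) \<in> r O s \<and> (u', w') \<in> r O s \<and> u \<in> \<Omega> \<inter> r\<inverse> `` \<Omega>' \<and> u' \<in> \<Omega> \<inter> r\<inverse> `` \<Omega>'"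
        then obtain v v' where v: "(u, v) \<in> r" "(v, w) \<in> s" "(u', v') \<in> r" "(v', w') \<in> s" by blast
        have v\<Omega>: "v \<in> \<Omega>'" "v' \<in> \<Omega>'" using a v sv unfolding single_valued_def by blast+
        note l1 = 1(4)[rule_format, of u v u' v'] and l2 = 2(4)[rule_format, of v w v' w']
        have "transverse_dist \<psi> (\<tau> w) (\<tau> w') \<le> L' * transverse_dist \<kappa> (\<tau> v) (\<tau> v')"
          using l2 v v\<Omega> by simp
        also have "\<dots> \<le> L' * (L * transverse_dist \<phi> (\<tau> u) (\<tau> u'))"
          using l1 a v 2(3) by (intro mult_left_mono) simp_all
        finally show "transverse_dist \<psi> (\<tau> w) (\<tau> w') \<le> L * L' * transverse_dist \<phi> (\<tau> u) (\<tau> u')"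
          by (simp add: mult_ac)
        have "transverse_dist \<phi> (\<tau> u) (\<tau> u') \<le> L * transverse_dist \<kappa> (\<tau> v) (\<tau> v')"
          using l1 a v by simp
        also have "\<dots> \<le> L * (L' * transverse_dist \<psi> (\<tau> w) (\<tau> w'))"
          using l2 v v\<Omega> 1(3) by (intro mult_left_mono) simp_all
        finally show "transverse_dist \<phi> (\<tau> u) (\<tau> u') \<le> L * L' * transverse_dist \<psi> (\<tau> w) (\<tau> w')"
          by (simp add: mult_ac)
      qed
    qed
  next
    fix r G assume P: "transversely_bilipschitz T \<tau> r"
    show "transversely_bilipschitz T \<tau> (Id_on G O r)"
    proof (rule transversely_bilipschitzI)
      fix u0 v0 U \<phi> V \<psi>
      assume a: "(u0, v0) \<in> Id_on G O r" "(U, \<phi>) \<in> \<A>" "(V, \<psi>) \<in> \<A>" "f (\<tau> u0) \<in> U" "f (\<tau> v0) \<in> V"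
      then have "(u0, v0) \<in> r" by auto
      then obtain \<Omega> L where 1: "openin T \<Omega>" "u0 \<in> \<Omega>" "0 < L" "bilipschitz_near \<tau> r \<phi> \<psi> \<Omega> L"
        using transversely_bilipschitzD[OF P _ a(2-5)] by metis
      then show "\<exists>\<Omega> L. openin T \<Omega> \<and> u0 \<in> \<Omega> \<and> 0 < L \<and> bilipschitz_near \<tau> (Id_on G O r) \<phi> \<psi> \<Omega> L"
        by (intro exI[of _ \<Omega>] exI[of _ L]) auto
    qed
  next
    fix r assume local: "\<And>u. u \<in> Domain r \<Longrightarrow>
      \<exists>G. openin T G \<and> u \<in> G \<and> transversely_bilipschitz T \<tau> (Id_on G O r)"
    show "transversely_bilipschitz T \<tau> r"
    proof (rule transversely_bilipschitzI)
      fix u0 v0 U \<phi> V \<psi>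
      assume a: "(u0, v0) \<in> r" "(U, \<phi>) \<in> \<A>" "(V, \<psi>) \<in> \<A>" "f (\<tau> u0) \<in> U" "f (\<tau> v0) \<in> V"
      obtain G where G: "openin T G" "u0 \<in> G" "transversely_bilipschitz T \<tau> (Id_on G O r)"
        using local[OF DomainI[OF a(1)]] by blast
      then have "(u0, v0) \<in> Id_on G O r" using a(1) by auto
      then obtain \<Omega> L where 1: "openin T \<Omega>" "u0 \<in> \<Omega>" "0 < L" "bilipschitz_near \<tau> (Id_on G O r) \<phi> \<psi> \<Omega> L"
        using transversely_bilipschitzD[OF G(3) _ a(2-5)] by metis
      have "(u, v) \<in> Id_on G O r" if "(u, v) \<in> r" "u \<in> \<Omega> \<inter> G" for u v using that by auto
      then show "\<exists>\<Omega> L. openin T \<Omega> \<and> u0 \<in> \<Omega> \<and> 0 < L \<and> bilipschitz_near \<tau> r \<phi> \<psi> \<Omega> L"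
        using 1 G(1,2) by (intro exI[of _ "\<Omega> \<inter> G"] exI[of _ L] conjI openin_Int allI impI) simp_all
    qed
  qed
qed

text \<open>Points in a common small plaque of the foliation have the same transverse coordinate in
  \<open>M\<close>, and this coordinate is injective on the transversal near
  \<open>t\<close>.\<close>

lemma transversal_separated:
  assumes ct: "complete_transversal M X chart T \<tau>" and \<tau>: "continuous_map T M \<tau>"
    and t: "t \<in> topspace T" and c: "(U, \<phi>) \<in> \<A>" "f (\<tau> t) \<in> U"
  obtains \<Omega> where "openin T \<Omega>" "t \<in> \<Omega>"
    "\<And>u u'. \<lbrakk>u \<in> \<Omega>; u' \<in> \<Omega>; \<phi> (f (\<tau> u)) - \<phi> (f (\<tau> u')) \<in> E\<rbrakk> \<Longrightarrow> u = u'"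
proof -
  obtain y W V where y: "y \<in> topspace M" and W: "openin T W" "t \<in> W"
    "\<tau> ` W \<subseteq> (\<Union>w\<in>chart_trans (chart y). plaque M (chart y) w)"
    and hom: "homeomorphic_map (subtopology T W) (subtopology (mtopology_of X) V)
          (\<lambda>u. snd (chart_map (chart y) (\<tau> u)))"
    using ct t unfolding complete_transversal_def by blast
  have inj: "inj_on (\<lambda>u. snd (chart_map (chart y) (\<tau> u))) W"
    using homeomorphic_imp_injective_map[OF hom] openin_subset[OF W(1)] by (simp add: Int_absorb1)
  have "\<tau> t \<in> (\<Union>w\<in>chart_trans (chart y). plaque M (chart y) w)" using W(2,3) by blast
  then have ext: "\<tau> t \<in> chart_ext (chart y)" unfolding plaque_eq[OF y] by blast
  have tM: "\<tau> t \<in> topspace M"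
    using continuous_map_image_subset_topspace[OF \<tau>] t by blast
  obtain Q where Q: "openin M Q" "\<tau> t \<in> Q"
    "\<forall>z\<in>Q. \<forall>z'\<in>Q. \<phi> (f z) - \<phi> (f z') \<in> E \<longrightarrow>
       snd (chart_map (chart y) z) = snd (chart_map (chart y) z')"
    using local_product[OF tM c y ext] by (elim exE conjE) (rule that)
  define \<Omega> where "\<Omega> = W \<inter> {u \<in> topspace T. \<tau> u \<in> Q}"
  have "openin T \<Omega>"
    unfolding \<Omega>_def by (intro openin_Int W(1) openin_continuous_map_preimage[OF \<tau> Q(1)])
  moreover have "t \<in> \<Omega>" unfolding \<Omega>_def using W(2) t Q(2) by simp
  moreover have "u = u'" if u: "u \<in> \<Omega>" "u' \<in> \<Omega>" "\<phi> (f (\<tau> u)) - \<phi> (f (\<tau> u')) \<in> E" for u u'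
  proof -
    have "snd (chart_map (chart y) (\<tau> u)) = snd (chart_map (chart y) (\<tau> u'))"
      using Q(3) u unfolding \<Omega>_def by simp
    then show ?thesis using inj_onD[OF inj] u(1,2) unfolding \<Omega>_def by blast
  qed
  ultimately show ?thesis by (rule that)
qed

end

section \<open>The counting argument\<close>

text \<open>Rounding to a fine cubical grid is injective on a separated set, and only boundedly many
  grid cells are available.\<close>

lemma card_separated_le:
  fixes c :: "'t \<Rightarrow> 'm::euclidean_space"
  assumes A: "finite A" and C: "\<And>t. t \<in> A \<Longrightarrow> norm (c t) \<le> C"
    and \<delta>: "0 < \<delta>" and sep: "\<And>t t'. \<lbrakk>t \<in> A; t' \<in> A; t \<noteq> t'\<rbrakk> \<Longrightarrow> \<delta> \<le> norm (c t - c t')"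
    and C0: "0 \<le> C"
  shows "real (card A) \<le> (4 * real DIM('m) * C / \<delta> + 3) ^ DIM('m)"
proof -
  define D where "D = real DIM('m)"
  have D: "0 < D" unfolding D_def by simp
  \<comment> \<open>The mesh \<open>1 / s\<close> is \<open>\<delta> / (2 * D)\<close>: points of
    one cell differ by at most \<open>\<delta> / 2\<close> in the sum of coordinate
    differences.\<close>
  define s where "s = 2 * D / \<delta>"
  have s: "0 < s" unfolding s_def using D \<delta> by simp
  define K where "K = \<lceil>C * s\<rceil>"
  have K0: "0 \<le> K" unfolding K_def using mult_nonneg_nonneg[OF C0 less_imp_le[OF s]] by simp
  define g where "g t = (\<lambda>b\<in>Basis. \<lfloor>(c t \<bullet> b) * s\<rfloor>)" for t
  have "inj_on g A"
  proof (rule inj_onI)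
    fix t t' assume t: "t \<in> A" "t' \<in> A" and eq: "g t = g t'"
    have small: "\<bar>(c t - c t') \<bullet> b\<bar> \<le> \<delta> / (2 * D)" if b: "b \<in> Basis" for b
    proof -
      have "\<lfloor>(c t \<bullet> b) * s\<rfloor> = \<lfloor>(c t' \<bullet> b) * s\<rfloor>"
        using fun_cong[OF eq, of b] b by (simp add: g_def)
      then have "\<bar>(c t \<bullet> b) * s - (c t' \<bullet> b) * s\<bar> \<le> 1" by linarith
      then have "\<bar>(c t - c t') \<bullet> b\<bar> * s \<le> 1"
        using s by (simp add: inner_diff_left left_diff_distrib[symmetric] abs_mult)
      then show ?thesis using s D \<delta> by (simp add: s_def field_simps)
    qed
    have "norm (c t - c t') \<le> (\<Sum>b\<in>Basis. \<bar>(c t - c t') \<bullet> b\<bar>)" by (rule norm_le_l1)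
    also have "\<dots> \<le> (\<Sum>b\<in>(Basis :: 'm set). \<delta> / (2 * D))" by (rule sum_mono) (rule small)
    also have "\<dots> = \<delta> / 2" using D by (simp add: D_def)
    finally have "norm (c t - c t') < \<delta>" using \<delta> by simp
    then show "t = t'" using sep[OF t] by force
  qed
  moreover have "g ` A \<subseteq> (\<Pi>\<^sub>E b\<in>Basis. {-K..K})"
  proof
    fix x assume "x \<in> g ` A"
    then obtain t where t: "t \<in> A" "x = g t" by blast
    have "\<lfloor>(c t \<bullet> b) * s\<rfloor> \<in> {-K..K}" if b: "b \<in> Basis" for b
    proof -
      have "\<bar>c t \<bullet> b\<bar> \<le> C" using Basis_le_norm[OF b, of "c t"] C[OF t(1)] by simp
      then have "\<bar>(c t \<bullet> b) * s\<bar> \<le> C * s" using s by (simp add: abs_mult)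
      then have "(c t \<bullet> b) * s \<le> of_int K" "- of_int K \<le> (c t \<bullet> b) * s"
        unfolding K_def by linarith+
      then show ?thesis by (simp add: le_floor_iff floor_le_iff)
    qed
    then show "x \<in> (\<Pi>\<^sub>E b\<in>Basis. {-K..K})" unfolding t(2) g_def by auto
  qed
  ultimately have "card A \<le> card (\<Pi>\<^sub>E b\<in>(Basis :: 'm set). {-K..K})"
    by (intro card_inj_on_le) (auto intro!: finite_PiE)
  also have "\<dots> = nat (2 * K + 1) ^ DIM('m)"
    by (simp add: card_PiE)
  finally have "real (card A) \<le> real (nat (2 * K + 1)) ^ DIM('m)"
    by (simp add: of_nat_power[symmetric] del: of_nat_power)
  also have "\<dots> \<le> (4 * D * C / \<delta> + 3) ^ DIM('m)"
  proof (rule power_mono)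
    have "of_int K \<le> C * s + 1" unfolding K_def by linarith
    then have "2 * of_int K + 1 \<le> 2 * (C * s) + 3" by simp
    also have "2 * (C * s) + 3 = 4 * D * C / \<delta> + 3" by (simp add: s_def)
    finally show "real (nat (2 * K + 1)) \<le> 4 * D * C / \<delta> + 3" using K0 by simp
  qed simp
  finally show ?thesis unfolding D_def .
qed

lemma linear_less_power2: "\<exists>j. a + b * j < (2::nat) ^ j"
proof -
  \<comment> \<open>For \<open>j = 2 * i\<close> the left side is at most \<open>i + i * i\<close>,
    which is less than \<open>(i + 1) * (i + 1)\<close> and hence than
    \<open>2 ^ i * 2 ^ i\<close>.\<close>
  define i where "i = a + 2 * b + 1"
  have i: "a \<le> i" "2 * b \<le> i" unfolding i_def by simp_all
  have "b * (2 * i) = 2 * b * i" by simp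
  also have "\<dots> \<le> i * i" by (rule mult_le_mono1[OF i(2)])
  finally have "a + b * (2 * i) \<le> i + i * i" using i(1) by (rule add_mono[rotated])
  also have "\<dots> < (i + 1) * (i + 1)" by simp
  also have "\<dots> \<le> 2 ^ i * 2 ^ i"
    using Suc_leI[OF less_exp[of i]] by (intro mult_le_mono) simp_all
  also have "\<dots> = 2 ^ (2 * i)" by (simp add: power_add[symmetric] mult_2)
  finally show ?thesis by blast
qed

lemma finite_uniform_bound:
  assumes "finite A" "\<And>a. a \<in> A \<Longrightarrow> \<exists>m::nat. P a m" "\<And>a m m'. \<lbrakk>P a m; m \<le> m'\<rbrakk> \<Longrightarrow> P a m'"
  shows "\<exists>m. \<forall>a\<in>A. P a m"
  using assms(1,2)
proof (induction A)
  case (insert a A)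
  then obtain m m' where m: "\<forall>a\<in>A. P a m" "P a m'" by (metis insert_iff)
  have "P b (max m m')" if "b \<in> insert a A" for b
    using that m assms(3)[of b m "max m m'"] assms(3)[of b m' "max m m'"] by auto
  then show ?case by blast
qed simp

lemma open_contains_cylinder:
  assumes "openin (subtree_space n) \<Omega>" "t \<in> \<Omega>"
  shows "\<exists>m. \<forall>t'\<in>tspace n. agree n m t t' \<longrightarrow> t' \<in> \<Omega>"
  using assms unfolding openin_subtree_space by (elim conjE ballE[where x = t]) simp_all

context foliated_embedding
begin

text \<open>
  As the space of trees is compact and ultrametric, one foliation chart can be chosen on each ball
  of a fixed radius.
\<close>

lemma global_coordinates:
  assumes \<tau>: "continuous_map (subtree_space n) M \<tau>"
  shows "\<exists>m0 U \<phi>. (\<forall>t\<in>tspace n. (U t, \<phi> t) \<in> \<A> \<and> f (\<tau> t) \<in> U t) \<and>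
    (\<forall>t t'. agree n m0 t t' \<longrightarrow> U t' = U t \<and> \<phi> t' = \<phi> t)"
proof -
  have "\<exists>m. \<forall>t\<in>tspace n. \<exists>c. c \<in> \<A> \<and> (\<forall>t'\<in>tspace n. agree n m t t' \<longrightarrow> f (\<tau> t') \<in> fst c)"
  proof (rule tspace_uniform)
    fix t assume t: "t \<in> tspace n"
    then have "\<tau> t \<in> topspace M"
      using continuous_map_image_subset_topspace[OF \<tau>] by blast
    then obtain U \<phi> where c: "(U, \<phi>) \<in> \<A>" "f (\<tau> t) \<in> U"
      using fol_chart_exists[OF f_in_topspace] by metis
    have "continuous_map (subtree_space n) N (\<lambda>t. f (\<tau> t))"
      using continuous_map_compose[OF \<tau> continuous_f] by (simp add: comp_def)
    then have op: "openin (subtree_space n) {t' \<in> tspace n. f (\<tau> t') \<in> U}"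
      by (rule openin_continuous_map_preimage[OF _ fol_chart(1)[OF c(1)]])
    have mem: "t \<in> {t' \<in> tspace n. f (\<tau> t') \<in> U}" using t c by simp
    from open_contains_cylinder[OF op mem]
    obtain m where m: "\<forall>t'\<in>tspace n. agree n m t t' \<longrightarrow> t' \<in> {t' \<in> tspace n. f (\<tau> t') \<in> U}" ..
    then show "\<exists>m. \<exists>c. c \<in> \<A> \<and> (\<forall>t'\<in>tspace n. agree n m t t' \<longrightarrow> f (\<tau> t') \<in> fst c)"
      using c(1) by (intro exI[of _ m] exI[of _ "(U, \<phi>)"]) auto
  next
    fix t t' m m' assume mm: "m \<le> m'" "agree n m t t'"
      and "\<exists>c. c \<in> \<A> \<and> (\<forall>s\<in>tspace n. agree n m t s \<longrightarrow> f (\<tau> s) \<in> fst c)"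
    then obtain c where c: "c \<in> \<A>" "\<And>s. \<lbrakk>s \<in> tspace n; agree n m t s\<rbrakk> \<Longrightarrow> f (\<tau> s) \<in> fst c" by blast
    have "f (\<tau> s) \<in> fst c" if "s \<in> tspace n" "agree n m' t' s" for s
      using c(2)[OF that(1)] agree_trans[OF mm(2) agree_mono[OF that(2) mm(1)]] by simp
    then show "\<exists>c. c \<in> \<A> \<and> (\<forall>s\<in>tspace n. agree n m' t' s \<longrightarrow> f (\<tau> s) \<in> fst c)"
      using c(1) by blast
  qed
  then obtain m0 where m0: "\<And>t. t \<in> tspace n \<Longrightarrow>
      \<exists>c. c \<in> \<A> \<and> (\<forall>t'\<in>tspace n. agree n m0 t t' \<longrightarrow> f (\<tau> t') \<in> fst c)"
    by blast
  \<comment> \<open>The predicate depends on \<open>t\<close> only through its ball of radius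
    \<open>m0\<close>, so the choice returns literally the same chart for trees that agree
    there.\<close>
  define ch where "ch t = (SOME c. c \<in> \<A> \<and> (\<forall>t'\<in>tspace n. agree n m0 t t' \<longrightarrow> f (\<tau> t') \<in> fst c))" for t
  have ch: "ch t \<in> \<A>" "\<And>t'. \<lbrakk>t' \<in> tspace n; agree n m0 t t'\<rbrakk> \<Longrightarrow> f (\<tau> t') \<in> fst (ch t)"
    if "t \<in> tspace n" for t
    using someI_ex[OF m0[OF that]] unfolding ch_def by simp_all
  have eq: "ch t' = ch t" if "agree n m0 t t'" for t t'
    using that unfolding ch_def agree_def by simp
  have "\<forall>t\<in>tspace n. (fst (ch t), snd (ch t)) \<in> \<A> \<and> f (\<tau> t) \<in> fst (ch t)"
    using ch by simp
  moreover have "\<forall>t t'. agree n m0 t t' \<longrightarrow> fst (ch t') = fst (ch t) \<and> snd (ch t') = snd (ch t)"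
    using eq by simp
  ultimately show ?thesis
    by (intro exI[of _ m0] exI[of _ "\<lambda>t. fst (ch t)"] exI[of _ "\<lambda>t. snd (ch t)"] conjI)
qed

text \<open>The depths come from compactness: \<open>m1\<close> for a common Lipschitz bound of the
  letters, \<open>m2\<close> for separating trees by their plaques, \<open>m4\<close> for a common
  lower bound on the transverse distance of trees that first differ just beyond
  \<open>m3\<close>.\<close>

lemma no_translation_transversal:
  assumes n: "2 \<le> n" and ct: "complete_transversal M X chart (subtree_space n) \<tau>"
    and hol: "holonomy_pseudogroup M chart (subtree_space n) \<tau> = translation_pseudogroup n"
  shows False
proof -
  have \<tau>: "continuous_map (subtree_space n) M \<tau>"
    by (rule complete_transversal_continuous[OF ct])
  obtain m0 U \<phi> where chart': "\<forall>t\<in>tspace n. (U t, \<phi> t) \<in> \<A> \<and> f (\<tau> t) \<in> U t"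
    and loc: "\<forall>t t'. agree n m0 t t' \<longrightarrow> U t' = U t \<and> \<phi> t' = \<phi> t"
    using global_coordinates[OF \<tau>] by (elim exE conjE) (rule that)
  have chart: "(U t, \<phi> t) \<in> \<A>" "f (\<tau> t) \<in> U t" if "t \<in> tspace n" for t
    using chart' that by simp_all
  \<comment> \<open>Each tree is placed in the chart of its own cylinder. Differences of
    \<open>c\<close> measure distances in the foliation for trees with a common chart, in particular
    for trees agreeing to depth \<open>m0\<close>.\<close>
  define c where "c t = \<phi> t (f (\<tau> t))" for t
  have c_eq: "c t' = \<phi> t (f (\<tau> t'))" if "t \<in> tspace n" "t' \<in> tspace n" "agree n m0 t t'" for t t'
    unfolding c_def using loc that(3) by simp
  have cont: "\<exists>m. \<forall>t'\<in>tspace n. agree n m t t' \<longrightarrow> dist (c t') (c t) < \<epsilon>"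
    if t: "t \<in> tspace n" and \<epsilon>: "0 < \<epsilon>" for t \<epsilon>
  proof -
    have op: "openin (subtree_space n) {t' \<in> tspace n. \<tau> t' \<in> {z \<in> topspace M. f z \<in> U t \<and> \<phi> t (f z) \<in> ball (c t) \<epsilon>}}"
      by (rule openin_continuous_map_preimage[OF \<tau> openin_preimage_ball[OF chart(1)[OF t] open_ball]])
    have "\<tau> t \<in> topspace M"
      using continuous_map_image_subset_topspace[OF \<tau>] t by blast
    then have mem: "t \<in> {t' \<in> tspace n. \<tau> t' \<in> {z \<in> topspace M. f z \<in> U t \<and> \<phi> t (f z) \<in> ball (c t) \<epsilon>}}"
      using t chart(2)[OF t] \<epsilon> by (simp add: c_def)
    from open_contains_cylinder[OF op mem] obtain m where m: "\<forall>t'\<in>tspace n. agree n m t t' \<longrightarrow>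
        t' \<in> {t' \<in> tspace n. \<tau> t' \<in> {z \<in> topspace M. f z \<in> U t \<and> \<phi> t (f z) \<in> ball (c t) \<epsilon>}}" ..
    have "dist (c t') (c t) < \<epsilon>" if t': "t' \<in> tspace n" "agree n (max m m0) t t'" for t'
    proof -
      have "agree n m t t'" "agree n m0 t t'" using agree_mono[OF t'(2)] by simp_all
      then show ?thesis using m[rule_format, OF t'(1)] c_eq[OF t t'(1)] by (simp add: dist_commute)
    qed
    then show ?thesis by blast
  qed
  \<comment> \<open>One parameter serves as depth and as bound, which makes the property monotone in
    the form that \<open>tspace_uniform\<close> expects.\<close>
  have "\<exists>m. \<forall>t\<in>tspace n. \<forall>t'\<in>tspace n. agree n m t t' \<longrightarrow> norm (c t') \<le> real m"
  proof (rule tspace_uniform)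
    fix t assume t: "t \<in> tspace n"
    obtain m where m: "\<forall>t'\<in>tspace n. agree n m t t' \<longrightarrow> dist (c t') (c t) < 1"
      using cont[OF t, of 1] by auto
    obtain k where k: "norm (c t) + 1 \<le> real k" using real_arch_simple by blast
    have "norm (c t') \<le> real (max m k)" if t': "t' \<in> tspace n" "agree n (max m k) t t'" for t'
    proof -
      have "agree n m t t'" using t'(2) by (rule agree_mono) simp
      then have "dist (c t') (c t) < 1" using m t'(1) by blast
      then have "norm (c t') \<le> norm (c t) + 1"
        using norm_triangle_sub[of "c t'" "c t"] by (simp add: dist_norm)
      then show ?thesis using k by simp
    qed
    then show "\<exists>m. \<forall>t'\<in>tspace n. agree n m t t' \<longrightarrow> norm (c t') \<le> real m" by blast
  next
    fix t t' m m' assume mm: "m \<le> m'" "agree n m t t'"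
      and b: "\<forall>s\<in>tspace n. agree n m t s \<longrightarrow> norm (c s) \<le> real m"
    show "\<forall>s\<in>tspace n. agree n m' t' s \<longrightarrow> norm (c s) \<le> real m'"
    proof (intro ballI impI)
      fix s assume s: "s \<in> tspace n" "agree n m' t' s"
      then have "norm (c s) \<le> real m"
        using b agree_trans[OF mm(2) agree_mono[OF s(2) mm(1)]] by simp
      then show "norm (c s) \<le> real m'" using mm(1) by simp
    qed
  qed
  then obtain C :: nat where C: "\<And>t. t \<in> tspace n \<Longrightarrow> norm (c t) \<le> real C"
    using agree_refl by blast
  \<comment> \<open>Again \<open>m\<close> is both the radius of the cylinder and the Lipschitz
    constant.\<close>
  define step where "step a m t \<longleftrightarrow> (\<forall>t1\<in>tspace n. \<forall>t2\<in>tspace n. agree n m t t1 \<and> agree n m t t2 \<and>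
      [a] \<in> \<Union> t1 \<and> [a] \<in> \<Union> t2 \<longrightarrow>
      infdist (c (pull n [a] t1) - c (pull n [a] t2)) E \<le> real m * infdist (c t1 - c t2) E)" for a m t
  have step_mono: "step a m' t'" if "step a m t" and mm: "m \<le> m'" "agree n m t t'" for a m m' t t'
    unfolding step_def
  proof (intro ballI impI, elim conjE)
    fix t1 t2 assume t12: "t1 \<in> tspace n" "t2 \<in> tspace n" "agree n m' t' t1" "agree n m' t' t2"
      "[a] \<in> \<Union> t1" "[a] \<in> \<Union> t2"
    then have "agree n m t t1" "agree n m t t2"
      using agree_trans[OF mm(2) agree_mono[OF _ mm(1)]] by blast+
    then have "infdist (c (pull n [a] t1) - c (pull n [a] t2)) E \<le> real m * infdist (c t1 - c t2) E"
      using \<open>step a m t\<close> t12 unfolding step_def by blast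
    also have "\<dots> \<le> real m' * infdist (c t1 - c t2) E"
      using mm(1) infdist_nonneg by (intro mult_right_mono) simp_all
    finally show "infdist (c (pull n [a] t1) - c (pull n [a] t2)) E \<le> real m' * infdist (c t1 - c t2) E" .
  qed
  have "\<exists>m. \<forall>t\<in>tspace n. step a m t" if a: "a \<in> letters n" for a
  proof (rule tspace_uniform)
    have ac: "[a] \<in> carrier (free_group n)" by (rule letter_closed[OF a])
    fix t assume t: "t \<in> tspace n"
    show "\<exists>m. step a m t"
    proof (cases "[a] \<in> \<Union> t")
      case False
      \<comment> \<open>Depth \<open>2\<close> reveals whether \<open>[a]\<close> is a vertex, so
        near such a tree the condition is vacuous.\<close>
      have "[a] \<notin> \<Union> t1" if "t1 \<in> tspace n" "agree n 2 t t1" for t1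
        using agree_vertex[OF tspace_subset[OF that(1)] agree_sym[OF that(2)], of "[a]"] False by auto
      then show ?thesis unfolding step_def by blast
    next
      case True
      have pt: "pull n [a] t \<in> tspace n" by (rule pull_tspace[OF t True])
      have "translation n [a] \<in> holonomy_pseudogroup M chart (subtree_space n) \<tau>"
        unfolding hol translation_pseudogroup_eq using a by (intro generator_in_generated_pseudogroup) simp
      then have bil: "transversely_bilipschitz (subtree_space n) \<tau> (translation n [a])"
        by (rule holonomy_pseudogroup_transversely_bilipschitz[OF \<tau>])
      have mem: "(t1, pull n [a] t1) \<in> translation n [a]" if "t1 \<in> tspace n" "[a] \<in> \<Union> t1" for t1
        unfolding translation_eq[OF ac] graph_on_def using that by blast
      obtain \<Omega> L where \<Omega>: "openin (subtree_space n) \<Omega>" "t \<in> \<Omega>" "0 < L"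
        and L: "bilipschitz_near \<tau> (translation n [a]) (\<phi> t) (\<phi> (pull n [a] t)) \<Omega> L"
        by (rule transversely_bilipschitzD[OF bil mem[OF t True] chart(1)[OF t] chart(1)[OF pt]
              chart(2)[OF t] chart(2)[OF pt]])
      obtain m where m: "\<And>t'. \<lbrakk>t' \<in> tspace n; agree n m t t'\<rbrakk> \<Longrightarrow> t' \<in> \<Omega>"
        using open_contains_cylinder[OF \<Omega>(1,2)] by blast
      obtain k where k: "L \<le> real k" using real_arch_simple by blast
      \<comment> \<open>Depth \<open>Suc m0\<close> leaves \<open>m0\<close> after a translation by
        one letter, so that source and target are both seen in the charts of \<open>t\<close> and of
        its translate.\<close>
      define m' where "m' = max (max m k) (Suc m0)"
      have "step a m' t"
        unfolding step_def
      proof (intro ballI impI, elim conjE)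
        fix t1 t2 assume t12: "t1 \<in> tspace n" "t2 \<in> tspace n" "agree n m' t t1" "agree n m' t t2"
          "[a] \<in> \<Union> t1" "[a] \<in> \<Union> t2"
        have near: "s \<in> \<Omega>" "c s = \<phi> t (f (\<tau> s))" "c (pull n [a] s) = \<phi> (pull n [a] t) (f (\<tau> (pull n [a] s)))"
          if s: "s \<in> tspace n" "agree n m' t s" "[a] \<in> \<Union> s" for s
        proof -
          have ag: "agree n m t s" "agree n m0 t s" "agree n (m0 + length [a]) t s"
            using s(2) by (rule agree_mono; simp add: m'_def)+
          show "s \<in> \<Omega>" by (rule m[OF s(1) ag(1)])
          show "c s = \<phi> t (f (\<tau> s))" by (rule c_eq[OF t s(1) ag(2)])
          show "c (pull n [a] s) = \<phi> (pull n [a] t) (f (\<tau> (pull n [a] s)))"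
            using s t ag(3) ac by (intro c_eq pt pull_tspace agree_pull tspace_subset)
        qed
        have "infdist (c (pull n [a] t1) - c (pull n [a] t2)) E \<le> L * infdist (c t1 - c t2) E"
          using L[rule_format, of t1 "pull n [a] t1" t2 "pull n [a] t2"] mem[OF t12(1,5)] mem[OF t12(2,6)]
            near(1)[OF t12(1,3,5)] near(1)[OF t12(2,4,6)]
          unfolding near(2,3)[OF t12(1,3,5)] near(2,3)[OF t12(2,4,6)] by simp
        also have "\<dots> \<le> real m' * infdist (c t1 - c t2) E"
          using k infdist_nonneg by (intro mult_right_mono) (auto simp: m'_def)
        finally show "infdist (c (pull n [a] t1) - c (pull n [a] t2)) E \<le> real m' * infdist (c t1 - c t2) E" .
      qed
      then show ?thesis ..
    qed
  qed (rule step_mono)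
  note ex_step = this
  have "\<exists>m. \<forall>a\<in>letters n. \<forall>t\<in>tspace n. step a m t"
  proof (rule finite_uniform_bound)
    show "\<exists>m. \<forall>t\<in>tspace n. step a m t" if "a \<in> letters n" for a by (rule ex_step[OF that])
    show "\<forall>t\<in>tspace n. step a m' t" if "\<forall>t\<in>tspace n. step a m t" "m \<le> m'" for a m m'
      using step_mono[OF _ that(2) agree_refl] that(1) by blast
  qed simp
  then obtain m1 where m1: "\<And>a t. \<lbrakk>a \<in> letters n; t \<in> tspace n\<rbrakk> \<Longrightarrow> step a m1 t" by blast
  have "\<exists>m. \<forall>t\<in>tspace n. \<forall>t1\<in>tspace n. \<forall>t2\<in>tspace n.
      agree n m t t1 \<and> agree n m t t2 \<and> c t1 - c t2 \<in> E \<longrightarrow> t1 = t2"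
  proof (rule tspace_uniform)
    fix t assume t: "t \<in> tspace n"
    obtain \<Omega> where \<Omega>: "openin (subtree_space n) \<Omega>" "t \<in> \<Omega>"
      "\<And>u u'. \<lbrakk>u \<in> \<Omega>; u' \<in> \<Omega>; \<phi> t (f (\<tau> u)) - \<phi> t (f (\<tau> u')) \<in> E\<rbrakk> \<Longrightarrow> u = u'"
      using transversal_separated[OF ct \<tau> t chart(1)[OF t] chart(2)[OF t]] by metis
    obtain m where m: "\<And>t'. \<lbrakk>t' \<in> tspace n; agree n m t t'\<rbrakk> \<Longrightarrow> t' \<in> \<Omega>"
      using open_contains_cylinder[OF \<Omega>(1,2)] by blast
    have "t1 = t2" if "t1 \<in> tspace n" "t2 \<in> tspace n" "agree n (max m m0) t t1" "agree n (max m m0) t t2"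
      "c t1 - c t2 \<in> E" for t1 t2
    proof -
      have "agree n m t t1" "agree n m0 t t1" "agree n m t t2" "agree n m0 t t2"
        using agree_mono[OF that(3)] agree_mono[OF that(4)] by simp_all
      then show ?thesis
        using \<Omega>(3)[OF m[OF that(1)] m[OF that(2)]] that(5) c_eq[OF t that(1)] c_eq[OF t that(2)] by simp
    qed
    then show "\<exists>m. \<forall>t1\<in>tspace n. \<forall>t2\<in>tspace n.
      agree n m t t1 \<and> agree n m t t2 \<and> c t1 - c t2 \<in> E \<longrightarrow> t1 = t2" by blast
  next
    fix t t' m m' assume mm: "m \<le> m'" "agree n m t t'" and inj: "\<forall>t1\<in>tspace n. \<forall>t2\<in>tspace n.
      agree n m t t1 \<and> agree n m t t2 \<and> c t1 - c t2 \<in> E \<longrightarrow> t1 = t2"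
    have "agree n m t s" if "agree n m' t' s" for s
      using agree_trans[OF mm(2) agree_mono[OF that mm(1)]] .
    then show "\<forall>t1\<in>tspace n. \<forall>t2\<in>tspace n.
      agree n m' t' t1 \<and> agree n m' t' t2 \<and> c t1 - c t2 \<in> E \<longrightarrow> t1 = t2" using inj by simp
  qed
  then obtain m2 where m2: "\<And>t1 t2. \<lbrakk>t1 \<in> tspace n; t2 \<in> tspace n; agree n m2 t1 t2; c t1 - c t2 \<in> E\<rbrakk> \<Longrightarrow> t1 = t2"
    using agree_refl by metis
  \<comment> \<open>At this depth the Lipschitz bound and the separation by plaques both apply;
    \<open>Suc\<close> makes it positive, as the counting of trees requires.\<close>
  define m3 where "m3 = Suc (max m1 m2)"
  \<comment> \<open>Pairs that first differ at level \<open>Suc m3\<close> form a compact set on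
    which the transverse distance is positive; \<open>far\<close> prepares the proof of a common
    lower bound there.\<close>
  define rel where "rel t1 t2 \<longleftrightarrow> agree n m3 t1 t2 \<and> \<not> agree n (Suc m3) t1 t2" for t1 t2
  define far where "far m t1 t2 \<longleftrightarrow> (\<forall>s1\<in>tspace n. \<forall>s2\<in>tspace n. agree n m t1 s1 \<and> agree n m t2 s2 \<and> rel s1 s2 \<longrightarrow>
      1 / (real m + 1) \<le> infdist (c s1 - c s2) E)" for m t1 t2
  have far_mono: "far m' t1' t2'"
    if far: "far m t1 t2" and mm: "m \<le> m'" "agree n m t1 t1'" "agree n m t2 t2'"
    for m m' t1 t1' t2 t2'
    unfolding far_def
  proof (intro ballI impI, elim conjE)
    fix s1 s2 assume s: "s1 \<in> tspace n" "s2 \<in> tspace n" "agree n m' t1' s1" "agree n m' t2' s2" "rel s1 s2"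
    have "agree n m t1 s1" "agree n m t2 s2"
      using agree_trans[OF mm(2) agree_mono[OF s(3) mm(1)]] agree_trans[OF mm(3) agree_mono[OF s(4) mm(1)]] .
    then have "1 / (real m + 1) \<le> infdist (c s1 - c s2) E"
      using far s unfolding far_def by blast
    moreover have "1 / (real m' + 1) \<le> 1 / (real m + 1)" using mm(1) by (simp add: frac_le)
    ultimately show "1 / (real m' + 1) \<le> infdist (c s1 - c s2) E" by simp
  qed
  have far: "\<exists>m. far m t1 t2" if t: "t1 \<in> tspace n" "t2 \<in> tspace n" for t1 t2
  proof (cases "rel t1 t2")
    case False
    \<comment> \<open>\<open>rel\<close> is determined by the balls of radius \<open>Suc m3\<close>,
      so near an unrelated pair there is nothing to show.\<close>
    have "\<not> rel s1 s2" if s: "agree n (Suc m3) t1 s1" "agree n (Suc m3) t2 s2" for s1 s2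
    proof
      assume r: "rel s1 s2"
      have s': "agree n m3 t1 s1" "agree n m3 t2 s2" using s agree_mono by (metis le_SucI order_refl)+
      have "agree n m3 t1 t2"
        using r s' agree_trans[OF agree_trans[OF s'(1)] agree_sym[OF s'(2)]] unfolding rel_def by blast
      moreover have "\<not> agree n (Suc m3) t1 t2"
        using r agree_trans[OF agree_trans[OF agree_sym[OF s(1)]] s(2)] unfolding rel_def by blast
      ultimately show False using False unfolding rel_def by blast
    qed
    then show ?thesis unfolding far_def by blast
  next
    case True
    define \<eta> where "\<eta> = infdist (c t1 - c t2) E"
    have "agree n m2 t1 t2" using True unfolding rel_def by (metis agree_mono m3_def le_SucI max.cobounded2)
    moreover have "t1 \<noteq> t2" using True unfolding rel_def by auto
    ultimately have "c t1 - c t2 \<notin> E" using m2[OF t] by blast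
    then have \<eta>: "0 < \<eta>"
      unfolding \<eta>_def using infdist_subspace_eq_0[OF subspace_E] infdist_nonneg by (metis less_eq_real_def)
    \<comment> \<open>Displacing each of the two points by less than \<open>\<eta> / 4\<close>
      leaves at least \<open>\<eta> / 2\<close>, and \<open>k3\<close> makes
      \<open>1 / (real m + 1)\<close> no larger than that.\<close>
    obtain k1 where k1: "\<forall>t'\<in>tspace n. agree n k1 t1 t' \<longrightarrow> dist (c t') (c t1) < \<eta> / 4"
      using cont[OF t(1), of "\<eta> / 4"] \<eta> by auto
    obtain k2 where k2: "\<forall>t'\<in>tspace n. agree n k2 t2 t' \<longrightarrow> dist (c t') (c t2) < \<eta> / 4"
      using cont[OF t(2), of "\<eta> / 4"] \<eta> by auto
    obtain k3 :: nat where k3: "2 / \<eta> \<le> real k3" using real_arch_simple by blast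
    define m where "m = max (max k1 k2) k3"
    have "far m t1 t2"
      unfolding far_def
    proof (intro ballI impI, elim conjE)
      fix s1 s2 assume s: "s1 \<in> tspace n" "s2 \<in> tspace n" "agree n m t1 s1" "agree n m t2 s2" "rel s1 s2"
      have "agree n k1 t1 s1" "agree n k2 t2 s2"
        using agree_mono[OF s(3)] agree_mono[OF s(4)] by (simp_all add: m_def)
      then have d: "dist (c s1) (c t1) < \<eta> / 4" "dist (c s2) (c t2) < \<eta> / 4"
        using k1 k2 s by simp_all
      have "\<eta> \<le> infdist (c s1 - c s2) E + dist (c t1 - c t2) (c s1 - c s2)"
        unfolding \<eta>_def by (rule infdist_triangle)
      also have "dist (c t1 - c t2) (c s1 - c s2) \<le> dist (c s1) (c t1) + dist (c s2) (c t2)"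
        unfolding dist_norm
        using norm_triangle_ineq4[of "c t1 - c s1" "c t2 - c s2"]
        by (simp add: norm_minus_commute algebra_simps)
      finally have ge: "\<eta> / 2 \<le> infdist (c s1 - c s2) E" using d by simp
      have "2 / \<eta> \<le> real m + 1" using k3 unfolding m_def by simp
      then have "1 / (real m + 1) \<le> \<eta> / 2" using \<eta> by (simp add: field_simps)
      then show "1 / (real m + 1) \<le> infdist (c s1 - c s2) E" using ge by simp
    qed
    then show ?thesis ..
  qed
  \<comment> \<open>Compactness of the product, by applying \<open>tspace_uniform\<close> in one
    variable after the other.\<close>
  have "\<exists>m. \<forall>t1\<in>tspace n. \<forall>t2\<in>tspace n. far m t1 t2"
  proof (rule tspace_uniform)
    show "\<exists>m. \<forall>t2\<in>tspace n. far m t1 t2" if "t1 \<in> tspace n" for t1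
      by (rule tspace_uniform[OF far[OF that]]) (auto intro: far_mono)
  qed (auto intro: far_mono)
  then obtain m4 where m4: "\<And>t1 t2. \<lbrakk>t1 \<in> tspace n; t2 \<in> tspace n\<rbrakk> \<Longrightarrow> far m4 t1 t2" by blast
  define \<epsilon> where "\<epsilon> = 1 / (real m4 + 1)"
  \<comment> \<open>The summand \<open>1\<close> ensures \<open>1 \<le> L\<close>, which lets the
    additive constant of the counting bound be absorbed.\<close>
  define L where "L = real m1 + 1"
  have \<epsilon>: "0 < \<epsilon>" and L: "1 \<le> L" unfolding \<epsilon>_def L_def by simp_all
  have sep: "\<epsilon> \<le> L ^ j * infdist (c t1 - c t2) E"
    if "t1 \<in> tspace n" "t2 \<in> tspace n" "agree n (m3 + j) t1 t2" "\<not> agree n (Suc (m3 + j)) t1 t2" for j t1 t2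
    using that
  proof (induction j arbitrary: t1 t2)
    case 0
    then have "rel t1 t2" unfolding rel_def by simp
    then show ?case
      using m4[OF 0(1,2)] 0(1,2) unfolding far_def \<epsilon>_def by simp
  next
    case (Suc j)
    obtain a where a: "a \<in> letters n" "[a] \<in> \<Union> t1" "[a] \<in> \<Union> t2"
      "agree n (m3 + j) (pull n [a] t1) (pull n [a] t2)" "\<not> agree n (Suc (m3 + j)) (pull n [a] t1) (pull n [a] t2)"
      using agree_step[of t1 n t2 "m3 + j"] Suc.prems by auto
    \<comment> \<open>Every pair in the induction still agrees to depth at least \<open>m3\<close>,
      and \<open>m3\<close> exceeds \<open>m1\<close>; so the same Lipschitz bound applies at each
      letter.\<close>
    have "agree n m1 t1 t2" using Suc.prems(3) by (rule agree_mono) (simp add: m3_def)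
    then have "infdist (c (pull n [a] t1) - c (pull n [a] t2)) E \<le> real m1 * infdist (c t1 - c t2) E"
      using m1[OF a(1) Suc.prems(1)] Suc.prems(1,2) a(2,3) unfolding step_def by simp
    also have "\<dots> \<le> L * infdist (c t1 - c t2) E"
      unfolding L_def by (intro mult_right_mono infdist_nonneg) simp
    finally have le: "infdist (c (pull n [a] t1) - c (pull n [a] t2)) E \<le> L * infdist (c t1 - c t2) E" .
    have "\<epsilon> \<le> L ^ j * infdist (c (pull n [a] t1) - c (pull n [a] t2)) E"
      using Suc.IH[OF pull_tspace[OF Suc.prems(1) a(2)] pull_tspace[OF Suc.prems(2) a(3)] a(4,5)] .
    also have "\<dots> \<le> L ^ j * (L * infdist (c t1 - c t2) E)"
      using le L by (intro mult_left_mono) simp_all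
    finally show ?case by (simp add: mult_ac)
  qed
  define d where "d = DIM('m)"
  \<comment> \<open>Obtained from \<open>card_separated_le\<close> with separation
    \<open>\<epsilon> / L ^ j\<close>, after estimating \<open>3\<close> by
    \<open>3 * L ^ j\<close>.\<close>
  define G where "G = 4 * real d * real C / \<epsilon> + 3"
  have G: "0 \<le> G" unfolding G_def using \<epsilon> by simp
  have bound: "2 ^ (2 ^ (m3 + j)) \<le> (G * L ^ j) ^ d" for j
  proof -
    obtain A where A: "A \<subseteq> tspace n" "card A = 2 ^ (2 ^ (m3 + j))"
      "\<forall>t\<in>A. \<forall>t'\<in>A. agree n (m3 + j) t t' \<and> (t \<noteq> t' \<longrightarrow> \<not> agree n (Suc (m3 + j)) t t')"
      using many_trees[OF n, of "m3 + j"] unfolding m3_def by auto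
    have "finite A" using A(2) by (metis card.infinite power_not_zero zero_neq_numeral)
    moreover have Lj: "0 < L ^ j" "1 \<le> L ^ j" using L by simp_all
    moreover have "\<epsilon> / L ^ j \<le> norm (c t - c t')" if t: "t \<in> A" "t' \<in> A" "t \<noteq> t'" for t t'
    proof -
      have "\<epsilon> \<le> L ^ j * infdist (c t - c t') E" using sep A(1,3) t by blast
      also have "\<dots> \<le> L ^ j * norm (c t - c t')"
        using Lj by (intro mult_left_mono infdist_subspace_le_norm[OF subspace_E]) simp
      finally show ?thesis using Lj(1) by (simp add: field_simps)
    qed
    ultimately have "real (card A) \<le> (4 * real DIM('m) * real C / (\<epsilon> / L ^ j) + 3) ^ DIM('m)"
      using C A(1) \<epsilon> by (intro card_separated_le) auto
    also have "\<dots> \<le> (G * L ^ j) ^ DIM('m)"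
    proof (rule power_mono)
      have "4 * real DIM('m) * real C / (\<epsilon> / L ^ j) + 3 \<le> 4 * real d * real C / \<epsilon> * L ^ j + 3 * L ^ j"
        using Lj(2) by (simp add: d_def)
      then show "4 * real DIM('m) * real C / (\<epsilon> / L ^ j) + 3 \<le> G * L ^ j"
        unfolding G_def by (simp add: algebra_simps)
    qed (use \<epsilon> Lj in simp)
    finally show ?thesis unfolding A(2) d_def by simp
  qed
  \<comment> \<open>With powers of \<open>2\<close> as upper bounds, both sides become powers of
    \<open>2\<close> and the contradiction is a comparison of exponents: exponential against linear
    in \<open>j\<close>.\<close>
  obtain g l :: nat where g: "G \<le> 2 ^ g" and l: "L \<le> 2 ^ l"
    using real_arch_pow[of 2 G] real_arch_pow[of 2 L]
    by (metis less_eq_real_def numeral_less_iff one_less_numeral_iff semiring_norm(76))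
  obtain j where j: "d * g + d * l * j < 2 ^ j" using linear_less_power2 by blast
  have "(2::real) ^ (2 ^ (m3 + j)) \<le> (G * L ^ j) ^ d" by (rule bound)
  also have "\<dots> \<le> (2 ^ g * (2 ^ l) ^ j) ^ d"
    using g l G L by (intro power_mono mult_mono) simp_all
  also have "\<dots> = 2 ^ (d * g + d * l * j)"
    by (simp add: power_mult[symmetric] power_add[symmetric] algebra_simps)
  finally have "2 ^ (m3 + j) \<le> d * g + d * l * j" by simp
  moreover have "(2::nat) ^ j \<le> 2 ^ (m3 + j)" by simp
  ultimately show False using j by linarith
qed

end

theorem theorem8p3:
  fixes n :: nat
    and M :: "'a topology" and X :: "'x metric"
    and chart :: "'a \<Rightarrow> ('a, real ^ 2, 'x) foliated_chart"
    and \<tau> :: "subgraph \<Rightarrow> 'a"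
  assumes "n \<ge> 2"
    and "matchbox_manifold M X chart"
    and "complete_transversal M X chart (subtree_space n) \<tau>"
    and "holonomy_pseudogroup M chart (subtree_space n) \<tau> = translation_pseudogroup n"
  shows "transitive M chart \<and>
    lipschitz_transversal M chart (subtree_space n) \<tau> \<and>
    (\<forall>(N :: 'b topology) (E :: 'm::euclidean_space set) \<A>.
       C1_foliation N E \<A> \<and> dim E = DIM(real ^ 2) \<longrightarrow>
       \<not> homeomorphic_to_invariant_subset M chart N E \<A>)"
proof -
  interpret matchbox_manifold M X chart by (rule assms(2))
  show ?thesis
  proof (intro conjI allI impI notI)
    show "transitive M chart"
      using assms(1,3,4) by (rule transitive_if_translation_pseudogroup)
    show "lipschitz_transversal M chart (subtree_space n) \<tau>"
      using assms(4) by (rule lipschitz_if_translation_pseudogroup)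
    fix N :: "'b topology" and E :: "'m::euclidean_space set" and \<A>
    assume fol: "C1_foliation N E \<A> \<and> dim E = DIM(real ^ 2)"
      and "homeomorphic_to_invariant_subset M chart N E \<A>"
    then obtain K f where K: "invariant_subset E \<A> K" "homeomorphic_map M (subtopology N K) f"
      unfolding homeomorphic_to_invariant_subset_def by blast
    interpret foliated_embedding M X chart N E \<A> K f
      using fol K totally_disconnected by unfold_locales auto
    show False
      using assms(1,3,4) by (rule no_translation_transversal)
  qed
qed

end
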